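(* Let $M$ be a real algebraic (resp. real analytic) generic submanifold of codimension $d\geq 1$ and of CR dimension $m=n-d\geq 1$ in $\mathbb{C}^n$. Then for every point $p_0\in M$, and for every choice of complex affine coordinates $t=(z,w)\in\mathbb{C}^m\times\mathbb{C}^d$ centered at $p_0$ such that $T^c_{p_0}M\cap\{z=0\}=\{0\}$, there exist $\rho_1>0$ and uniquely defined complex algebraic (resp. complex analytic) functions $\Theta_j$, $j=1,\dots,d$, vanishing at the origin, defined and converging normally in $\Delta_{2m+d}(2\rho_1)$, such that $M\cap\Delta_n(\rho_1)$ is given by the $d$ complex defining equations $$\bar w_j=\Theta_j(\bar z,z,w),\qquad j=1,\dots,d,$$ or equivalently by the $d$ conjugate complex defining equations $$w_j=\overline{\Theta}_j(z,\bar z,\bar w),\qquad j=1,\dots,d.$$ Here the vector-valued mapping $\Theta:=(\Theta_1,\dots,\Theta_d)$ satisfies the two conjugate vectorial functional equations (identities of power series) $$\bar w\equiv\Theta(\bar z,z,\overline{\Theta}(z,\bar z,\bar w)),\qquad w\equiv\overline{\Theta}(z,\bar z,\Theta(\bar z,z,w)).$$ Conversely, given a collection $\Theta=(\Theta_1,\dots,\Theta_d)$ of complex algebraic (resp. analytic) functions vanishing at the origin, converging normally in $\Delta_{2m+d}(2\rho_1)$ for some $\rho_1>0$ and satisfying these two functional equations, the set $M:=\{(z,w)\in\Delta_n(\rho_1):\bar w_j=\Theta_j(\bar z,z,w),\ j=1,\dots,d\}$ is a real generic submanifold of codimension $d$. Finally, with these equations, a basis of $(0,1)$ vector fields tangent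 to $M$ is given by $$\overline{L}_k:=\frac{\partial}{\partial\bar z_k}+\sum_{j=1}^d\frac{\partial\Theta_j}{\partial\bar z_k}(\bar z,z,w)\,\frac{\partial}{\partial\bar w_j},\qquad k=1,\dots,m.$$
   Context: $J$ is the complex structure of $T\mathbb{C}^n$ and $T^c_pM:=T_pM\cap JT_pM$. A real submanifold $M\subset\mathbb{C}^n$ of codimension $d$ is generic if $T_pM+JT_pM=T_p\mathbb{C}^n$ for all $p\in M$; its CR dimension is then $m=n-d$. $\Delta_N(\rho)=\{x\in\mathbb{C}^N:\max_k|x_k|<\rho\}$. A convergent power series $\varphi(x)$ is algebraic (in the sense of Nash) if there is a nonzero polynomial $P$ with $P(x,\varphi(x))\equiv0$; real algebraic submanifolds are those locally defined by algebraic power series with independent differentials. For a power series $\Phi(t)=\sum_\gamma\Phi_\gamma t^\gamma$, $\overline{\Phi}(t):=\sum_\gamma\overline{\Phi_\gamma}\,t^\gamma$ is obtained by conjugating the coefficients only.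
   Formalization: In the converse, identities of power series give M generic only in some Δ_n(ρ), 0<ρ≤ρ1; for all of Δ_n(ρ1) the functional equations must hold at every point of Δ(2ρ1) where the composition is defined, since otherwise M can degenerate away from 0. *)

theory Defs
  imports "HOL-Analysis.Analysis"
begin

section \<open>Power series in finitely many variables\<close>

text \<open>
  A power series in the variables indexed by the finite type \<open>'k\<close> is the family of its
  coefficients, indexed by multi-indices \<open>'k \<Rightarrow> nat\<close>. All series are centred at 0.
\<close>

type_synonym ('k, 'a) pseries = "('k \<Rightarrow> nat) \<Rightarrow> 'a"

definition ps_term :: "('k::finite, 'a::real_normed_field) pseries \<Rightarrow> 'a ^ 'k \<Rightarrow> ('k \<Rightarrow> nat) \<Rightarrow> 'a"
  where "ps_term c x \<gamma> = c \<gamma> * (\<Prod>i\<in>UNIV. (x $ i) ^ \<gamma> i)"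

definition ps_sum :: "('k::finite, 'a::real_normed_field) pseries \<Rightarrow> 'a ^ 'k \<Rightarrow> 'a"
  where "ps_sum c x = (\<Sum>\<^sub>\<infinity>\<gamma>. ps_term c x \<gamma>)"

definition polydisc :: "real \<Rightarrow> ('a::real_normed_vector ^ 'k::finite) set"
  where "polydisc \<rho> = {x. \<forall>k. norm (x $ k) < \<rho>}"

text \<open>
  Normal convergence in an open set: on each compact subset, the sup norms of the terms are
  summable. (The restriction to nonempty \<open>K\<close> only avoids the unspecified real \<open>Sup {}\<close>.)
\<close>

definition converges_normally :: "('k::finite, 'a::real_normed_field) pseries \<Rightarrow> real \<Rightarrow> bool"
  where "converges_normally c \<rho> \<longleftrightarrow>
    (\<forall>K. compact K \<and> K \<noteq> {} \<and> K \<subseteq> polydisc \<rho> \<longrightarrow>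
       (\<lambda>\<gamma>. SUP x\<in>K. norm (ps_term c x \<gamma>)) summable_on UNIV)"

definition convergent_ps :: "('k::finite, 'a::real_normed_field) pseries \<Rightarrow> bool"
  where "convergent_ps c \<longleftrightarrow> (\<exists>\<rho>>0. converges_normally c \<rho>)"

definition snoc_vec :: "'a ^ 'k \<Rightarrow> 'a \<Rightarrow> 'a ^ ('k::finite option)"
  where "snoc_vec x y = (\<chi> i. case i of None \<Rightarrow> y | Some k \<Rightarrow> x $ k)"

text \<open>
  A polynomial is a power series with finitely many nonzero coefficients; \<open>P\<close> below has the
  variables of \<open>c\<close> and one more, the index \<open>None\<close>, into which the sum of \<open>c\<close> is substituted.
\<close>

definition algebraic_ps :: "('k::finite, 'a::real_normed_field) pseries \<Rightarrow> bool"
  where "algebraic_ps c \<longleftrightarrow> convergent_ps c \<and>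
    (\<exists>P :: ('k option, 'a) pseries. finite {\<gamma>. P \<gamma> \<noteq> 0} \<and> P \<noteq> (\<lambda>_. 0) \<and>
       (\<forall>\<^sub>F x in nhds 0. ps_sum P (snoc_vec x (ps_sum c x)) = 0))"

datatype regularity = Algebraic | Analytic

definition ps_class :: "regularity \<Rightarrow> ('k::finite, 'a::real_normed_field) pseries \<Rightarrow> bool"
  where "ps_class reg c \<longleftrightarrow>
    (case reg of Algebraic \<Rightarrow> algebraic_ps c | Analytic \<Rightarrow> convergent_ps c)"

definition cnj_ps :: "('k, complex) pseries \<Rightarrow> ('k, complex) pseries"
  where "cnj_ps c = (\<lambda>\<gamma>. cnj (c \<gamma>))"


section \<open>Real submanifolds of complex space\<close>

definition real_coords :: "complex ^ 'n \<Rightarrow> real ^ ('n::finite + 'n)"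
  where "real_coords x = (\<chi> i. case i of Inl k \<Rightarrow> Re (x $ k) | Inr k \<Rightarrow> Im (x $ k))"

text \<open>
  Near each of its points \<open>p\<close> the set \<open>M\<close> is the common zero set of \<open>d\<close> real power series in
  the real coordinates centred at \<open>p\<close>, whose differentials at \<open>p\<close> are linearly independent.
\<close>

definition real_submanifold :: "regularity \<Rightarrow> nat \<Rightarrow> (complex ^ 'n::finite) set \<Rightarrow> bool"
  where "real_submanifold reg d M \<longleftrightarrow>
    (\<forall>p\<in>M. \<exists>\<rho>>0. \<exists>r :: nat \<Rightarrow> ('n + 'n, real) pseries.
       (\<forall>j<d. ps_class reg (r j) \<and> converges_normally (r j) \<rho>) \<and>
       (\<forall>a :: nat \<Rightarrow> real.
          (\<forall>v. (\<Sum>j<d. a j * frechet_derivative (\<lambda>x. ps_sum (r j) (real_coords (x - p))) (at p) v) = 0)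
          \<longrightarrow> (\<forall>j<d. a j = 0)) \<and>
       (\<forall>x. real_coords (x - p) \<in> polydisc \<rho> \<longrightarrow>
          (x \<in> M \<longleftrightarrow> (\<forall>j<d. ps_sum (r j) (real_coords (x - p)) = 0))))"

definition tangent_space :: "(complex ^ 'n::finite) set \<Rightarrow> complex ^ 'n \<Rightarrow> (complex ^ 'n) set"
  where "tangent_space M p =
    {v. \<exists>\<gamma> :: real \<Rightarrow> complex ^ 'n. \<exists>\<epsilon>>0. \<gamma> C1_differentiable_on {-\<epsilon><..<\<epsilon>} \<and>
        (\<forall>t\<in>{-\<epsilon><..<\<epsilon>}. \<gamma> t \<in> M) \<and> \<gamma> 0 = p \<and> (\<gamma> has_vector_derivative v) (at 0)}"

text \<open>The complex structure \<open>J\<close> is multiplication by the imaginary unit.\<close>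

definition complex_tangent_space :: "(complex ^ 'n::finite) set \<Rightarrow> complex ^ 'n \<Rightarrow> (complex ^ 'n) set"
  where "complex_tangent_space M p = tangent_space M p \<inter> (\<lambda>v. \<i> *s v) ` tangent_space M p"

definition generic_submanifold :: "regularity \<Rightarrow> nat \<Rightarrow> (complex ^ 'n::finite) set \<Rightarrow> bool"
  where "generic_submanifold reg d M \<longleftrightarrow> real_submanifold reg d M \<and>
    (\<forall>p\<in>M. {u + \<i> *s v | u v. u \<in> tangent_space M p \<and> v \<in> tangent_space M p} = UNIV)"

definition cnj_vec :: "complex ^ 'n \<Rightarrow> complex ^ 'n::finite"
  where "cnj_vec z = (\<chi> i. cnj (z $ i))"

text \<open>
  The vector with components \<open>c\<close> stands for the sum of the \<open>c\<^sub>i \<partial>/\<partial>\<bar>t\<^sub>i\<close>. Writing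
  \<open>\<partial>/\<partial>\<bar>t\<^sub>i = 1/2 (\<partial>/\<partial>x\<^sub>i + \<i> \<partial>/\<partial>y\<^sub>i)\<close>, its real and imaginary parts are the real tangent
  vectors \<open>1/2 \<bar>c\<close> and \<open>\<i>/2 \<bar>c\<close> (bars denote conjugates). It lies in the complexification of
  the tangent space iff both of these are tangent to \<open>M\<close>.
\<close>

definition tangent_space_01 :: "(complex ^ 'n::finite) set \<Rightarrow> complex ^ 'n \<Rightarrow> (complex ^ 'n) set"
  where "tangent_space_01 M p =
    {c. (1 / 2) *s cnj_vec c \<in> tangent_space M p \<and> (\<i> / 2) *s cnj_vec c \<in> tangent_space M p}"


section \<open>Complex defining equations\<close>

text \<open>
  Points \<open>t = (z, w)\<close> are vectors indexed by \<open>'m + 'd\<close>; the arguments \<open>(\<zeta>, z, w)\<close> of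
  \<open>\<Theta>\<close>, with \<open>\<zeta>\<close> in the place of the conjugate of \<open>z\<close>, are indexed by \<open>'m + 'm + 'd\<close>.
\<close>

definition vjoin :: "'a ^ 'k \<Rightarrow> 'a ^ 'l \<Rightarrow> 'a ^ ('k::finite + 'l::finite)"
  where "vjoin x y = (\<chi> i. case i of Inl k \<Rightarrow> x $ k | Inr l \<Rightarrow> y $ l)"

definition z_part :: "'a ^ ('m::finite + 'd::finite) \<Rightarrow> 'a ^ 'm"
  where "z_part t = (\<chi> k. t $ Inl k)"

type_synonym ('m, 'd) theta = "'d \<Rightarrow> ('m + 'm + 'd, complex) pseries"

definition theta_map :: "('m::finite, 'd::finite) theta \<Rightarrow>
    complex ^ 'm \<Rightarrow> complex ^ 'm \<Rightarrow> complex ^ 'd \<Rightarrow> complex ^ 'd"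
  where "theta_map \<Theta> \<zeta> z w = (\<chi> j. ps_sum (\<Theta> j) (vjoin \<zeta> (vjoin z w)))"

definition cnj_theta :: "('m, 'd) theta \<Rightarrow> ('m, 'd) theta"
  where "cnj_theta \<Theta> = (\<lambda>j. cnj_ps (\<Theta> j))"

definition admissible_theta :: "regularity \<Rightarrow> real \<Rightarrow> ('m::finite, 'd::finite) theta \<Rightarrow> bool"
  where "admissible_theta reg \<rho> \<Theta> \<longleftrightarrow>
    (\<forall>j. ps_class reg (\<Theta> j) \<and> ps_sum (\<Theta> j) 0 = 0 \<and> converges_normally (\<Theta> j) (2 * \<rho>))"

definition theta_set :: "real \<Rightarrow> ('m::finite, 'd::finite) theta \<Rightarrow> (complex ^ ('m + 'd)) set"
  where "theta_set \<rho> \<Theta> =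
    {vjoin z w | z w. vjoin z w \<in> polydisc \<rho> \<and> cnj_vec w = theta_map \<Theta> (cnj_vec z) z w}"

definition cnj_theta_set :: "real \<Rightarrow> ('m::finite, 'd::finite) theta \<Rightarrow> (complex ^ ('m + 'd)) set"
  where "cnj_theta_set \<rho> \<Theta> =
    {vjoin z w | z w. vjoin z w \<in> polydisc \<rho> \<and>
                      w = theta_map (cnj_theta \<Theta>) z (cnj_vec z) (cnj_vec w)}"

text \<open>
  The two functional equations as identities of convergent power series in independent
  variables: \<open>\<zeta>\<close> and \<open>\<omega>\<close> stand for the conjugates of \<open>z\<close> and \<open>w\<close>.
\<close>

definition functional_equations :: "('m::finite, 'd::finite) theta \<Rightarrow> bool"
  where "functional_equations \<Theta> \<longleftrightarrow>
    (\<forall>\<^sub>F (\<zeta>, z, \<omega>) in nhds 0. \<omega> = theta_map \<Theta> \<zeta> z (theta_map (cnj_theta \<Theta>) z \<zeta> \<omega>)) \<and>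
    (\<forall>\<^sub>F (\<zeta>, z, w) in nhds 0. w = theta_map (cnj_theta \<Theta>) z \<zeta> (theta_map \<Theta> \<zeta> z w))"

text \<open>
  The same equations between the functions on the polydisc of radius \<open>\<rho>\<close>, at every point
  where the composition is defined. The power series identities only imply this on the connected
  component of the origin of the domain of the composition, and they do not make all of
  \<open>theta_set (\<rho> / 2) \<Theta>\<close> a submanifold of codimension \<open>d\<close>: for \<open>d = 1\<close> and \<open>\<Theta>\<close> depending on
  \<open>w\<close> only, isolated solutions of \<open>\<bar>w = \<Theta>(w)\<close> can occur away from the origin.
\<close>

definition functional_equations_on :: "real \<Rightarrow> ('m::finite, 'd::finite) theta \<Rightarrow> bool"
  where "functional_equations_on \<rho> \<Theta> \<longleftrightarrow>
    (\<forall>\<zeta> z \<omega>. vjoin \<zeta> (vjoin z \<omega>) \<in> polydisc \<rho> \<and>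
        theta_map (cnj_theta \<Theta>) z \<zeta> \<omega> \<in> polydisc \<rho> \<longrightarrow>
        \<omega> = theta_map \<Theta> \<zeta> z (theta_map (cnj_theta \<Theta>) z \<zeta> \<omega>)) \<and>
    (\<forall>\<zeta> z w. vjoin \<zeta> (vjoin z w) \<in> polydisc \<rho> \<and>
        theta_map \<Theta> \<zeta> z w \<in> polydisc \<rho> \<longrightarrow>
        w = theta_map (cnj_theta \<Theta>) z \<zeta> (theta_map \<Theta> \<zeta> z w))"

definition partial_deriv :: "(complex ^ 'k::finite \<Rightarrow> complex) \<Rightarrow> 'k \<Rightarrow> complex ^ 'k \<Rightarrow> complex"
  where "partial_deriv f i x = deriv (\<lambda>s. f (x + axis i s)) 0"

text \<open>Components with respect to the \<open>\<partial>/\<partial>\<bar>z\<^sub>k\<close> and \<open>\<partial>/\<partial>\<bar>w\<^sub>j\<close>.\<close>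

definition L_bar :: "('m::finite, 'd::finite) theta \<Rightarrow> 'm \<Rightarrow>
    complex ^ 'm \<Rightarrow> complex ^ 'd \<Rightarrow> complex ^ ('m + 'd)"
  where "L_bar \<Theta> k z w =
    vjoin (axis k 1)
      (\<chi> j. partial_deriv (ps_sum (\<Theta> j)) (Inl k) (vjoin (cnj_vec z) (vjoin z w)))"

text \<open>
  A basis of vector fields is a frame: a basis of the (0,1) tangent space at every point. The
  coefficients of a field in this frame are its components along the \<open>\<partial>/\<partial>\<bar>z\<^sub>k\<close>, so they are as
  regular as the field.
\<close>

definition L_bar_basis :: "('m::finite, 'd::finite) theta \<Rightarrow> (complex ^ ('m + 'd)) set \<Rightarrow> bool"
  where "L_bar_basis \<Theta> M \<longleftrightarrow>
    (\<forall>z w. vjoin z w \<in> M \<longrightarrow>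
       inj (\<lambda>k. L_bar \<Theta> k z w) \<and>
       vec.independent (range (\<lambda>k. L_bar \<Theta> k z w)) \<and>
       vec.span (range (\<lambda>k. L_bar \<Theta> k z w)) = tangent_space_01 M (vjoin z w))"

end

theory Submission
  imports Defs "HOL-Complex_Analysis.Conformal_Mappings"
begin

text \<open>
  The set \<open>M\<close> is given near \<open>p\<^sub>0\<close> by real power series in the real and imaginary parts of the
  coordinates. Writing these as \<open>(t + \<bar>t)/2\<close> and \<open>(t - \<bar>t)/2i\<close> and replacing \<open>\<bar>t\<close> by an independent
  variable \<open>\<tau> = (\<zeta>, \<omega>)\<close> gives \<open>d\<close> holomorphic equations \<open>G\<^sub>j(\<zeta>, z, w, \<omega>) = 0\<close>. A vector \<open>\<omega>\<close> in the
  kernel of the differential of \<open>G\<close> with respect to \<open>\<omega>\<close> gives the vector \<open>(0, \<bar>\<omega>)\<close>, all of whose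
  complex multiples are tangent to \<open>M\<close>; since \<open>T\<^sup>cM\<close> meets \<open>{z = 0}\<close> only in \<open>0\<close>, this differential
  is invertible, and the equations can be solved as \<open>\<omega> = \<Theta>(\<zeta>, z, w)\<close> (\<open>theta_exists\<close>,
  \<open>implicit_theta\<close>). The \<open>G\<^sub>j\<close> come from real series, so the complexified set is invariant under
  \<open>(\<zeta>, z, w, \<omega>) \<mapsto> (\<bar>z, \<bar>\<zeta>, \<bar>\<omega>, \<bar>w)\<close>; written for the solution \<open>\<Theta>\<close>, this invariance is the
  functional equation.

  Conversely, the functional equation says that \<open>\<sigma>(\<zeta>, z, w) = (\<bar>z, \<bar>\<zeta>, conj \<Theta>(\<zeta>, z, w))\<close> is an
  antiholomorphic involution, whose fixed points are the points \<open>(\<bar>z, z, w)\<close> with \<open>(z, w) \<in> M\<close>. The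
  locale \<open>theta_point\<close> draws the consequences at one point. The differential of \<open>\<sigma>\<close> is an antilinear
  involution, so its fixed vectors span over the complex numbers
  (\<open>lift_tangent_decomposition\<close>). This gives genericity, the frame of \<open>(0,1)\<close> vectors, and the
  uniqueness of \<open>\<Theta>\<close>: a holomorphic function that vanishes on the fixed points has vanishing partial
  derivatives there, hence only zero coefficients (\<open>theta_unique\<close>). Of the \<open>2d\<close> real equations
  \<open>f = \<bar>w - \<Theta>(\<bar>z, z, w) = 0\<close> the \<open>d\<close> equations \<open>Re(\<mu>f\<^sub>j) = 0\<close> are independent and define the same set, if
  the number \<open>\<mu>\<close> of modulus one avoids finitely many values (\<open>real_equations_suffice\<close>).

  The analytic tools are developed for functions that are continuous and holomorphic in each
  variable. They are closed under partial derivatives, composition and local inversion, and on a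
  polydisc they are sums of normally convergent power series (\<open>mhol_ps_expansion\<close>); so no
  substitution of power series into one another is needed.

  In the algebraic case all functions constructed above must be shown to be algebraic. This rests on
  one counting argument (\<open>tame_dependent\<close>): up to a common denominator, the monomials of degree at most
  \<open>D\<close> in algebraic functions of \<open>k\<close> variables lie in a space of dimension \<open>O(D\<^sup>k)\<close>, so that any \<open>k + 1\<close>
  polynomial combinations of such functions satisfy a polynomial relation. Sums and inverse maps
  are special cases.
\<close>

section \<open>Holomorphic functions of several variables\<close>

text \<open>
  Continuity together with holomorphy in each variable is used as definition because both pass to
  uniform limits; that a complex linear total derivative exists is then a theorem.
\<close>

definition mhol :: "(complex ^ 'k::finite \<Rightarrow> complex) \<Rightarrow> (complex ^ 'k) set \<Rightarrow> bool"
  where "mhol f S \<longleftrightarrow> open S \<and> continuous_on S f \<and>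
    (\<forall>x\<in>S. \<forall>i. (\<lambda>s. f (x + axis i s)) field_differentiable at 0)"

lemma mhol_open: "mhol f S \<Longrightarrow> open S"
  and mhol_continuous_on: "mhol f S \<Longrightarrow> continuous_on S f"
  by (auto simp: mhol_def)

lemma mhol_subset: "mhol f S \<Longrightarrow> open T \<Longrightarrow> T \<subseteq> S \<Longrightarrow> mhol f T"
  unfolding mhol_def using continuous_on_subset by blast

lemma continuous_on_axis: "continuous_on A (\<lambda>s. x + axis i (s::complex))"
proof -
  have "continuous_on A (\<lambda>s. if j = i then s else (0::complex))" for j
    by (cases "j = i") auto
  then show ?thesis unfolding axis_def by (intro continuous_intros)
qed

lemma axis_0_vec [simp]: "axis i (0::'a::zero) = 0"
  by (simp add: axis_def zero_vec_def)

lemma open_axis_preimage: "open S \<Longrightarrow> open {s. x + axis i (s::complex) \<in> S}"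
  using open_vimage[OF _ continuous_on_axis[of UNIV x i]] by (simp add: vimage_def)

lemma axis_add: "axis i (s + t) = axis i s + (axis i t :: 'a::monoid_add ^ 'k)"
  by (simp add: vec_eq_iff axis_def)

lemma mhol_line:
  assumes "mhol f S"
  shows "(\<lambda>s. f (x + axis i s)) holomorphic_on {s. x + axis i s \<in> S}"
  unfolding holomorphic_on_open[OF open_axis_preimage[OF mhol_open[OF assms]]]
proof (intro ballI)
  fix s assume "s \<in> {s. x + axis i s \<in> S}"
  then have "(\<lambda>t. f ((x + axis i s) + axis i t)) field_differentiable at 0"
    using assms by (auto simp: mhol_def)
  then obtain D where "((\<lambda>t. f (x + axis i (s + t))) has_field_derivative D) (at 0)"
    by (auto simp: field_differentiable_def axis_add add.assoc)
  then have "((\<lambda>s. f (x + axis i s)) has_field_derivative D) (at (0 + s))"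
    by (subst DERIV_shift) (simp add: add.commute)
  then show "\<exists>D. ((\<lambda>s. f (x + axis i s)) has_field_derivative D) (at s)" by auto
qed

lemma partial_deriv_axis: "partial_deriv f i (x + axis i s) = deriv (\<lambda>s. f (x + axis i s)) s"
  unfolding partial_deriv_def by (subst (2) deriv_shift_0) (simp add: o_def axis_add add.assoc)

lemma higher_partial_deriv_axis:
  "((\<lambda>f. partial_deriv f i) ^^ n) f (x + axis i s) = (deriv ^^ n) (\<lambda>s. f (x + axis i s)) s"
proof (induction n arbitrary: s)
  case (Suc n)
  have "(\<lambda>s. ((\<lambda>f. partial_deriv f i) ^^ n) f (x + axis i s)) = (deriv ^^ n) (\<lambda>s. f (x + axis i s))"
    using Suc by auto
  then show ?case by (simp add: partial_deriv_axis)
qed simp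

lemma mhol_has_partial:
  assumes "mhol f S" "x + axis i s \<in> S"
  shows "((\<lambda>s. f (x + axis i s)) has_field_derivative partial_deriv f i (x + axis i s)) (at s)"
  unfolding partial_deriv_axis
  using holomorphic_derivI[OF mhol_line[OF assms(1)] open_axis_preimage[OF mhol_open[OF assms(1)]]] assms(2)
  by blast

lemma mholI_locally:
  assumes "\<And>x. x \<in> S \<Longrightarrow> \<exists>T. x \<in> T \<and> T \<subseteq> S \<and> mhol f T"
  shows "mhol f S"
proof -
  have op: "open S"
  proof (rule openI)
    fix x assume "x \<in> S"
    then obtain T where T: "x \<in> T" "T \<subseteq> S" "mhol f T" using assms by blast
    then show "\<exists>e>0. ball x e \<subseteq> S"
      using mhol_open open_contains_ball by (metis subset_trans)
  qed
  have "continuous_on S f"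
    unfolding continuous_on_eq_continuous_at[OF op]
    using assms mhol_continuous_on mhol_open continuous_on_eq_continuous_at by metis
  then show ?thesis unfolding mhol_def using op assms by (metis mhol_def)
qed

lemma norm_axis_vec [simp]: "norm (axis i (s::'a::real_normed_vector) :: 'a ^ 'k::finite) = norm s"
proof -
  have "(\<Sum>j\<in>UNIV. (norm ((axis i s :: 'a ^ 'k) $ j))\<^sup>2) = (\<Sum>j\<in>{i}. (norm s)\<^sup>2)"
    by (rule sum.mono_neutral_cong_right) (auto simp: axis_def)
  then show ?thesis by (simp add: norm_vec_def L2_set_def)
qed

lemma mhol_uniform_limit:
  assumes F: "F \<noteq> bot" and ev: "\<forall>\<^sub>F n in F. mhol (f n) S" and S: "open S"
    and ul: "uniform_limit S f g F"
  shows "mhol g S"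
  unfolding mhol_def
proof (intro conjI ballI allI S)
  show "continuous_on S g"
    by (rule uniform_limit_theorem[OF _ ul F]) (use ev in \<open>auto elim: eventually_mono simp: mhol_def\<close>)
  fix x i assume x: "x \<in> S"
  obtain r where r: "r > 0" "cball x r \<subseteq> S" using S x open_contains_cball by blast
  have sub: "x + axis i s \<in> S" if "s \<in> cball 0 r" for s :: complex
    using r that by (auto simp: subset_iff dist_norm)
  have ul': "uniform_limit (cball 0 r) (\<lambda>n s. f n (x + axis i s)) (\<lambda>s. g (x + axis i s)) F"
    by (rule uniform_limit_compose'[OF ul]) (use sub in auto)
  have "\<forall>\<^sub>F n in F. continuous_on (cball 0 r) (\<lambda>s. f n (x + axis i s)) \<and>
      (\<lambda>s. f n (x + axis i s)) holomorphic_on ball 0 r"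
    using ev
  proof eventually_elim
    case (elim n)
    have "(\<lambda>s. f n (x + axis i s)) holomorphic_on cball 0 r"
      using mhol_line[OF elim] by (rule holomorphic_on_subset) (use sub in auto)
    then show ?case using holomorphic_on_imp_continuous_on holomorphic_on_subset ball_subset_cball by blast
  qed
  from holomorphic_uniform_limit[OF this ul'] F
  have "(\<lambda>s. g (x + axis i s)) holomorphic_on ball 0 r" by auto
  then show "(\<lambda>s. g (x + axis i s)) field_differentiable at 0"
    using \<open>r > 0\<close> by (simp add: holomorphic_on_imp_differentiable_at)
qed

lemma mhol_translate:
  assumes "mhol f S"
  shows "mhol (\<lambda>x. f (x + a)) {x. x + a \<in> S}"
  unfolding mhol_def
proof (intro conjI ballI allI)
  show "open {x. x + a \<in> S}"
    using open_vimage[OF mhol_open[OF assms], of "\<lambda>x. x + a"]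
    by (simp add: vimage_def continuous_intros)
  show "continuous_on {x. x + a \<in> S} (\<lambda>x. f (x + a))"
    by (rule continuous_on_compose2[OF mhol_continuous_on[OF assms]]) (auto intro!: continuous_intros)
  fix x i assume "x \<in> {x. x + a \<in> S}"
  then have "(\<lambda>s. f ((x + a) + axis i s)) field_differentiable at 0" using assms by (auto simp: mhol_def)
  then show "(\<lambda>s. f (x + axis i s + a)) field_differentiable at 0" by (simp add: algebra_simps)
qed

lemma mhol_diff_quot:
  assumes f: "mhol f S" and g: "mhol g S"
  shows "mhol (\<lambda>x. (f x - g x) / c) S"
  unfolding mhol_def
proof (intro conjI ballI allI)
  show "open S" using f mhol_open by blast
  have "continuous_on S (\<lambda>x. inverse c * (f x - g x))"
    using mhol_continuous_on f g by (intro continuous_intros) auto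
  then show "continuous_on S (\<lambda>x. (f x - g x) / c)" by (simp add: field_simps)
  fix x i assume "x \<in> S"
  then show "(\<lambda>s. (f (x + axis i s) - g (x + axis i s)) / c) field_differentiable at 0"
    using f g by (cases "c = 0") (auto simp: mhol_def intro!: derivative_intros field_differentiable_diff field_differentiable_divide)
qed

text \<open>
  By the Cauchy estimate for the second derivative in one variable, the difference quotients
  converge to the partial derivative uniformly near each point, so it is holomorphic as a uniform
  limit of holomorphic functions.
\<close>

theorem mhol_partial_deriv:
  assumes f: "mhol f S"
  shows "mhol (partial_deriv f i) S"
proof (rule mholI_locally)
  fix x0 assume "x0 \<in> S"
  then obtain R where R: "R > 0" "cball x0 R \<subseteq> S"
    using open_contains_cball mhol_open[OF f] by blast
  define r where "r = R / 3"
  have r: "r > 0" "cball x0 (3 * r) \<subseteq> S" using R by (auto simp: r_def)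
  have "compact (f ` cball x0 (3 * r))"
    using mhol_continuous_on[OF f] r by (intro compact_continuous_image) (auto intro: continuous_on_subset)
  then obtain B where B: "\<And>x. x \<in> cball x0 (3 * r) \<Longrightarrow> norm (f x) \<le> B"
    by (meson compact_imp_bounded bounded_iff imageI)
  have inS: "x + axis i s \<in> cball x0 (3 * r)" if "x \<in> ball x0 r" "norm s \<le> 2 * r" for x s
  proof -
    have "dist x0 (x + axis i s) \<le> dist x0 x + norm s"
      using dist_triangle[of x0 "x + axis i s" x] by (simp add: dist_norm)
    then show ?thesis using that by auto
  qed
  let ?q = "\<lambda>h x. (f (x + axis i h) - f x) / h"
  have est: "norm (?q h x - partial_deriv f i x) \<le> (2 * B / r^2) * norm h"
    if x: "x \<in> ball x0 r" and h: "norm h < r" "h \<noteq> 0" for x h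
  proof -
    define g where "g = (\<lambda>s. f (x + axis i s))"
    have gh: "g holomorphic_on ball 0 (2 * r)"
      unfolding g_def using mhol_line[OF f] by (rule holomorphic_on_subset) (use inS[OF x] r in auto)
    have gh': "g holomorphic_on cball 0 (2 * r)"
      unfolding g_def using mhol_line[OF f] by (rule holomorphic_on_subset) (use inS[OF x] r in auto)
    have d2: "norm ((deriv ^^ 2) g s) \<le> 2 * B / r^2" if s: "s \<in> ball 0 r" for s
    proof -
      have sub: "cball s r \<subseteq> cball 0 (2 * r)"
        using s by (auto simp: subset_iff dist_norm) (smt (verit) norm_triangle_ineq4 norm_minus_commute norm_triangle_sub)
      have "norm ((deriv ^^ 2) g s) \<le> fact 2 * B / r^2"
      proof (rule Cauchy_inequality[OF _ _ \<open>r > 0\<close>])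
        show "g holomorphic_on ball s r" using gh' sub by (meson holomorphic_on_subset ball_subset_cball subset_trans)
        show "continuous_on (cball s r) g" using gh' sub by (meson holomorphic_on_imp_continuous_on continuous_on_subset)
        fix t assume "norm (s - t) = r"
        then have "t \<in> cball 0 (2 * r)" using sub by (auto simp: dist_norm subset_iff)
        then show "norm (g t) \<le> B" unfolding g_def using inS[OF x] B by auto
      qed
      then show ?thesis by simp
    qed
    have "norm ((deriv ^^ 0) g h - (\<Sum>k\<le>1. (deriv ^^ k) g 0 * (h - 0)^k / fact k))
        \<le> (2 * B / r^2) * norm (h - 0) ^ Suc 1 / fact 1"
    proof (rule field_Taylor[of "ball 0 r" 1 "\<lambda>k. (deriv ^^ k) g"])
      fix k s assume "s \<in> ball (0::complex) r" "k \<le> (1::nat)"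
      then have s: "s \<in> ball 0 (2 * r)" using r by auto
      show "((deriv ^^ k) g has_field_derivative (deriv ^^ Suc k) g s) (at s within ball 0 r)"
        using holomorphic_derivI[OF holomorphic_higher_deriv[OF gh] _ s, of k]
        by (auto intro: has_field_derivative_at_within)
    qed (use d2 h r in \<open>auto simp: numeral_2_eq_2\<close>)
    then have *: "norm (f (x + axis i h) - f x - partial_deriv f i x * h) \<le> (2 * B / r^2) * norm h ^ 2"
      by (simp add: g_def partial_deriv_def algebra_simps power2_eq_square)
    have "?q h x - partial_deriv f i x = (f (x + axis i h) - f x - partial_deriv f i x * h) / h"
      using h by (simp add: field_simps)
    then have "norm (?q h x - partial_deriv f i x) \<le> (2 * B / r^2) * norm h ^ 2 / norm h"
      using divide_right_mono[OF *, of "norm h"] by (simp add: norm_divide)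
    then show ?thesis using h by (simp add: power2_eq_square)
  qed
  have "B \<ge> 0" using B[of x0] r by (meson norm_ge_zero centre_in_cball order_trans mult_nonneg_nonneg less_imp_le zero_le_numeral)
  have ul: "uniform_limit (ball x0 r) ?q (partial_deriv f i) (at 0)"
  proof (rule uniform_limitI)
    fix e :: real assume "e > 0"
    define d where "d = min r (e / (2 * B / r^2 + 1))"
    have "d > 0" using \<open>e > 0\<close> r \<open>B \<ge> 0\<close> by (auto simp: d_def divide_nonneg_pos add_nonneg_pos)
    have "\<forall>\<^sub>F h in at 0. norm h < d \<and> h \<noteq> (0::complex)"
      using \<open>d > 0\<close> unfolding eventually_at by (auto simp: dist_norm)
    then show "\<forall>\<^sub>F h in at 0. \<forall>x\<in>ball x0 r. dist (?q h x) (partial_deriv f i x) < e"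
    proof eventually_elim
      case (elim h)
      have "(2 * B / r^2) * norm h \<le> (2 * B / r^2 + 1) * norm h"
        by (intro mult_right_mono) auto
      also have "\<dots> < e"
      proof -
        have "2 * B / r^2 + 1 > 0" using \<open>B \<ge> 0\<close> by (simp add: add_nonneg_pos)
        moreover have "norm h < e / (2 * B / r^2 + 1)" using elim by (auto simp: d_def)
        ultimately show ?thesis by (simp add: pos_less_divide_eq mult.commute)
      qed
      finally have "2 * B / r\<^sup>2 * norm h < e" .
      moreover have "norm h < r" "h \<noteq> 0" using elim by (auto simp: d_def)
      ultimately show ?case using est[of _ h] unfolding dist_norm by fastforce
    qed
  qed
  have "mhol (partial_deriv f i) (ball x0 r)"
  proof (rule mhol_uniform_limit[OF _ _ open_ball ul])
    have "\<forall>\<^sub>F h in at 0. norm h < r \<and> h \<noteq> (0::complex)"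
      using \<open>r > 0\<close> unfolding eventually_at by (auto simp: dist_norm)
    then show "\<forall>\<^sub>F h in at 0. mhol (?q h) (ball x0 r)"
    proof eventually_elim
      case (elim h)
      show ?case
      proof (rule mhol_diff_quot)
        show "mhol (\<lambda>x. f (x + axis i h)) (ball x0 r)"
          by (rule mhol_subset[OF mhol_translate[OF f]]) (use inS elim r in \<open>auto simp: subset_iff\<close>)
        show "mhol f (ball x0 r)"
          by (rule mhol_subset[OF f]) (use r in \<open>auto simp: subset_iff\<close>)
      qed
    qed
  qed simp
  moreover have "ball x0 r \<subseteq> S" using r by (auto simp: subset_iff)
  ultimately show "\<exists>T. x0 \<in> T \<and> T \<subseteq> S \<and> mhol (partial_deriv f i) T" using \<open>r > 0\<close> centre_in_ball by blast
qed


lemma mhol_const [simp, intro]: "open S \<Longrightarrow> mhol (\<lambda>x. c) S"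
  by (auto simp: mhol_def)

lemma mhol_component [intro]:
  assumes "open S" shows "mhol (\<lambda>x. x $ k) S"
  unfolding mhol_def
proof (intro conjI ballI allI assms)
  show "continuous_on S (\<lambda>x. x $ k)" by (intro continuous_intros)
  fix x i
  show "(\<lambda>s. (x + axis i s) $ k) field_differentiable at (0::complex)"
    by (cases "k = i") (auto simp: axis_def intro!: derivative_intros field_differentiable_add)
qed

lemma mhol_add [intro]: "mhol f S \<Longrightarrow> mhol g S \<Longrightarrow> mhol (\<lambda>x. f x + g x) S"
  unfolding mhol_def by (simp add: continuous_on_add field_differentiable_add)

lemma mhol_mult [intro]: "mhol f S \<Longrightarrow> mhol g S \<Longrightarrow> mhol (\<lambda>x. f x * g x) S"
  unfolding mhol_def by (simp add: continuous_on_mult field_differentiable_mult)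

lemma mhol_diff [intro]: "mhol f S \<Longrightarrow> mhol g S \<Longrightarrow> mhol (\<lambda>x. f x - g x) S"
  using mhol_diff_quot[of f S g 1] by simp

lemma mhol_sum [intro]:
  "open S \<Longrightarrow> (\<And>a. a \<in> A \<Longrightarrow> mhol (f a) S) \<Longrightarrow> mhol (\<lambda>x. \<Sum>a\<in>A. f a x) S"
  by (induction A rule: infinite_finite_induct) auto

lemma mhol_power [intro]: "mhol f S \<Longrightarrow> mhol (\<lambda>x. f x ^ n) S"
  by (induction n) (auto dest: mhol_open)

lemma mhol_prod [intro]:
  "open S \<Longrightarrow> (\<And>a. a \<in> A \<Longrightarrow> mhol (f a) S) \<Longrightarrow> mhol (\<lambda>x. \<Prod>a\<in>A. f a x) S"
  by (induction A rule: infinite_finite_induct) auto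

definition cdiff :: "(complex ^ 'k::finite \<Rightarrow> complex) \<Rightarrow> complex ^ 'k \<Rightarrow> complex ^ 'k \<Rightarrow> complex"
  where "cdiff f x v = (\<Sum>i\<in>UNIV. partial_deriv f i x * v $ i)"

lemma cdiff_add: "cdiff f x (v + w) = cdiff f x v + cdiff f x w"
  by (simp add: cdiff_def algebra_simps sum.distrib)

lemma cdiff_scale: "cdiff f x (c *s v) = c * cdiff f x v"
  by (simp add: cdiff_def algebra_simps sum_distrib_left)

lemma cdiff_diff: "cdiff f x (v - w) = cdiff f x v - cdiff f x w"
  by (simp add: cdiff_def algebra_simps sum_subtractf)

lemma bounded_linear_cdiff: "bounded_linear (cdiff f x)"
  unfolding cdiff_def
  by (intro bounded_linear_sum bounded_linear_const_mult bounded_linear_vec_nth)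

lemma norm_restrict_le:
  fixes v :: "'a::real_normed_vector ^ 'k::finite"
  shows "norm (\<Sum>j\<in>A. axis j (v $ j)) \<le> CARD('k) * norm v"
proof -
  have "norm (\<Sum>j\<in>A. axis j (v $ j)) \<le> (\<Sum>j\<in>A. norm v)"
    by (rule sum_norm_le) (simp add: Finite_Cartesian_Product.norm_nth_le)
  also have "\<dots> \<le> CARD('k) * norm v" by (simp add: card_mono mult_right_mono)
  finally show ?thesis .
qed

lemma vec_eq_sum_axis: "(\<Sum>j\<in>UNIV. axis j (v $ j)) = (v :: 'a::comm_monoid_add ^ 'k::finite)"
  by (simp add: vec_eq_iff axis_def if_distrib[of "\<lambda>x. x $ _"] cong: if_cong)

text \<open>
  The partial derivatives of a function of this class are continuous, so that moving along one
  coordinate after the other gives the total derivative.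
\<close>

theorem mhol_has_derivative:
  fixes f :: "complex ^ 'k::finite \<Rightarrow> complex"
  assumes f: "mhol f S" and x: "x \<in> S"
  shows "(f has_derivative cdiff f x) (at x)"
proof -
  define R where "R A v = (\<Sum>j\<in>A. axis j (v $ j))" for A and v :: "complex ^ 'k"
  define N where "N = real CARD('k)"
  have N: "N > 0" by (simp add: N_def)
  have RN: "norm (R A v) \<le> N * norm v" for A v
    unfolding R_def N_def by (rule norm_restrict_le)
  have key: "\<exists>d>0. \<forall>v. norm v < d \<longrightarrow>
      norm (f (x + R A v) - f x - (\<Sum>i\<in>A. partial_deriv f i x * v $ i)) \<le> e * norm v"
    if "e > 0" "finite A" for e A
    using that(2,1)
  proof (induction A arbitrary: e rule: finite_induct)
    case empty
    then show ?case by (intro exI[of _ 1]) (auto simp: R_def)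
  next
    case (insert i A)
    obtain d1 where d1: "d1 > 0" "\<And>v. norm v < d1 \<Longrightarrow>
      norm (f (x + R A v) - f x - (\<Sum>i\<in>A. partial_deriv f i x * v $ i)) \<le> e / 2 * norm v"
      using insert.IH[of "e / 2"] insert.prems by auto
    have "isCont (partial_deriv f i) x"
      using mhol_continuous_on[OF mhol_partial_deriv[OF f, of i]] mhol_open[OF f] x
      by (simp add: continuous_on_eq_continuous_at)
    moreover have "e / 2 > 0" using insert.prems by simp
    ultimately obtain d2 where d2: "d2 > 0"
      "\<And>y. dist y x < d2 \<Longrightarrow> norm (partial_deriv f i y - partial_deriv f i x) < e / 2"
      unfolding continuous_at_eps_delta dist_norm by meson
    obtain d3 where d3: "d3 > 0" "ball x d3 \<subseteq> S"
      using x mhol_open[OF f] open_contains_ball by blast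
    define d where "d = min d1 (min d2 d3 / (N + 1))"
    have "d > 0" using d1 d2 d3 N by (auto simp: d_def)
    moreover have "norm (f (x + R (insert i A) v) - f x - (\<Sum>i\<in>insert i A. partial_deriv f i x * v $ i)) \<le> e * norm v"
      if v: "norm v < d" for v
    proof -
      define y where "y = x + R A v"
      have near: "y + axis i s \<in> S \<and> norm (partial_deriv f i (y + axis i s) - partial_deriv f i x) < e / 2"
        if s: "norm s \<le> norm (v $ i)" for s
      proof -
        have "dist (y + axis i s) x \<le> norm (R A v) + norm s"
          unfolding y_def dist_norm using norm_triangle_ineq[of "R A v" "axis i s"] by (simp add: algebra_simps)
        also have "\<dots> \<le> N * norm v + norm v"
          using RN[of A v] s Finite_Cartesian_Product.norm_nth_le[of v i] by linarith
        also have "\<dots> = norm v * (N + 1)" by (simp add: algebra_simps)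
        also have "\<dots> < min d2 d3"
          using v N unfolding d_def by (simp add: pos_less_divide_eq)
        finally show ?thesis using d2 d3 by (auto simp: dist_commute)
      qed
      define g where "g = (\<lambda>s. f (y + axis i s) - partial_deriv f i x * s)"
      have "norm (g (v $ i) - g 0) \<le> e / 2 * norm (v $ i - 0)"
      proof (rule field_differentiable_bound[of "cball 0 (norm (v $ i))"])
        fix s :: complex assume s: "s \<in> cball 0 (norm (v $ i))"
        show "(g has_field_derivative (partial_deriv f i (y + axis i s) - partial_deriv f i x)) (at s within cball 0 (norm (v $ i)))"
          unfolding g_def
          by (rule has_field_derivative_at_within, rule DERIV_diff[OF mhol_has_partial[OF f] DERIV_cmult_Id])
            (use near[of s] s in auto)
        show "norm (partial_deriv f i (y + axis i s) - partial_deriv f i x) \<le> e / 2"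
          using near[of s] s by auto
      qed auto
      also have "\<dots> \<le> e / 2 * norm v"
        using insert.prems by (intro mult_left_mono) (auto simp: Finite_Cartesian_Product.norm_nth_le)
      finally have 1: "norm (f (y + axis i (v $ i)) - f y - partial_deriv f i x * v $ i) \<le> e / 2 * norm v"
        by (simp add: g_def algebra_simps)
      have 2: "norm (f y - f x - (\<Sum>i\<in>A. partial_deriv f i x * v $ i)) \<le> e / 2 * norm v"
        unfolding y_def using d1(2) v by (auto simp: d_def)
      have "x + R (insert i A) v = y + axis i (v $ i)"
        using insert by (simp add: R_def y_def algebra_simps)
      then have "f (x + R (insert i A) v) - f x - (\<Sum>i\<in>insert i A. partial_deriv f i x * v $ i)
        = (f (y + axis i (v $ i)) - f y - partial_deriv f i x * v $ i)
          + (f y - f x - (\<Sum>i\<in>A. partial_deriv f i x * v $ i))"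
        using insert by simp
      then show ?thesis using norm_triangle_ineq 1 2 by (smt (verit) field_sum_of_halves distrib_right)
    qed
    ultimately show ?case by blast
  qed
  show ?thesis
    unfolding has_derivative_at_alt
  proof (intro conjI bounded_linear_cdiff allI impI)
    fix e :: real assume "e > 0"
    from key[OF this, of UNIV] obtain d where d: "d > 0" "\<And>v. norm v < d \<Longrightarrow>
      norm (f (x + v) - f x - cdiff f x v) \<le> e * norm v"
      by (auto simp: R_def vec_eq_sum_axis cdiff_def)
    show "\<exists>d>0. \<forall>y. norm (y - x) < d \<longrightarrow> norm (f y - f x - cdiff f x (y - x)) \<le> e * norm (y - x)"
    proof (intro exI[of _ d] conjI allI impI d(1))
      fix y assume "norm (y - x) < d"
      from d(2)[OF this] show "norm (f y - f x - cdiff f x (y - x)) \<le> e * norm (y - x)" by simp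
    qed
  qed
qed

lemma axis_scale: "axis i s = s *s (axis i 1 :: complex ^ 'k)"
  by (simp add: vec_eq_iff axis_def)

lemma bounded_linear_axis: "bounded_linear (\<lambda>s::complex. axis i s :: complex ^ 'k::finite)"
proof (rule bounded_linear_intro[of _ 1])
  show "axis i (r *\<^sub>R x) = r *\<^sub>R (axis i x :: complex ^ 'k)" for r x
    by (simp add: vec_eq_iff axis_def)
qed (auto simp: axis_add)

lemma has_derivative_axis:
  "((\<lambda>s. x + axis i s) has_derivative (\<lambda>s. axis i s)) (at (s::complex))"
  by (auto intro!: derivative_eq_intros bounded_linear_imp_has_derivative bounded_linear_axis)

lemma mholI_has_derivative:
  fixes f :: "complex ^ 'k::finite \<Rightarrow> complex"
  assumes "open S"
    and "\<And>x. x \<in> S \<Longrightarrow> \<exists>D. (f has_derivative D) (at x) \<and> (\<forall>c v. D (c *s v) = c * D v)"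
  shows "mhol f S"
  unfolding mhol_def
proof (intro conjI ballI allI assms(1))
  show "continuous_on S f"
    using assms by (meson continuous_at_imp_continuous_on has_derivative_continuous)
  fix x i assume "x \<in> S"
  then obtain D where D: "(f has_derivative D) (at x)" "\<And>c v. D (c *s v) = c * D v"
    using assms(2) by blast
  have "((\<lambda>s. f (x + axis i s)) has_derivative (\<lambda>s. D (axis i s))) (at 0)"
    by (rule has_derivative_compose[OF has_derivative_axis]) (use D in simp)
  moreover have "(\<lambda>s. D (axis i s)) = (*) (D (axis i 1))"
    by (subst axis_scale) (auto simp: D)
  ultimately show "(\<lambda>s. f (x + axis i s)) field_differentiable at 0"
    by (auto simp: field_differentiable_def has_field_derivative_def)
qed

lemma has_derivative_vecI:
  fixes f :: "'a::real_normed_vector \<Rightarrow> complex ^ 'k::finite"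
  assumes "\<And>i. ((\<lambda>x. f x $ i) has_derivative (\<lambda>v. f' v $ i)) (at x)"
  shows "(f has_derivative f') (at x)"
proof -
  have "((\<lambda>x. \<Sum>i\<in>UNIV. axis i (f x $ i)) has_derivative (\<lambda>v. \<Sum>i\<in>UNIV. axis i (f' v $ i))) (at x)"
    by (intro has_derivative_sum bounded_linear.has_derivative[OF bounded_linear_axis] assms)
  then show ?thesis by (simp add: vec_eq_sum_axis)
qed

lemma cdiff_unique:
  assumes "mhol f S" "x \<in> S" "(f has_derivative D) (at x)"
  shows "D = cdiff f x"
  using has_derivative_unique[OF assms(3) mhol_has_derivative[OF assms(1,2)]] .

lemma mhol_compose:
  fixes f :: "complex ^ 'k::finite \<Rightarrow> complex" and g :: "complex ^ 'l::finite \<Rightarrow> complex ^ 'k"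
  assumes f: "mhol f T" and g: "\<And>i. mhol (\<lambda>x. g x $ i) S" and sub: "\<And>x. x \<in> S \<Longrightarrow> g x \<in> T"
  shows "mhol (\<lambda>x. f (g x)) S"
proof (rule mholI_has_derivative)
  show "open S" using g mhol_open by blast
  fix x assume x: "x \<in> S"
  define D where "D v = (\<chi> i. cdiff (\<lambda>x. g x $ i) x v)" for v
  have "(g has_derivative D) (at x)"
    by (rule has_derivative_vecI) (simp add: D_def mhol_has_derivative[OF g x])
  from has_derivative_compose[OF this mhol_has_derivative[OF f sub[OF x]]]
  have "((\<lambda>x. f (g x)) has_derivative (\<lambda>v. cdiff f (g x) (D v))) (at x)" .
  moreover have "D (c *s v) = c *s D v" for c v
    by (simp add: D_def cdiff_scale vec_eq_iff)
  ultimately show "\<exists>D. ((\<lambda>x. f (g x)) has_derivative D) (at x) \<and> (\<forall>c v. D (c *s v) = c * D v)"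
    by (auto simp: cdiff_scale)
qed

text \<open>
  Continuity of the partial derivatives makes the linear approximation uniform in both end points;
  differentiability at \<open>x\<close> alone would only compare with the value at \<open>x\<close>.
\<close>

lemma mhol_strict_derivative:
  fixes f :: "complex ^ 'k::finite \<Rightarrow> complex"
  assumes f: "mhol f S" and x: "x \<in> S" and e: "e > 0"
  obtains d where "d > 0" "ball x d \<subseteq> S"
    "\<And>y z. y \<in> ball x d \<Longrightarrow> z \<in> ball x d \<Longrightarrow> norm (f y - f z - cdiff f x (y - z)) \<le> e * norm (y - z)"
proof -
  have "\<exists>d>0. \<forall>y. dist y x < d \<longrightarrow> norm (partial_deriv f i y - partial_deriv f i x) < e / CARD('k)" for i
  proof -
    have "isCont (partial_deriv f i) x"
      using mhol_continuous_on[OF mhol_partial_deriv[OF f, of i]] mhol_open[OF f] x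
      by (simp add: continuous_on_eq_continuous_at)
    moreover have "e / CARD('k) > 0" using e by simp
    ultimately show ?thesis
      unfolding continuous_at_eps_delta dist_norm by meson
  qed
  then obtain D where D: "\<And>i. D i > 0"
    "\<And>i y. dist y x < D i \<Longrightarrow> norm (partial_deriv f i y - partial_deriv f i x) < e / CARD('k)"
    by metis
  obtain d0 where d0: "d0 > 0" "ball x d0 \<subseteq> S"
    using x mhol_open[OF f] open_contains_ball by blast
  define d where "d = min d0 (Min (range D))"
  have d: "d > 0" "d \<le> d0" "\<And>i. d \<le> D i"
    using d0 D by (auto simp: d_def min.coboundedI2)
  show thesis
  proof (rule that[of d])
    show "d > 0" "ball x d \<subseteq> S" using d d0 by auto
    fix y z assume yz: "y \<in> ball x d" "z \<in> ball x d"
    define g where "g y = f y - cdiff f x y" for y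
    have "norm (g y - g z) \<le> e * norm (y - z)"
    proof (rule differentiable_bound[of "ball x d" g])
      fix u assume u: "u \<in> ball x d"
      then have uS: "u \<in> S" using d d0 by auto
      show "(g has_derivative (\<lambda>v. cdiff f u v - cdiff f x v)) (at u within ball x d)"
        unfolding g_def
        by (intro has_derivative_diff has_derivative_at_withinI[OF mhol_has_derivative[OF f uS]]
            bounded_linear_imp_has_derivative bounded_linear_cdiff)
      have le: "norm (partial_deriv f i u - partial_deriv f i x) \<le> e / CARD('k)" for i
        using D(2)[of u i] u d(3)[of i] by (auto simp: dist_commute)
      show "onorm (\<lambda>v. cdiff f u v - cdiff f x v) \<le> e"
      proof (rule onorm_le)
        fix v
        have "cdiff f u v - cdiff f x v = (\<Sum>i\<in>UNIV. (partial_deriv f i u - partial_deriv f i x) * v $ i)"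
          by (simp add: cdiff_def sum_subtractf algebra_simps)
        also have "norm \<dots> \<le> (\<Sum>i\<in>(UNIV::'k set). e / CARD('k) * norm v)"
          by (intro sum_norm_le) (use e in \<open>auto simp: norm_mult simp del: times_divide_eq_left
              intro!: mult_mono le Finite_Cartesian_Product.norm_nth_le\<close>)
        also have "\<dots> = e * norm v" by simp
        finally show "norm (cdiff f u v - cdiff f x v) \<le> e * norm v" .
      qed
    qed (use yz in auto)
    then show "norm (f y - f z - cdiff f x (y - z)) \<le> e * norm (y - z)"
      by (simp add: g_def cdiff_diff algebra_simps)
  qed
qed

section \<open>Power series on polydiscs\<close>

abbreviation mdeg :: "('k::finite \<Rightarrow> nat) \<Rightarrow> nat"
  where "mdeg \<gamma> \<equiv> (\<Sum>i\<in>UNIV. \<gamma> i)"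

lemma open_polydisc: "open (polydisc \<rho> :: ('a::real_normed_vector ^ 'k::finite) set)"
proof -
  have "polydisc \<rho> = (\<Inter>k. {x :: 'a ^ 'k. norm (x $ k) < \<rho>})" by (auto simp: polydisc_def)
  also have "open \<dots>"
    by (intro open_INT ballI open_Collect_less continuous_intros) auto
  finally show ?thesis .
qed

lemma zero_in_polydisc [simp]: "0 \<in> polydisc \<rho> \<longleftrightarrow> \<rho> > 0"
  by (auto simp: polydisc_def)

lemma polydisc_radius:
  assumes "x \<in> polydisc \<rho>"
  obtains r where "0 \<le> r" "r < \<rho>" "\<And>k. norm (x $ k) \<le> r"
proof (rule that[of "Max (range (\<lambda>k. norm (x $ k)))"])
  show "Max (range (\<lambda>k. norm (x $ k))) < \<rho>" using assms by (subst Max_less_iff) (auto simp: polydisc_def)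
  show "\<And>k. norm (x $ k) \<le> Max (range (\<lambda>k. norm (x $ k)))" by (rule Max_ge) auto
  then show "0 \<le> Max (range (\<lambda>k. norm (x $ k)))" using norm_ge_zero order_trans by blast
qed

lemma polydisc_subset_ball:
  fixes e :: real
  assumes "e > 0"
  obtains \<rho> where "\<rho> > 0" "(polydisc \<rho> :: ('a::real_normed_vector ^ 'k::finite) set) \<subseteq> ball 0 e"
proof (rule that[of "e / CARD('k)"])
  show "polydisc (e / CARD('k)) \<subseteq> (ball 0 e :: ('a ^ 'k) set)"
  proof
    fix x :: "'a ^ 'k" assume "x \<in> polydisc (e / CARD('k))"
    then have "(\<Sum>k\<in>UNIV. norm (x $ k)) < (\<Sum>k\<in>(UNIV::'k set). e / CARD('k))"
      by (intro sum_strict_mono) (auto simp: polydisc_def)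
    also have "\<dots> = e" by simp
    moreover have "norm x \<le> (\<Sum>k\<in>UNIV. norm (x $ k))"
      unfolding norm_vec_def by (rule L2_set_le_sum) simp
    ultimately show "x \<in> ball 0 e" by simp
  qed
qed (use assms in simp)

lemma polydisc_in_nhd:
  assumes "open U" "0 \<in> U"
  obtains \<rho> where "\<rho> > 0" "(polydisc \<rho> :: ('a::real_normed_vector ^ 'k::finite) set) \<subseteq> U"
proof -
  obtain e where "e > 0" "ball 0 e \<subseteq> U" using assms open_contains_ball by blast
  then show ?thesis using polydisc_subset_ball[of e] that by (metis subset_trans)
qed

lemma polydisc_mono: "\<rho> \<le> \<rho>' \<Longrightarrow> polydisc \<rho> \<subseteq> polydisc \<rho>'"
  unfolding polydisc_def using less_le_trans by blast

lemma norm_ps_term_le: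
  assumes "\<And>k. norm (x $ k) \<le> r"
  shows "norm (ps_term c x \<gamma>) \<le> norm (c \<gamma>) * r ^ mdeg \<gamma>"
proof -
  have "norm (ps_term c x \<gamma>) = norm (c \<gamma>) * (\<Prod>i\<in>UNIV. norm (x $ i) ^ \<gamma> i)"
    by (simp add: ps_term_def norm_mult prod_norm[symmetric] norm_power)
  also have "(\<Prod>i\<in>UNIV. norm (x $ i) ^ \<gamma> i) \<le> (\<Prod>i\<in>UNIV. r ^ \<gamma> i)"
    by (intro prod_mono) (auto intro!: power_mono assms)
  also have "(\<Prod>i\<in>UNIV. r ^ \<gamma> i) = r ^ mdeg \<gamma>" by (simp add: power_sum)
  finally show ?thesis by (simp add: mult_left_mono)
qed

text \<open>
  On the compact polydisc of radius \<open>r\<close> the supremum of the monomial of index \<open>\<gamma>\<close> is attained at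
  the point with all coordinates \<open>r\<close>, so normal convergence is a condition on the coefficients.
\<close>

theorem converges_normally_iff:
  fixes c :: "('k::finite, 'a::real_normed_field) pseries"
  shows "converges_normally c \<rho> \<longleftrightarrow>
    (\<forall>r. 0 \<le> r \<and> r < \<rho> \<longrightarrow> (\<lambda>\<gamma>. norm (c \<gamma>) * r ^ mdeg \<gamma>) summable_on UNIV)"
proof safe
  fix r assume c: "converges_normally c \<rho>" and r: "0 \<le> r" "r < \<rho>"
  define x where "x = ((\<chi> k. of_real r) :: 'a ^ 'k)"
  have "{x} \<subseteq> polydisc \<rho>" using r by (auto simp: polydisc_def x_def)
  then have "(\<lambda>\<gamma>. SUP x\<in>{x}. norm (ps_term c x \<gamma>)) summable_on UNIV"
    using c[unfolded converges_normally_def, rule_format, of "{x}"] by auto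
  moreover have "norm (ps_term c x \<gamma>) = norm (c \<gamma>) * r ^ mdeg \<gamma>" for \<gamma>
    using r by (simp add: ps_term_def norm_mult prod_norm[symmetric] norm_power x_def power_sum)
  ultimately show "(\<lambda>\<gamma>. norm (c \<gamma>) * r ^ mdeg \<gamma>) summable_on UNIV" by simp
next
  assume R: "\<forall>r. 0 \<le> r \<and> r < \<rho> \<longrightarrow> (\<lambda>\<gamma>. norm (c \<gamma>) * r ^ mdeg \<gamma>) summable_on UNIV"
  show "converges_normally c \<rho>"
    unfolding converges_normally_def
  proof (intro allI impI, elim conjE)
    fix K :: "('a ^ 'k) set" assume K: "compact K" "K \<noteq> {}" "K \<subseteq> polydisc \<rho>"
    have "\<exists>x\<in>K. \<forall>y\<in>K. norm (y $ k) \<le> norm (x $ k)" for k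
      by (rule continuous_attains_sup[OF K(1,2)]) (intro continuous_intros)
    then obtain X where X: "\<And>k. X k \<in> K" "\<And>k y. y \<in> K \<Longrightarrow> norm (y $ k) \<le> norm (X k $ k)"
      by metis
    define r where "r = Max (range (\<lambda>k. norm (X k $ k)))"
    have le: "norm (y $ k) \<le> r" if "y \<in> K" for y k
    proof -
      have "norm (X k $ k) \<le> r" unfolding r_def by (rule Max_ge) auto
      then show ?thesis using X(2)[OF that, of k] by simp
    qed
    have "r < \<rho>" using K(3) X(1) unfolding r_def by (subst Max_less_iff) (auto simp: polydisc_def subset_iff)
    moreover have "r \<ge> 0" using le K(2) norm_ge_zero order_trans by blast
    ultimately have "(\<lambda>\<gamma>. norm (c \<gamma>) * r ^ mdeg \<gamma>) summable_on UNIV" using R by simp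
    moreover have "(SUP x\<in>K. norm (ps_term c x \<gamma>)) \<le> norm (c \<gamma>) * r ^ mdeg \<gamma>" for \<gamma>
      using K(2) by (intro cSUP_least norm_ps_term_le le)
    moreover have "0 \<le> (SUP x\<in>K. norm (ps_term c x \<gamma>))" for \<gamma>
    proof -
      obtain x where "x \<in> K" using K(2) by blast
      moreover have "bdd_above ((\<lambda>x. norm (ps_term c x \<gamma>)) ` K)"
        by (rule bdd_aboveI2[where M = "norm (c \<gamma>) * r ^ mdeg \<gamma>"]) (intro norm_ps_term_le le)
      ultimately have "norm (ps_term c x \<gamma>) \<le> (SUP x\<in>K. norm (ps_term c x \<gamma>))" by (rule cSUP_upper)
      then show ?thesis using norm_ge_zero order_trans by blast
    qed
    ultimately show "(\<lambda>\<gamma>. SUP x\<in>K. norm (ps_term c x \<gamma>)) summable_on UNIV"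
      by (rule summable_on_comparison_test)
  qed
qed

lemma converges_normally_mono:
  fixes c :: "('k::finite, 'a::real_normed_field) pseries"
  shows "converges_normally c \<rho> \<Longrightarrow> \<rho>' \<le> \<rho> \<Longrightarrow> converges_normally c \<rho>'"
  by (auto simp: converges_normally_iff)

lemma ps_summable:
  fixes c :: "('k::finite, 'a::{real_normed_field, banach}) pseries"
  assumes "converges_normally c \<rho>" "x \<in> polydisc \<rho>"
  shows "(ps_term c x has_sum ps_sum c x) UNIV"
proof -
  obtain r where r: "0 \<le> r" "r < \<rho>" "\<And>k. norm (x $ k) \<le> r" using polydisc_radius[OF assms(2)] by blast
  have "(\<lambda>\<gamma>. norm (c \<gamma>) * r ^ mdeg \<gamma>) summable_on UNIV"
    using assms(1) r by (simp add: converges_normally_iff)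
  then have "(\<lambda>\<gamma>. norm (ps_term c x \<gamma>)) summable_on UNIV"
    by (rule Infinite_Sum.abs_summable_on_comparison_test') (use norm_ps_term_le r in auto)
  then show ?thesis unfolding ps_sum_def by (rule has_sum_infsum[OF Infinite_Sum.abs_summable_summable])
qed

lemma mhol_ps_term: "open S \<Longrightarrow> mhol (\<lambda>x. ps_term c x \<gamma>) S"
  unfolding ps_term_def by (intro mhol_mult mhol_const mhol_prod mhol_power mhol_component)

lemma ps_sum_uniform_limit:
  fixes c :: "('k::finite, complex) pseries"
  assumes "converges_normally c \<rho>" "0 \<le> r" "r < \<rho>"
  shows "uniform_limit (polydisc r) (\<lambda>X x. \<Sum>\<gamma>\<in>X. ps_term c x \<gamma>) (ps_sum c) (finite_subsets_at_top UNIV)"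
  unfolding ps_sum_def
proof (rule Weierstrass_m_test_general)
  show "(\<lambda>\<gamma>. norm (c \<gamma>) * r ^ mdeg \<gamma>) summable_on UNIV"
    using assms by (simp add: converges_normally_iff)
qed (intro norm_ps_term_le, auto simp: polydisc_def less_imp_le)

lemma mhol_ps_sum:
  fixes c :: "('k::finite, complex) pseries"
  assumes "converges_normally c \<rho>"
  shows "mhol (ps_sum c) (polydisc \<rho>)"
proof (rule mholI_locally)
  fix x :: "complex ^ 'k" assume "x \<in> polydisc \<rho>"
  then obtain r where r: "0 \<le> r" "r < \<rho>" "\<And>k. norm (x $ k) \<le> r" using polydisc_radius by blast
  define s where "s = (r + \<rho>) / 2"
  have s: "r < s" "s < \<rho>" using r by (auto simp: s_def)
  have "mhol (ps_sum c) (polydisc s)"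
  proof (rule mhol_uniform_limit[OF _ _ open_polydisc ps_sum_uniform_limit[OF assms]])
    show "\<forall>\<^sub>F X in finite_subsets_at_top UNIV. mhol (\<lambda>x. \<Sum>\<gamma>\<in>X. ps_term c x \<gamma>) (polydisc s)"
      by (intro always_eventually allI mhol_sum mhol_ps_term open_polydisc)
  qed (use r s in auto)
  moreover have "x \<in> polydisc s" using r s by (auto simp: polydisc_def intro: le_less_trans)
  ultimately show "\<exists>T. x \<in> T \<and> T \<subseteq> polydisc \<rho> \<and> mhol (ps_sum c) T"
    using polydisc_mono[of s \<rho>] s by (intro exI[of _ "polydisc s"]) auto
qed

definition ps_deriv :: "'k \<Rightarrow> ('k, complex) pseries \<Rightarrow> ('k, complex) pseries"
  where "ps_deriv i c \<gamma> = of_nat (Suc (\<gamma> i)) * c (\<gamma>(i := Suc (\<gamma> i)))"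

lemma mdeg_upd: "mdeg (\<gamma>(i := n)) = n + (\<Sum>j\<in>UNIV-{i}. \<gamma> j)" for i :: "'k::finite"
  by (subst sum.remove[of UNIV i]) auto

lemma mdeg_remove: "mdeg \<gamma> = \<gamma> i + (\<Sum>j\<in>UNIV-{i}. \<gamma> j)" for i :: "'k::finite"
  by (subst sum.remove[of UNIV i]) auto

lemma converges_normally_ps_deriv:
  fixes c :: "('k::finite, complex) pseries"
  assumes "converges_normally c \<rho>"
  shows "converges_normally (ps_deriv i c) \<rho>"
  unfolding converges_normally_iff
proof safe
  fix r0 :: real assume r0: "0 \<le> r0" "r0 < \<rho>"
  \<comment> \<open>Between \<open>r0\<close> and \<open>\<rho>\<close>; the factor \<open>(n + 1) r\<^sup>n\<close> is absorbed by the larger \<open>s\<^sup>n\<^sup>+\<^sup>1\<close>.\<close>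
  define r where "r = (2 * r0 + \<rho>) / 3"
  define s where "s = (r0 + 2 * \<rho>) / 3"
  have rs: "r0 \<le> r" "0 < r" "r < s" "s < \<rho>" using r0 by (auto simp: r_def s_def)
  have "(\<lambda>n. of_nat n * (r / s) ^ n) \<longlonglongrightarrow> 0"
    using rs by (intro powser_times_n_limit_0) auto
  then have "Bseq (\<lambda>n. of_nat n * (r / s) ^ n)" using convergentI convergent_imp_Bseq by blast
  then obtain K where K: "\<And>n. norm (of_nat n * (r / s) ^ n) \<le> K" by (auto simp: Bseq_def)
  have K': "of_nat (Suc n) * r ^ n \<le> (K / r) * s ^ Suc n" for n
  proof -
    have "of_nat (Suc n) * r ^ Suc n / s ^ Suc n \<le> K"
      using K[of "Suc n"] rs by (simp add: power_divide abs_mult)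
    then have "of_nat (Suc n) * r ^ n * r \<le> K * s ^ Suc n"
      using rs by (simp add: pos_divide_le_eq field_simps)
    then show ?thesis using rs by (simp add: pos_le_divide_eq)
  qed
  define h where "h = (\<lambda>\<gamma>::'k \<Rightarrow> nat. \<gamma>(i := Suc (\<gamma> i)))"
  have inj: "inj h"
    by (rule injI) (auto simp: h_def fun_eq_iff, metis fun_upd_apply nat.inject)
  have "(\<lambda>\<gamma>. norm (c \<gamma>) * s ^ mdeg \<gamma>) summable_on UNIV"
    using assms rs by (simp add: converges_normally_iff)
  then have "(\<lambda>\<gamma>. norm (c \<gamma>) * s ^ mdeg \<gamma>) summable_on range h"
    by (rule summable_on_subset_banach) auto
  then have "(\<lambda>\<gamma>. norm (c (h \<gamma>)) * s ^ mdeg (h \<gamma>)) summable_on UNIV"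
    using summable_on_reindex[OF inj, of "\<lambda>\<gamma>. norm (c \<gamma>) * s ^ mdeg \<gamma>"] by (simp add: o_def)
  then have "(\<lambda>\<gamma>. (K / r) * (norm (c (h \<gamma>)) * s ^ mdeg (h \<gamma>))) summable_on UNIV"
    by (rule summable_on_cmult_right)
  then show "(\<lambda>\<gamma>. norm (ps_deriv i c \<gamma>) * r0 ^ mdeg \<gamma>) summable_on UNIV"
  proof (rule summable_on_comparison_test)
    fix \<gamma> :: "'k \<Rightarrow> nat"
    have m: "mdeg (h \<gamma>) = Suc (mdeg \<gamma>)"
      unfolding h_def mdeg_upd by (simp add: mdeg_remove[of \<gamma> i])
    have "\<gamma> i \<le> mdeg \<gamma>" by (simp add: mdeg_remove[of \<gamma> i])
    have "norm (ps_deriv i c \<gamma>) * r0 ^ mdeg \<gamma> = norm (c (h \<gamma>)) * (of_nat (Suc (\<gamma> i)) * r0 ^ mdeg \<gamma>)"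
      by (simp add: ps_deriv_def norm_mult h_def del: of_nat_Suc)
    also have "\<dots> \<le> norm (c (h \<gamma>)) * (of_nat (Suc (mdeg \<gamma>)) * r ^ mdeg \<gamma>)"
      using r0 rs \<open>\<gamma> i \<le> mdeg \<gamma>\<close>
      by (intro mult_left_mono mult_mono power_mono of_nat_mono) (auto simp del: of_nat_Suc)
    also have "\<dots> \<le> norm (c (h \<gamma>)) * ((K / r) * s ^ Suc (mdeg \<gamma>))"
      by (intro mult_left_mono K') auto
    finally show "norm (ps_deriv i c \<gamma>) * r0 ^ mdeg \<gamma> \<le> K / r * (norm (c (h \<gamma>)) * s ^ mdeg (h \<gamma>))"
      by (simp add: m mult_ac)
  qed (use r0 in auto)
qed

lemma partial_deriv_ps_term:
  fixes c :: "('k::finite, complex) pseries"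
  shows "partial_deriv (\<lambda>x. ps_term c x \<gamma>) i x
    = c \<gamma> * (of_nat (\<gamma> i) * x $ i ^ (\<gamma> i - 1) * (\<Prod>j\<in>UNIV-{i}. x $ j ^ \<gamma> j))"
proof -
  have "(\<Prod>j\<in>UNIV. (x + axis i s) $ j ^ \<gamma> j) = (x $ i + s) ^ \<gamma> i * (\<Prod>j\<in>UNIV-{i}. x $ j ^ \<gamma> j)" for s
    by (subst prod.remove[of UNIV i]) (auto simp: axis_def intro!: prod.cong)
  then have "(\<lambda>s. ps_term c (x + axis i s) \<gamma>) =
      (\<lambda>s. c \<gamma> * ((x $ i + s) ^ \<gamma> i * (\<Prod>j\<in>UNIV-{i}. x $ j ^ \<gamma> j)))"
    by (simp add: ps_term_def)
  then show ?thesis unfolding partial_deriv_def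
    by (auto intro!: DERIV_imp_deriv derivative_eq_intros)
qed

lemma partial_deriv_ps_sum:
  fixes c :: "('k::finite, complex) pseries"
  assumes c: "converges_normally c \<rho>" and x: "x \<in> polydisc \<rho>"
  shows "partial_deriv (ps_sum c) i x = ps_sum (ps_deriv i c) x"
proof -
  obtain r where r: "0 \<le> r" "r < \<rho>" "\<And>k. norm (x $ k) \<le> r" using polydisc_radius[OF x] by blast
  define s where "s = (\<rho> - r) / 3"
  have s: "s > 0" using r by (simp add: s_def)
  let ?F = "finite_subsets_at_top (UNIV :: ('k \<Rightarrow> nat) set)"
  have near: "x + axis i t \<in> polydisc (r + 2 * s)" if "norm t \<le> s" for t
    unfolding polydisc_def
  proof safe
    fix k
    have "norm ((x + axis i t) $ k) \<le> norm (x $ k) + norm t"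
      by (auto simp: axis_def intro: norm_triangle_ineq)
    then show "norm ((x + axis i t) $ k) < r + 2 * s" using r(3)[of k] that s by linarith
  qed
  have ul: "uniform_limit (cball 0 s) (\<lambda>X t. \<Sum>\<gamma>\<in>X. ps_term c (x + axis i t) \<gamma>)
      (\<lambda>t. ps_sum c (x + axis i t)) ?F"
    by (rule uniform_limit_compose'[OF ps_sum_uniform_limit[OF c, of "r + 2 * s"]])
      (use near r s in \<open>auto simp: s_def field_simps\<close>)
  have mh: "mhol (\<lambda>x. \<Sum>\<gamma>\<in>X. ps_term c x \<gamma>) UNIV" for X
    by (intro mhol_sum mhol_ps_term open_UNIV)
  have ev: "\<forall>\<^sub>F X in ?F. continuous_on (cball 0 s) (\<lambda>t. \<Sum>\<gamma>\<in>X. ps_term c (x + axis i t) \<gamma>) \<and>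
    (\<forall>w\<in>ball 0 s. ((\<lambda>t. \<Sum>\<gamma>\<in>X. ps_term c (x + axis i t) \<gamma>) has_field_derivative
        (\<Sum>\<gamma>\<in>X. partial_deriv (\<lambda>x. ps_term c x \<gamma>) i (x + axis i w))) (at w))"
  proof (intro always_eventually allI conjI ballI)
    fix X
    show "continuous_on (cball 0 s) (\<lambda>t. \<Sum>\<gamma>\<in>X. ps_term c (x + axis i t) \<gamma>)"
      using continuous_on_compose2[OF mhol_continuous_on[OF mh[of X]] continuous_on_axis[of "cball 0 s" x i]] by auto
    show "((\<lambda>t. \<Sum>\<gamma>\<in>X. ps_term c (x + axis i t) \<gamma>) has_field_derivative
        (\<Sum>\<gamma>\<in>X. partial_deriv (\<lambda>x. ps_term c x \<gamma>) i (x + axis i w))) (at w)" for w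
      by (intro DERIV_sum mhol_has_partial[OF mhol_ps_term[OF open_UNIV]]) auto
  qed
  obtain g' where g': "\<And>w. w \<in> ball 0 s \<Longrightarrow> ((\<lambda>t. ps_sum c (x + axis i t)) has_field_derivative g' w) (at w) \<and>
      ((\<lambda>X. \<Sum>\<gamma>\<in>X. partial_deriv (\<lambda>x. ps_term c x \<gamma>) i (x + axis i w)) \<longlongrightarrow> g' w) ?F"
    using has_complex_derivative_uniform_limit[OF ev ul _ s] by auto
  have "g' 0 = partial_deriv (ps_sum c) i x"
    unfolding partial_deriv_def using g'[of 0] s by (auto intro: DERIV_imp_deriv[symmetric])
  then have hs: "((\<lambda>\<gamma>. partial_deriv (\<lambda>x. ps_term c x \<gamma>) i x) has_sum partial_deriv (ps_sum c) i x) UNIV"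
    using g'[of 0] s by (simp add: has_sum_def)
  define h where "h = (\<lambda>\<gamma>::'k \<Rightarrow> nat. \<gamma>(i := Suc (\<gamma> i)))"
  have inj: "inj h"
    by (rule injI) (auto simp: h_def fun_eq_iff, metis fun_upd_apply nat.inject)
  have "((\<lambda>\<gamma>. partial_deriv (\<lambda>x. ps_term c x \<gamma>) i x) has_sum partial_deriv (ps_sum c) i x) (range h)"
  proof (subst has_sum_cong_neutral[where T = UNIV])
    fix \<gamma> assume "\<gamma> \<in> UNIV - range h"
    moreover have "h (\<gamma>(i := \<gamma> i - 1)) = \<gamma>" if "\<gamma> i \<noteq> 0"
      using that by (auto simp: h_def fun_eq_iff)
    ultimately have "\<gamma> i = 0" by (metis DiffD2 rangeI)
    then show "partial_deriv (\<lambda>x. ps_term c x \<gamma>) i x = 0" by (simp add: partial_deriv_ps_term)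
  qed (use hs in auto)
  then have "((\<lambda>\<gamma>. partial_deriv (\<lambda>x. ps_term c x (h \<gamma>)) i x) has_sum partial_deriv (ps_sum c) i x) UNIV"
    using has_sum_reindex[OF inj, of "\<lambda>\<gamma>. partial_deriv (\<lambda>x. ps_term c x \<gamma>) i x"] by (simp add: o_def)
  moreover have "partial_deriv (\<lambda>x. ps_term c x (h \<gamma>)) i x = ps_term (ps_deriv i c) x \<gamma>" for \<gamma>
  proof -
    have "(\<Prod>j\<in>UNIV. x $ j ^ \<gamma> j) = x $ i ^ \<gamma> i * (\<Prod>j\<in>UNIV-{i}. x $ j ^ \<gamma> j)"
      by (subst prod.remove[of UNIV i]) auto
    moreover have "(\<Prod>j\<in>UNIV-{i}. x $ j ^ h \<gamma> j) = (\<Prod>j\<in>UNIV-{i}. x $ j ^ \<gamma> j)"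
      by (intro prod.cong) (auto simp: h_def)
    ultimately show ?thesis
      unfolding partial_deriv_ps_term by (simp add: ps_term_def ps_deriv_def h_def mult_ac)
  qed
  ultimately have "(ps_term (ps_deriv i c) x has_sum partial_deriv (ps_sum c) i x) UNIV" by simp
  then show ?thesis unfolding ps_sum_def by (simp add: infsumI)
qed


lemma ps_sum_0 [simp]: "ps_sum (c :: ('k::finite, 'a::{real_normed_field, banach}) pseries) 0 = c (\<lambda>_. 0)"
proof -
  have "(ps_term c 0 has_sum c (\<lambda>_. 0)) UNIV"
  proof (rule has_sum_finite_neutralI[of "{\<lambda>_. 0}"])
    fix \<gamma> assume "\<gamma> \<in> UNIV - {\<lambda>_::'k. 0::nat}"
    then obtain i where "\<gamma> i \<noteq> 0" by (auto simp: fun_eq_iff)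
    then have "(\<Prod>i\<in>UNIV. (0::'a) ^ \<gamma> i) = 0" by (intro prod_zero) auto
    then show "ps_term c 0 \<gamma> = 0" by (simp add: ps_term_def)
  qed (auto simp: ps_term_def)
  then show ?thesis unfolding ps_sum_def by (simp add: infsumI)
qed

lemma partial_deriv_cong:
  assumes "open S" "x \<in> S" "\<And>y. y \<in> S \<Longrightarrow> f y = g y"
  shows "partial_deriv f i x = partial_deriv g i x"
  unfolding partial_deriv_def
proof (rule deriv_cong_ev[OF _ refl])
  have "\<forall>\<^sub>F s in nhds 0. s \<in> {s. x + axis i s \<in> S}"
    by (rule eventually_nhds_in_open[OF open_axis_preimage[OF assms(1)]]) (use assms in simp)
  then show "\<forall>\<^sub>F s in nhds 0. f (x + axis i s) = g (x + axis i s)"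
    by eventually_elim (use assms in auto)
qed

text \<open>
  The coefficient of index \<open>\<gamma>\<close> is a multiple of an iterated partial derivative at the origin. Any
  vanishing condition \<open>Z\<close> that forces the value at the origin to be zero and passes on to the
  partial derivatives therefore kills all coefficients.
\<close>

theorem ps_eq_0I:
  fixes c :: "('k::finite, complex) pseries"
  assumes c: "converges_normally c \<rho>" and \<rho>: "\<rho> > 0" and Z: "Z (ps_sum c)"
    and Z0: "\<And>f. Z f \<Longrightarrow> f 0 = 0"
    and Zd: "\<And>f i. mhol f (polydisc \<rho>) \<Longrightarrow> Z f \<Longrightarrow> Z (partial_deriv f i)"
  shows "c = (\<lambda>_. 0)"
proof
  fix \<gamma>
  have "c \<gamma> = 0" if "converges_normally c \<rho>" "mhol f (polydisc \<rho>)" "Z f"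
    "\<And>x. x \<in> polydisc \<rho> \<Longrightarrow> f x = ps_sum c x" for f c
    using that
  proof (induction "mdeg \<gamma>" arbitrary: \<gamma> f c)
    case 0
    then have "\<gamma> = (\<lambda>_. 0)" by (auto simp: fun_eq_iff)
    then show ?case using "0.prems"(4)[of 0] Z0[OF "0.prems"(3)] \<rho> by simp
  next
    case (Suc n)
    then obtain i where i: "\<gamma> i \<noteq> 0" by (metis sum.neutral nat.distinct(1))
    define \<gamma>' where "\<gamma>' = \<gamma>(i := \<gamma> i - 1)"
    have \<gamma>: "\<gamma> = \<gamma>'(i := Suc (\<gamma>' i))" using i by (auto simp: \<gamma>'_def fun_eq_iff)
    have "n = mdeg \<gamma>'"
      unfolding \<gamma>'_def mdeg_upd using Suc(2) i by (simp add: mdeg_remove[of \<gamma> i])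
    moreover have "partial_deriv f i x = ps_sum (ps_deriv i c) x" if "x \<in> polydisc \<rho>" for x
      using partial_deriv_cong[OF open_polydisc that Suc.prems(4)] partial_deriv_ps_sum[OF Suc.prems(1) that]
      by simp
    ultimately have "ps_deriv i c \<gamma>' = 0"
      using Suc.hyps(1)[of \<gamma>' "ps_deriv i c" "partial_deriv f i"] converges_normally_ps_deriv[OF Suc.prems(1)]
        mhol_partial_deriv[OF Suc.prems(2)] Zd[OF Suc.prems(2,3)] by blast
    then show ?case by (subst \<gamma>) (simp add: ps_deriv_def del: of_nat_Suc)
  qed
  from this[OF c mhol_ps_sum[OF c] Z] show "c \<gamma> = 0" by simp
qed

lemma eventually_partial_deriv_0:
  assumes "\<forall>\<^sub>F x in nhds p. f x = 0"
  shows "\<forall>\<^sub>F x in nhds p. partial_deriv f i x = 0"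
proof -
  obtain S where S: "open S" "p \<in> S" "\<And>x. x \<in> S \<Longrightarrow> f x = 0"
    using assms unfolding eventually_nhds by blast
  have "partial_deriv f i x = 0" if "x \<in> S" for x
    using partial_deriv_cong[OF S(1) that S(3), where i = i] by (simp add: partial_deriv_def)
  then show ?thesis unfolding eventually_nhds using S by blast
qed

lemma ps_sum_diff:
  fixes c c' :: "('k::finite, 'a::{real_normed_field, banach}) pseries"
  assumes "converges_normally c \<rho>" "converges_normally c' \<rho>" "x \<in> polydisc \<rho>"
  shows "ps_sum (\<lambda>\<gamma>. c \<gamma> - c' \<gamma>) x = ps_sum c x - ps_sum c' x"
proof -
  have "((\<lambda>\<gamma>. ps_term c x \<gamma> - ps_term c' x \<gamma>) has_sum ps_sum c x - ps_sum c' x) UNIV"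
    using has_sum_add[OF ps_summable[OF assms(1,3)] has_sum_cmult_right[OF ps_summable[OF assms(2,3)], of "-1"]]
    by simp
  then show ?thesis unfolding ps_sum_def[of "\<lambda>\<gamma>. c \<gamma> - c' \<gamma>"]
    by (intro infsumI) (simp add: ps_term_def[abs_def] algebra_simps)
qed

lemma converges_normally_diff:
  fixes c c' :: "('k::finite, 'a::real_normed_field) pseries"
  assumes "converges_normally c \<rho>" "converges_normally c' \<rho>"
  shows "converges_normally (\<lambda>\<gamma>. c \<gamma> - c' \<gamma>) \<rho>"
  unfolding converges_normally_iff
proof safe
  fix r assume r: "0 \<le> r" "r < \<rho>"
  have "(\<lambda>\<gamma>. norm (c \<gamma>) * r ^ mdeg \<gamma> + norm (c' \<gamma>) * r ^ mdeg \<gamma>) summable_on UNIV"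
    using assms r by (intro summable_on_add) (auto simp: converges_normally_iff)
  then show "(\<lambda>\<gamma>. norm (c \<gamma> - c' \<gamma>) * r ^ mdeg \<gamma>) summable_on UNIV"
    by (rule summable_on_comparison_test)
      (use r in \<open>auto simp flip: distrib_right intro!: mult_right_mono norm_triangle_ineq4\<close>)
qed

lemma ps_unique:
  fixes c c' :: "('k::finite, complex) pseries"
  assumes "converges_normally c \<rho>" "converges_normally c' \<rho>" "\<rho> > 0"
    and ev: "\<forall>\<^sub>F x in nhds 0. ps_sum c x = ps_sum c' x"
  shows "c = c'"
proof -
  have "(\<lambda>\<gamma>. c \<gamma> - c' \<gamma>) = (\<lambda>_. 0)"
  proof (rule ps_eq_0I[OF converges_normally_diff[OF assms(1,2)] assms(3), where Z = "\<lambda>f. \<forall>\<^sub>F x in nhds 0. f x = 0"])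
    have "\<forall>\<^sub>F x in nhds 0. x \<in> polydisc \<rho>"
      by (rule eventually_nhds_in_open[OF open_polydisc]) (use assms in simp)
    with ev show "\<forall>\<^sub>F x in nhds 0. ps_sum (\<lambda>\<gamma>. c \<gamma> - c' \<gamma>) x = 0"
      by eventually_elim (simp add: ps_sum_diff[OF assms(1,2)])
  qed (auto dest: eventually_nhds_x_imp_x eventually_partial_deriv_0)
  then show ?thesis by (simp add: fun_eq_iff)
qed

lemma geometric_summable:
  fixes q :: real
  assumes q: "0 \<le> q" "q < 1"
  shows "(\<lambda>\<gamma>::'k::finite \<Rightarrow> nat. q ^ mdeg \<gamma>) summable_on UNIV"
proof (rule nonneg_bounded_partial_sums_imp_summable_on)
  show "\<forall>\<^sub>F X in finite_subsets_at_top (UNIV :: ('k \<Rightarrow> nat) set). (\<Sum>\<gamma>\<in>X. q ^ mdeg \<gamma>) \<le> (1 / (1 - q)) ^ CARD('k)"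
  proof (rule eventually_finite_subsets_at_top_weakI)
    fix X :: "('k \<Rightarrow> nat) set" assume X: "finite X"
    define N where "N = Max (insert 0 (\<Union>\<gamma>\<in>X. range \<gamma>))"
    have fin: "finite (insert 0 (\<Union>\<gamma>\<in>X. range \<gamma>))" using X by auto
    have "X \<subseteq> PiE UNIV (\<lambda>_. {..N})"
      unfolding N_def using fin by (auto intro!: Max_ge)
    then have "(\<Sum>\<gamma>\<in>X. q ^ mdeg \<gamma>) \<le> (\<Sum>\<gamma>\<in>PiE (UNIV::'k set) (\<lambda>_. {..N}). q ^ mdeg \<gamma>)"
      using q by (intro sum_mono2 finite_PiE) auto
    also have "\<dots> = (\<Prod>i\<in>(UNIV::'k set). \<Sum>n\<in>{..N}. q ^ n)"
      by (subst prod_sum_PiE) (auto simp: power_sum)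
    also have "\<dots> \<le> (\<Prod>i\<in>(UNIV::'k set). 1 / (1 - q))"
    proof (rule prod_mono, safe)
      show "0 \<le> (\<Sum>n\<le>N. q ^ n)" using q by (intro sum_nonneg) auto
      have "(\<Sum>n\<le>N. q ^ n) = (1 - q ^ Suc N) / (1 - q)" using q by (subst sum_gp0) auto
      also have "\<dots> \<le> 1 / (1 - q)" using q by (intro divide_right_mono) auto
      finally show "(\<Sum>n\<le>N. q ^ n) \<le> 1 / (1 - q)" .
    qed
    finally show "(\<Sum>\<gamma>\<in>X. q ^ mdeg \<gamma>) \<le> (1 / (1 - q)) ^ CARD('k)" by simp
  qed
qed (use q in auto)

lemma converges_normallyI:
  fixes c :: "('k::finite, complex) pseries"
  assumes "\<And>r. 0 < r \<Longrightarrow> r < \<rho> \<Longrightarrow> \<exists>B. \<forall>\<gamma>. norm (c \<gamma>) * r ^ mdeg \<gamma> \<le> B"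
  shows "converges_normally c \<rho>"
  unfolding converges_normally_iff
proof safe
  fix r assume r: "0 \<le> r" "r < \<rho>"
  define s where "s = (r + \<rho>) / 2"
  have s: "r < s" "s < \<rho>" "0 < s" using r by (auto simp: s_def)
  obtain B where B: "\<And>\<gamma>. norm (c \<gamma>) * s ^ mdeg \<gamma> \<le> B" using assms[of s] s by auto
  have "(\<lambda>\<gamma>::'k \<Rightarrow> nat. B * (r / s) ^ mdeg \<gamma>) summable_on UNIV"
    using r s by (intro summable_on_cmult_right geometric_summable) auto
  then show "(\<lambda>\<gamma>. norm (c \<gamma>) * r ^ mdeg \<gamma>) summable_on UNIV"
  proof (rule summable_on_comparison_test)
    fix \<gamma> :: "'k \<Rightarrow> nat"
    have "norm (c \<gamma>) * r ^ mdeg \<gamma> = (norm (c \<gamma>) * s ^ mdeg \<gamma>) * (r / s) ^ mdeg \<gamma>"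
      using s by (simp add: power_divide)
    also have "\<dots> \<le> B * (r / s) ^ mdeg \<gamma>" using r s by (intro mult_right_mono B) auto
    finally show "norm (c \<gamma>) * r ^ mdeg \<gamma> \<le> B * (r / s) ^ mdeg \<gamma>" .
  qed (use r in auto)
qed

lemma mhol_higher_partial_deriv: "mhol f S \<Longrightarrow> mhol (((\<lambda>f. partial_deriv f i) ^^ n) f) S"
  by (induction n) (auto intro: mhol_partial_deriv)

lemma mhol_bounded_closed_polydisc:
  fixes f :: "complex ^ 'k::finite \<Rightarrow> complex"
  assumes f: "mhol f (polydisc \<rho>)" and r: "r < \<rho>"
  obtains B where "\<And>x. (\<forall>k. norm (x $ k) \<le> r) \<Longrightarrow> norm (f x) \<le> B"
proof -
    have "compact {x :: complex ^ 'k. \<forall>k. norm (x $ k) \<le> r}"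
      unfolding compact_eq_bounded_closed
    proof
      have "norm x \<le> CARD('k) * r" if "\<forall>k. norm (x $ k) \<le> r" for x :: "complex ^ 'k"
      proof -
        have "norm x \<le> (\<Sum>k\<in>UNIV. norm (x $ k))"
          unfolding norm_vec_def by (rule L2_set_le_sum) simp
        also have "\<dots> \<le> (\<Sum>k\<in>(UNIV::'k set). r)" using that by (intro sum_mono) auto
        finally show ?thesis by simp
      qed
      then show "bounded {x :: complex ^ 'k. \<forall>k. norm (x $ k) \<le> r}" by (auto simp: bounded_iff)
      show "closed {x :: complex ^ 'k. \<forall>k. norm (x $ k) \<le> r}"
        by (intro closed_Collect_all closed_Collect_le continuous_intros)
    qed
    moreover have "{x :: complex ^ 'k. \<forall>k. norm (x $ k) \<le> r} \<subseteq> polydisc \<rho>"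
      using r by (auto simp: polydisc_def intro: le_less_trans)
    ultimately have "compact (f ` {x. \<forall>k. norm (x $ k) \<le> r})"
      using mhol_continuous_on[OF f] by (intro compact_continuous_image) (auto intro: continuous_on_subset)
    then obtain B where "\<forall>y\<in>f ` {x. \<forall>k. norm (x $ k) \<le> r}. norm y \<le> B"
      by (meson compact_imp_bounded bounded_iff)
    then show thesis using that by blast
qed

text \<open>
  The Taylor expansion is carried out in one variable after the other: the Taylor coefficients in
  \<open>x\<^sub>i\<close> are holomorphic functions of the remaining variables. The Cauchy estimate is part of the
  induction, because it makes the resulting multiple series absolutely convergent, which allows
  the regrouping.
\<close>

lemma ps_expansion_insert:
  fixes f :: "complex ^ 'k::finite \<Rightarrow> complex"
  assumes "finite S" "mhol f (polydisc \<rho>)" "\<rho> > 0"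
  shows "\<exists>c. (\<forall>\<gamma>. (\<exists>i. i \<notin> S \<and> \<gamma> i \<noteq> 0) \<longrightarrow> c \<gamma> = 0) \<and>
    (\<forall>r B. 0 < r \<and> r < \<rho> \<and> (\<forall>x. (\<forall>k. norm (x $ k) \<le> r) \<and> (\<forall>k. k \<notin> S \<longrightarrow> x $ k = 0) \<longrightarrow> norm (f x) \<le> B)
       \<longrightarrow> (\<forall>\<gamma>. norm (c \<gamma>) * r ^ mdeg \<gamma> \<le> B)) \<and>
    (\<forall>x\<in>polydisc \<rho>. (\<forall>k. k \<notin> S \<longrightarrow> x $ k = 0) \<longrightarrow> (ps_term c x has_sum f x) UNIV)"
  using assms
proof (induction S arbitrary: f rule: finite_induct)
  case empty
  let ?c = "\<lambda>\<gamma>::'k \<Rightarrow> nat. if \<gamma> = (\<lambda>_. 0) then f 0 else 0"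
  show ?case
  proof (intro exI[of _ ?c] conjI allI impI ballI)
    fix x :: "complex ^ 'k" assume "\<forall>k. k \<notin> {} \<longrightarrow> x $ k = 0"
    then have "x = 0" by (simp add: vec_eq_iff)
    then show "(ps_term ?c x has_sum f x) UNIV"
      by (intro has_sum_finite_neutralI[of "{\<lambda>_. 0}"]) (auto simp: ps_term_def)
  next
    fix r B \<gamma>
    assume "0 < r \<and> r < \<rho> \<and> (\<forall>x::complex ^ 'k. (\<forall>k. norm (x $ k) \<le> r) \<and> (\<forall>k. k \<notin> {} \<longrightarrow> x $ k = 0) \<longrightarrow> norm (f x) \<le> B)"
    then have "norm (f 0) \<le> B" by (metis less_imp_le norm_zero zero_index)
    then show "norm (?c \<gamma>) * r ^ mdeg \<gamma> \<le> B" by (auto intro: order_trans[OF norm_ge_zero])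
  qed auto
next
  case (insert i S f)
  define D where "D n = ((\<lambda>f. partial_deriv f i) ^^ n) f" for n
  define g where "g n x = inverse (fact n) * D n x" for n x
  have gh: "mhol (g n) (polydisc \<rho>)" for n
    unfolding g_def D_def using insert.prems by (intro mhol_mult mhol_higher_partial_deriv mhol_const open_polydisc)
  define P where "P n c \<longleftrightarrow> (\<forall>\<gamma>. (\<exists>i. i \<notin> S \<and> \<gamma> i \<noteq> 0) \<longrightarrow> c \<gamma> = 0) \<and>
    (\<forall>r B. 0 < r \<and> r < \<rho> \<and> (\<forall>x. (\<forall>k. norm (x $ k) \<le> r) \<and> (\<forall>k. k \<notin> S \<longrightarrow> x $ k = 0) \<longrightarrow> norm (g n x) \<le> B)
       \<longrightarrow> (\<forall>\<gamma>. norm (c \<gamma>) * r ^ mdeg \<gamma> \<le> B)) \<and>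
    (\<forall>x\<in>polydisc \<rho>. (\<forall>k. k \<notin> S \<longrightarrow> x $ k = 0) \<longrightarrow> (ps_term c x has_sum g n x) UNIV)" for n c
  have "\<exists>c. P n c" for n
    unfolding P_def by (rule insert.IH[OF gh \<open>\<rho> > 0\<close>])
  then obtain C where C: "\<And>n. P n (C n)" by metis
  have C0: "C n \<gamma> = 0" if "j \<notin> S" "\<gamma> j \<noteq> 0" for n \<gamma> j
    using C[of n] that unfolding P_def by blast
  have CB: "norm (C n \<gamma>) * r ^ mdeg \<gamma> \<le> B" if "0 < r" "r < \<rho>"
    "\<And>x. (\<forall>k. norm (x $ k) \<le> r) \<Longrightarrow> (\<forall>k. k \<notin> S \<longrightarrow> x $ k = 0) \<Longrightarrow> norm (g n x) \<le> B" for n r B \<gamma>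
    using C[of n] that unfolding P_def by blast
  have CS: "(ps_term (C n) x has_sum g n x) UNIV" if "x \<in> polydisc \<rho>" "\<forall>k. k \<notin> S \<longrightarrow> x $ k = 0" for n x
    using C[of n] that unfolding P_def by blast
  define c where "c \<gamma> = C (\<gamma> i) (\<gamma>(i := 0))" for \<gamma>
  have iS: "i \<notin> S" using insert by auto
  have Dline: "g n x = (deriv ^^ n) (\<lambda>s. f (x + axis i s)) 0 / fact n" for n x
    using higher_partial_deriv_axis[where i = i and n = n and f = f and x = x and s = 0] by (simp add: g_def D_def divide_inverse mult.commute)
  have line_in: "x + axis i s \<in> polydisc \<rho>"
    if "x \<in> polydisc \<rho>" "x $ i = 0" "norm s < \<rho>" for x and s :: complex
    using that by (auto simp: polydisc_def axis_def)
  have bound: "norm (c \<gamma>) * r ^ mdeg \<gamma> \<le> B"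
    if r: "0 < r" "r < \<rho>" and B: "\<And>x. (\<forall>k. norm (x $ k) \<le> r) \<Longrightarrow> (\<forall>k. k \<notin> insert i S \<longrightarrow> x $ k = 0) \<Longrightarrow> norm (f x) \<le> B"
    for r B \<gamma>
  proof -
    define n where "n = \<gamma> i"
    have "norm (C n (\<gamma>(i := 0))) * r ^ mdeg (\<gamma>(i := 0)) \<le> B / r ^ n"
    proof (rule CB[OF r])
      fix x :: "complex ^ 'k" assume x: "\<forall>k. norm (x $ k) \<le> r" "\<forall>k. k \<notin> S \<longrightarrow> x $ k = 0"
      have xi: "x $ i = 0" using x iS by auto
      have xp: "x \<in> polydisc \<rho>" using x r by (auto simp: polydisc_def intro: le_less_trans)
      have hol: "(\<lambda>s. f (x + axis i s)) holomorphic_on cball 0 r"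
        using mhol_line[OF insert.prems(1)] by (rule holomorphic_on_subset) (use line_in[OF xp xi] r in auto)
      have "norm ((deriv ^^ n) (\<lambda>s. f (x + axis i s)) 0) \<le> fact n * B / r ^ n"
      proof (rule Cauchy_inequality[OF _ _ r(1)])
        fix s :: complex assume "norm (0 - s) = r"
        then show "norm (f (x + axis i s)) \<le> B"
          using x xi by (intro B) (auto simp: axis_def)
      qed (use hol in \<open>auto intro: holomorphic_on_imp_continuous_on holomorphic_on_subset\<close>)
      then show "norm (g n x) \<le> B / r ^ n"
        by (simp add: Dline norm_divide field_simps)
    qed
    moreover have "mdeg \<gamma> = n + mdeg (\<gamma>(i := 0))"
      unfolding mdeg_upd by (simp add: mdeg_remove[of \<gamma> i] n_def)
    ultimately show ?thesis
      using r by (simp add: c_def n_def power_add field_simps)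
  qed
  have bound_ex: "\<exists>B. \<forall>\<gamma>. norm (c \<gamma>) * r ^ mdeg \<gamma> \<le> B" if r: "0 < r" "r < \<rho>" for r
    using mhol_bounded_closed_polydisc[OF insert.prems(1) r(2)] bound[OF r] by metis
  have conv: "converges_normally c \<rho>" by (rule converges_normallyI) (rule bound_ex)
  have sums: "(ps_term c x has_sum f x) UNIV"
    if x: "x \<in> polydisc \<rho>" "\<forall>k. k \<notin> insert i S \<longrightarrow> x $ k = 0" for x
  proof -
    define x' where "x' = (\<chi> k. if k = i then 0 else x $ k)"
    have x': "x' \<in> polydisc \<rho>" "x' $ i = 0" "\<forall>k. k \<notin> S \<longrightarrow> x' $ k = 0" "x' + axis i (x $ i) = x"
      using x \<open>\<rho> > 0\<close> by (auto simp: x'_def polydisc_def axis_def vec_eq_iff)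
    let ?E = "{\<gamma>::'k \<Rightarrow> nat. \<gamma> i = 0}"
    define h where "h = (\<lambda>(n, \<gamma>). \<gamma>(i := n) :: 'k \<Rightarrow> nat)"
    have bij: "bij_betw h (Sigma UNIV (\<lambda>_. ?E)) UNIV"
      by (rule bij_betwI[where g = "\<lambda>\<gamma>. (\<gamma> i, \<gamma>(i := 0))"]) (auto simp: h_def)
    have tot: "((\<lambda>p. ps_term c x (h p)) has_sum ps_sum c x) (Sigma UNIV (\<lambda>_. ?E))"
      using ps_summable[OF conv x(1)] has_sum_reindex_bij_betw[OF bij] by blast
    have inner: "((\<lambda>\<gamma>. ps_term c x (h (n, \<gamma>))) has_sum g n x' * (x $ i) ^ n) ?E" for n
    proof -
      have "((\<lambda>\<gamma>. ps_term (C n) x' \<gamma> * (x $ i) ^ n) has_sum g n x' * (x $ i) ^ n) UNIV"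
        by (intro has_sum_cmult_left CS x')
      then show ?thesis
      proof (subst has_sum_cong_neutral[where T = UNIV])
        fix \<gamma> assume "\<gamma> \<in> UNIV - ?E"
        then show "ps_term (C n) x' \<gamma> * (x $ i) ^ n = 0" using C0[OF iS, of \<gamma> n] by (simp add: ps_term_def)
      next
        fix \<gamma> assume "\<gamma> \<in> ?E \<inter> UNIV"
        then have \<gamma>: "\<gamma>(i := 0) = \<gamma>" by (auto simp: fun_eq_iff)
        have "(\<Prod>j\<in>UNIV. x $ j ^ (\<gamma>(i := n)) j) = x $ i ^ n * (\<Prod>j\<in>UNIV-{i}. x $ j ^ \<gamma> j)"
          by (subst prod.remove[of UNIV i]) auto
        moreover have "(\<Prod>j\<in>UNIV. x' $ j ^ \<gamma> j) = (\<Prod>j\<in>UNIV-{i}. x $ j ^ \<gamma> j)"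
          using \<open>\<gamma> \<in> ?E \<inter> UNIV\<close> by (subst prod.remove[of UNIV i]) (auto simp: x'_def intro!: prod.cong)
        ultimately show "ps_term c x (h (n, \<gamma>)) = ps_term (C n) x' \<gamma> * (x $ i) ^ n"
          using \<gamma> by (simp add: ps_term_def h_def c_def)
      qed auto
    qed
    have "((\<lambda>n. g n x' * (x $ i) ^ n) has_sum ps_sum c x) UNIV"
      by (rule has_sum_SigmaD[OF tot]) (use inner in auto)
    then have "(\<lambda>n. g n x' * (x $ i) ^ n) sums ps_sum c x" by (rule has_sum_imp_sums)
    moreover have "(\<lambda>n. g n x' * (x $ i) ^ n) sums f x"
    proof -
      have "(\<lambda>s. f (x' + axis i s)) holomorphic_on ball 0 \<rho>"
        using mhol_line[OF insert.prems(1)] by (rule holomorphic_on_subset) (use line_in[OF x'(1,2)] in auto)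
      from holomorphic_power_series[OF this, of "x $ i"] x(1)
      show ?thesis by (simp add: Dline x' polydisc_def)
    qed
    ultimately have "ps_sum c x = f x" using sums_unique2 by blast
    then show ?thesis using ps_summable[OF conv x(1)] by simp
  qed
  show ?case
  proof (intro exI[of _ c] conjI allI impI ballI)
    fix \<gamma> :: "'k \<Rightarrow> nat" assume "\<exists>j. j \<notin> insert i S \<and> \<gamma> j \<noteq> 0"
    then obtain j where "j \<notin> S" "(\<gamma>(i := 0)) j \<noteq> 0" by auto
    then show "c \<gamma> = 0" unfolding c_def by (rule C0)
  qed (use bound sums in blast)+
qed

theorem mhol_ps_expansion:
  fixes f :: "complex ^ 'k::finite \<Rightarrow> complex"
  assumes f: "mhol f (polydisc \<rho>)" and \<rho>: "\<rho> > 0"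
  obtains c where "converges_normally c \<rho>" "\<And>x. x \<in> polydisc \<rho> \<Longrightarrow> ps_sum c x = f x"
proof -
  obtain c where bnd: "\<forall>r B. 0 < r \<and> r < \<rho> \<and> (\<forall>x. (\<forall>k. norm (x $ k) \<le> r) \<and> (\<forall>k. k \<notin> UNIV \<longrightarrow> x $ k = 0) \<longrightarrow> norm (f x) \<le> B)
       \<longrightarrow> (\<forall>\<gamma>. norm (c \<gamma>) * r ^ mdeg \<gamma> \<le> B)"
    and sm: "\<forall>x\<in>polydisc \<rho>. (\<forall>k. k \<notin> UNIV \<longrightarrow> x $ k = 0) \<longrightarrow> (ps_term c x has_sum f x) UNIV"
    using ps_expansion_insert[OF finite_class.finite_UNIV f \<rho>] by blast
  show thesis
  proof (rule that)
    show "ps_sum c x = f x" if "x \<in> polydisc \<rho>" for x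
      using sm that unfolding ps_sum_def by (simp add: infsumI)
    show "converges_normally c \<rho>"
    proof (rule converges_normallyI)
      fix r assume "0 < r" "r < \<rho>"
      then show "\<exists>B. \<forall>\<gamma>. norm (c \<gamma>) * r ^ mdeg \<gamma> \<le> B"
        using mhol_bounded_closed_polydisc[OF f, of r] bnd by metis
    qed
  qed
qed

section \<open>Identity theorems\<close>

lemma mhol_eq_0I:
  fixes f :: "complex ^ 'k::finite \<Rightarrow> complex"
  assumes f: "mhol f (polydisc \<rho>)" and Z: "Z f"
    and Z0: "\<And>f. Z f \<Longrightarrow> f 0 = 0"
    and Zd: "\<And>f i. mhol f (polydisc \<rho>) \<Longrightarrow> Z f \<Longrightarrow> Z (partial_deriv f i)"
    and Zc: "\<And>f g. Z f \<Longrightarrow> (\<And>x. x \<in> polydisc \<rho> \<Longrightarrow> f x = g x) \<Longrightarrow> Z g"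
    and x: "x \<in> polydisc \<rho>"
  shows "f x = 0"
proof -
  have \<rho>: "\<rho> > 0" using x unfolding polydisc_def by (auto intro: le_less_trans[OF norm_ge_zero])
  obtain c where c: "converges_normally c \<rho>" "\<And>x. x \<in> polydisc \<rho> \<Longrightarrow> ps_sum c x = f x"
    using mhol_ps_expansion[OF f \<rho>] by blast
  have "c = (\<lambda>_. 0)"
    by (rule ps_eq_0I[OF c(1) \<rho>, of Z]) (use Z0 Zd Zc[OF Z] c(2) in auto)
  then have "ps_sum c x = 0" by (simp add: ps_sum_def ps_term_def)
  then show ?thesis using c(2)[OF x] by simp
qed

lemma mhol_identity:
  fixes f :: "complex ^ 'k::finite \<Rightarrow> complex"
  assumes f: "mhol f (polydisc \<rho>)" and ev: "\<forall>\<^sub>F x in nhds 0. f x = 0" and x: "x \<in> polydisc \<rho>"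
  shows "f x = 0"
proof (rule mhol_eq_0I[OF f, where Z = "\<lambda>f. \<forall>\<^sub>F x in nhds 0. f x = 0"])
  have \<rho>: "\<rho> > 0" using x unfolding polydisc_def by (auto intro: le_less_trans[OF norm_ge_zero])
  fix f g :: "complex ^ 'k \<Rightarrow> complex"
  assume f0: "\<forall>\<^sub>F x in nhds 0. f x = 0" and eq: "\<And>x. x \<in> polydisc \<rho> \<Longrightarrow> f x = g x"
  have P: "\<forall>\<^sub>F x in nhds 0. x \<in> (polydisc \<rho> :: (complex ^ 'k) set)"
    by (rule eventually_nhds_in_open[OF open_polydisc]) (use \<rho> in simp)
  from f0 P show "\<forall>\<^sub>F x in nhds 0. g x = 0" by (rule eventually_elim2) (use eq in auto)
qed (use ev x in \<open>auto dest: eventually_nhds_x_imp_x eventually_partial_deriv_0\<close>)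

lemma has_derivative_0_of_zero_curve:
  fixes f :: "'a::real_normed_vector \<Rightarrow> 'b::real_normed_vector" and \<gamma> :: "real \<Rightarrow> 'a"
  assumes f: "(f has_derivative D) (at (\<gamma> 0))" and \<gamma>: "(\<gamma> has_vector_derivative v) (at 0)"
    and ev: "\<forall>\<^sub>F t in nhds 0. f (\<gamma> t) = 0"
  shows "D v = 0"
proof -
  have "((\<lambda>t. f (\<gamma> t)) has_derivative (\<lambda>t. D (t *\<^sub>R v))) (at 0)"
    using has_derivative_compose[OF \<gamma>[unfolded has_vector_derivative_def] f] by simp
  moreover have "((\<lambda>t. f (\<gamma> t)) has_derivative (\<lambda>t. 0)) (at 0)"
  proof (rule has_derivative_transform_eventually[of "\<lambda>_. 0"])
    show "\<forall>\<^sub>F t in at 0. 0 = f (\<gamma> t)"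
      using ev by (auto simp: eventually_at_filter elim: eventually_mono)
    show "0 = f (\<gamma> 0)" using eventually_nhds_x_imp_x[OF ev] by simp
  qed auto
  ultimately have "(\<lambda>t. D (t *\<^sub>R v)) = (\<lambda>t. 0)" by (rule has_derivative_unique)
  from fun_cong[OF this, of 1] show ?thesis by simp
qed

definition cvec :: "real ^ 'k::finite \<Rightarrow> complex ^ 'k"
  where "cvec x = (\<chi> i. complex_of_real (x $ i))"

lemma cvec_0 [simp]: "cvec 0 = 0" by (simp add: cvec_def vec_eq_iff)

lemma cvec_add_axis: "cvec (x + axis i t) = cvec x + axis i (complex_of_real t)"
  by (auto simp: cvec_def vec_eq_iff axis_def)

lemma continuous_on_cvec: "continuous_on A cvec"
  unfolding cvec_def by (intro continuous_intros)

lemma eventually_cvec: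
  assumes "open S" "0 \<in> S"
  shows "\<forall>\<^sub>F x in nhds 0. cvec x \<in> S"
proof -
  have "open (cvec -` S)"
    by (rule open_vimage[OF assms(1) continuous_on_cvec])
  from eventually_nhds_in_open[OF this, of 0] show ?thesis using assms by simp
qed

text \<open>
  On the real points the partial derivatives are real limits of difference quotients, so the
  real points determine a holomorphic function.
\<close>

lemma mhol_zero_on_reals:
  fixes f :: "complex ^ 'k::finite \<Rightarrow> complex"
  assumes f: "mhol f (polydisc \<rho>)" and ev: "\<forall>\<^sub>F x in nhds 0. f (cvec x) = 0" and x: "x \<in> polydisc \<rho>"
  shows "f x = 0"
proof (rule mhol_eq_0I[OF f, where Z = "\<lambda>f. \<forall>\<^sub>F x in nhds 0. f (cvec x) = 0"])
  have "\<rho> > 0" using x unfolding polydisc_def by (auto intro: le_less_trans[OF norm_ge_zero])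
  then have P: "\<forall>\<^sub>F x in nhds 0. cvec x \<in> (polydisc \<rho> :: (complex ^ 'k) set)"
    by (intro eventually_cvec open_polydisc) auto
  {
    fix f g :: "complex ^ 'k \<Rightarrow> complex"
    assume "\<forall>\<^sub>F x in nhds 0. f (cvec x) = 0" and eq: "\<And>x. x \<in> polydisc \<rho> \<Longrightarrow> f x = g x"
    from P this(1) show "\<forall>\<^sub>F x in nhds 0. g (cvec x) = 0"
      by (rule eventually_elim2) (use eq in auto)
  next
    fix f i assume f: "mhol f (polydisc \<rho> :: (complex ^ 'k) set)" and ev: "\<forall>\<^sub>F x in nhds 0. f (cvec x) = 0"
    have "\<forall>\<^sub>F x in nhds 0. \<forall>\<^sub>F y in nhds x. f (cvec y) = 0" using ev by (simp add: eventually_eventually)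
    with P show "\<forall>\<^sub>F x in nhds 0. partial_deriv f i (cvec x) = 0"
    proof eventually_elim
      case (elim x)
      have c: "((\<lambda>t. x + axis i t) \<longlongrightarrow> x) (nhds 0)"
      proof -
        have "continuous_on UNIV (\<lambda>t::real. x + axis i t)"
        proof -
          have "continuous_on UNIV (\<lambda>t. if j = i then t else (0::real))" for j by (cases "j = i") auto
          then show ?thesis unfolding axis_def by (intro continuous_intros)
        qed
        then have "((\<lambda>t. x + axis i t) \<longlongrightarrow> x + axis i 0) (nhds 0)"
          by (intro continuous_on_tendsto_compose[OF _ filterlim_ident]) auto
        then show ?thesis by simp
      qed
      have "((\<lambda>s. f (cvec x + axis i s)) has_field_derivative partial_deriv f i (cvec x + axis i 0)) (at 0)"
        using mhol_has_partial[OF f, of "cvec x" i 0] elim by simp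
      then have fd: "((\<lambda>s. f (cvec x + axis i s)) has_derivative (*) (partial_deriv f i (cvec x))) (at (of_real 0))"
        by (simp add: has_field_derivative_def)
      have "partial_deriv f i (cvec x) * 1 = 0"
      proof (rule has_derivative_0_of_zero_curve[where \<gamma> = "\<lambda>t::real. of_real t", OF fd])
        show "(complex_of_real has_vector_derivative 1) (at 0)"
          by (auto intro!: derivative_eq_intros)
        show "\<forall>\<^sub>F t in nhds 0. f (cvec x + axis i (complex_of_real t)) = 0"
          using eventually_compose_filterlim[OF elim(2) c] by (simp add: cvec_add_axis)
      qed
      then show ?case by simp
    qed
  }
  show "f 0 = 0" if "\<forall>\<^sub>F x in nhds 0. f (cvec x) = 0" for f :: "complex ^ 'k \<Rightarrow> complex"
    using eventually_nhds_x_imp_x[OF that] by simp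
qed (use ev x in auto)

section \<open>Inverse functions\<close>

lemma continuous_on_inv_blinfun:
  fixes A :: "'b::metric_space \<Rightarrow> 'a::euclidean_space \<Rightarrow>\<^sub>L 'a"
  assumes A: "continuous_on S A" and bij: "\<And>y. y \<in> S \<Longrightarrow> bij (blinfun_apply (A y))"
  shows "continuous_on S (\<lambda>y. inv (blinfun_apply (A y)) v)"
  unfolding continuous_on_def
proof
  fix y0 assume y0: "y0 \<in> S"
  define B where "B = inv (blinfun_apply (A y0))"
  have "linear B"
  proof -
    have "linear (blinfun_apply (A y0))" "inj (blinfun_apply (A y0))"
      using bij[OF y0] by (auto simp: bij_is_inj blinfun.bounded_linear_right bounded_linear.linear)
    then obtain g where g: "linear g" "g \<circ> blinfun_apply (A y0) = id"
      using linear_injective_left_inverse by blast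
    have "B u = g u" for u
    proof -
      have "A y0 (B u) = u" unfolding B_def using bij[OF y0] by (simp add: bij_is_surj surj_f_inv_f)
      then show ?thesis using fun_cong[OF g(2), of "B u"] by simp
    qed
    then have "B = g" by blast
    then show ?thesis using g by simp
  qed
  then have "bounded_linear B" by (simp add: linear_conv_bounded_linear)
  then obtain K where K: "K > 0" "\<And>u. norm (B u) \<le> norm u * K"
    using bounded_linear.pos_bounded by blast
  define w0 where "w0 = B v"
  \<comment> \<open>From \<open>A(y) w = v = A(y\<^sub>0) w\<^sub>0\<close> follows \<open>w - w\<^sub>0 = A(y\<^sub>0)\<^sup>-\<^sup>1 (A(y\<^sub>0) - A(y)) w\<close>.\<close>
  have est: "norm (inv (blinfun_apply (A y)) v - w0) \<le> 2 * K * norm w0 * norm (A y - A y0)"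
    if y: "y \<in> S" and small: "norm (A y - A y0) < 1 / (2 * K)" for y
  proof -
    define w where "w = inv (blinfun_apply (A y)) v"
    have "A y w = v" unfolding w_def using bij[OF y] by (simp add: bij_is_surj surj_f_inv_f)
    have "B (A y0 w) = w" unfolding B_def using bij[OF y0] by (simp add: bij_is_inj)
    then have "w - w0 = B (A y0 w - A y w)"
      using \<open>linear B\<close> \<open>A y w = v\<close> by (simp add: w0_def linear_diff)
    also have "norm \<dots> \<le> norm (A y0 w - A y w) * K" by (rule K)
    also have "norm (A y0 w - A y w) \<le> norm (A y - A y0) * norm w"
      using norm_blinfun[of "A y0 - A y" w] by (simp add: blinfun.diff_left norm_minus_commute)
    finally have 1: "norm (w - w0) \<le> norm (A y - A y0) * norm w * K" using K by (simp add: mult_right_mono)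
    define e where "e = norm (A y - A y0) * K"
    have e: "0 \<le> e" "e \<le> 1 / 2" using small K by (auto simp: e_def field_simps)
    have "norm w \<le> norm w0 + norm (w - w0)" using norm_triangle_ineq[of w0 "w - w0"] by simp
    then have "norm (w - w0) \<le> e * (norm w0 + norm (w - w0))"
      using 1 e by (smt (verit, best) e_def mult.assoc mult.commute mult_left_mono)
    also have "\<dots> \<le> e * norm w0 + norm (w - w0) / 2"
      using mult_right_mono[OF e(2) norm_ge_zero[of "w - w0"]] by (simp add: distrib_left)
    finally have "norm (w - w0) \<le> 2 * e * norm w0" by simp
    then show ?thesis by (simp add: w_def e_def mult_ac)
  qed
  have lim: "((\<lambda>y. norm (A y - A y0)) \<longlongrightarrow> 0) (at y0 within S)"
    using A y0 by (simp add: continuous_on_def LIM_zero_iff tendsto_norm_zero)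
  have ev: "\<forall>\<^sub>F y in at y0 within S. y \<in> S \<and> norm (A y - A y0) < 1 / (2 * K)"
    using order_tendstoD(2)[OF lim, of "1 / (2 * K)"] K
    by (auto simp: eventually_at_filter elim: eventually_mono)
  have "((\<lambda>y. inv (blinfun_apply (A y)) v - w0) \<longlongrightarrow> 0) (at y0 within S)"
  proof (rule Lim_null_comparison)
    show "\<forall>\<^sub>F y in at y0 within S. norm (inv (blinfun_apply (A y)) v - w0) \<le> 2 * K * norm w0 * norm (A y - A y0)"
      using ev by eventually_elim (use est in auto)
    show "((\<lambda>y. 2 * K * norm w0 * norm (A y - A y0)) \<longlongrightarrow> 0) (at y0 within S)"
      using tendsto_mult_right_zero[OF lim] by simp
  qed
  then show "((\<lambda>y. inv (blinfun_apply (A y)) v) \<longlongrightarrow> inv (blinfun_apply (A y0)) v) (at y0 within S)"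
    by (simp add: w0_def B_def LIM_zero_iff)
qed

text \<open>
  The last conclusion, that the derivative of the inverse is continuous, makes the curves
  constructed with the inverse continuously differentiable.
\<close>

theorem C1_inverse_function:
  fixes F :: "'a::euclidean_space \<Rightarrow> 'a" and D :: "'a \<Rightarrow> 'a \<Rightarrow> 'a"
  assumes S: "open S" "x0 \<in> S"
    and D: "\<And>x. x \<in> S \<Longrightarrow> (F has_derivative D x) (at x)"
    and cont: "\<And>v. continuous_on S (\<lambda>x. D x v)"
    and inj: "\<And>v. D x0 v = 0 \<Longrightarrow> v = 0"
  obtains U V G where "open U" "U \<subseteq> S" "x0 \<in> U" "open V" "F x0 \<in> V" "homeomorphism U V F G"
    "\<And>y. y \<in> V \<Longrightarrow> bij (D (G y)) \<and> (G has_derivative inv (D (G y))) (at y)"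
    "\<And>v. continuous_on V (\<lambda>y. inv (D (G y)) v)"
proof -
  define f' where "f' x = Blinfun (D x)" for x
  have f': "blinfun_apply (f' x) = D x" if "x \<in> S" for x
    unfolding f'_def using D[OF that] has_derivative_bounded_linear bounded_linear_Blinfun_apply by blast
  have cf': "continuous_on S f'"
  proof (rule continuous_on_blinfun_componentwise)
    fix i :: 'a
    show "continuous_on S (\<lambda>x. blinfun_apply (f' x) i)"
      using cont[of i] by (rule continuous_on_eq) (simp add: f')
  qed
  have lin: "linear (D x0)" using D[OF S(2)] has_derivative_linear by blast
  then have "inj (D x0)" using inj by (simp add: linear_injective_0)
  then obtain g where g: "linear g" "g \<circ> D x0 = id" using lin linear_injective_left_inverse by blast
  define invf where "invf = Blinfun g"
  have invf: "blinfun_apply invf = g"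
    unfolding invf_def using g by (simp add: bounded_linear_Blinfun_apply linear_conv_bounded_linear)
  have "invf o\<^sub>L f' x0 = id_blinfun"
    by (rule blinfun_eqI) (use g in \<open>auto simp: invf f'[OF S(2)] fun_eq_iff\<close>)
  from inverse_function_theorem[OF S(1) _ cf' S(2) this, of F] D f'
  obtain U V G G' where *: "open U" "U \<subseteq> S" "x0 \<in> U" "open V" "F x0 \<in> V" "homeomorphism U V F G"
    "\<And>y. y \<in> V \<Longrightarrow> (G has_derivative (G' y)) (at y)"
    "\<And>y. y \<in> V \<Longrightarrow> G' y = inv (blinfun_apply (f'(G y)))"
    "\<And>y. y \<in> V \<Longrightarrow> bij (blinfun_apply (f'(G y)))"
    by (smt (verit, ccfv_threshold))
  have GS: "G y \<in> S" if "y \<in> V" for y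
    using *(2) homeomorphism_image2[OF *(6)] that by blast
  show thesis
  proof (rule that[OF *(1-6)])
    show "bij (D (G y)) \<and> (G has_derivative inv (D (G y))) (at y)" if "y \<in> V" for y
      using *(7-9)[OF that] f'[OF GS[OF that]] by simp
    have "continuous_on V (\<lambda>y. f' (G y))"
      by (rule continuous_on_compose2[OF cf']) (use homeomorphism_cont2[OF *(6)] GS in auto)
    from continuous_on_inv_blinfun[OF this *(9)]
    show "continuous_on V (\<lambda>y. inv (D (G y)) v)" for v
      by (rule continuous_on_eq) (simp_all add: f' GS)
  qed
qed

theorem mhol_inverse_function:
  fixes F :: "complex ^ 'k::finite \<Rightarrow> complex ^ 'k"
  assumes F: "\<And>i. mhol (\<lambda>x. F x $ i) S" and x0: "x0 \<in> S"
    and inj: "\<And>v. (\<And>i. cdiff (\<lambda>x. F x $ i) x0 v = 0) \<Longrightarrow> v = 0"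
  obtains U V G where "open U" "U \<subseteq> S" "x0 \<in> U" "open V" "F x0 \<in> V"
    "\<And>x. x \<in> U \<Longrightarrow> F x \<in> V \<and> G (F x) = x" "\<And>y. y \<in> V \<Longrightarrow> G y \<in> U \<and> F (G y) = y"
    "\<And>i. mhol (\<lambda>y. G y $ i) V"
proof -
  define D where "D x v = (\<chi> i. cdiff (\<lambda>x. F x $ i) x v)" for x v
  have S: "open S" using F mhol_open by blast
  have Dd: "(F has_derivative D x) (at x)" if "x \<in> S" for x
    by (rule has_derivative_vecI) (simp add: D_def mhol_has_derivative[OF F that])
  have Dc: "continuous_on S (\<lambda>x. D x v)" for v
    unfolding D_def cdiff_def
    by (intro continuous_intros mhol_continuous_on[OF mhol_partial_deriv[OF F]])
  have Di: "v = 0" if "D x0 v = 0" for v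
    by (rule inj) (use that in \<open>simp add: D_def vec_eq_iff\<close>)
  obtain U V G where *: "open U" "U \<subseteq> S" "x0 \<in> U" "open V" "F x0 \<in> V" "homeomorphism U V F G"
    "\<And>y. y \<in> V \<Longrightarrow> bij (D (G y)) \<and> (G has_derivative inv (D (G y))) (at y)"
    "\<And>v. continuous_on V (\<lambda>y. inv (D (G y)) v)"
    by (rule C1_inverse_function[OF S x0 Dd Dc Di], assumption, assumption, rule that)
  show thesis
  proof (rule that[OF *(1-5)])
    show "F x \<in> V \<and> G (F x) = x" if "x \<in> U" for x
      using homeomorphism_image1[OF *(6)] homeomorphism_apply1[OF *(6)] that by blast
    show "G y \<in> U \<and> F (G y) = y" if "y \<in> V" for y
      using homeomorphism_image2[OF *(6)] homeomorphism_apply2[OF *(6)] that by blast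
    fix i
    show "mhol (\<lambda>y. G y $ i) V"
    proof (rule mholI_has_derivative[OF *(4)])
      fix y assume y: "y \<in> V"
      have hom: "inv (D (G y)) (c *s v) = c *s inv (D (G y)) v" for c v
      proof -
        have "D (G y) (c *s inv (D (G y)) v) = c *s D (G y) (inv (D (G y)) v)"
          by (simp add: D_def vec_eq_iff cdiff_scale)
        also have "\<dots> = c *s v" using *(7)[OF y] by (simp add: bij_is_surj surj_f_inv_f)
        finally show ?thesis using *(7)[OF y] by (metis bij_inv_eq_iff)
      qed
      have "((\<lambda>y. G y $ i) has_derivative (\<lambda>v. inv (D (G y)) v $ i)) (at y)"
        by (rule bounded_linear.has_derivative[OF bounded_linear_vec_nth]) (use *(7)[OF y] in simp)
      then show "\<exists>D. ((\<lambda>y. G y $ i) has_derivative D) (at y) \<and> (\<forall>c v. D (c *s v) = c * D v)"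
        by (intro exI[of _ "\<lambda>v. inv (D (G y)) v $ i"]) (simp add: hom)
    qed
  qed
qed


section \<open>Tangent spaces of zero sets\<close>

lemma tangent_space_subset_kernel:
  assumes v: "v \<in> tangent_space M p" and f: "(f has_derivative D) (at p)"
    and S: "open S" "p \<in> S" and zero: "\<And>x. x \<in> M \<Longrightarrow> x \<in> S \<Longrightarrow> f x = 0"
  shows "D v = 0"
proof -
  obtain \<gamma> :: "real \<Rightarrow> complex ^ 'a" and \<epsilon> where \<epsilon>: "\<epsilon> > 0" and \<gamma>: "\<forall>t\<in>{-\<epsilon><..<\<epsilon>}. \<gamma> t \<in> M" "\<gamma> 0 = p"
    "(\<gamma> has_vector_derivative v) (at 0)"
    using v unfolding tangent_space_def by blast
  have "\<forall>\<^sub>F t in nhds 0. \<gamma> t \<in> S"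
  proof -
    have "isCont \<gamma> 0" using \<gamma>(3) has_vector_derivative_continuous by blast
    then have "(\<gamma> \<longlongrightarrow> \<gamma> 0) (nhds 0)" by (simp add: continuous_at tendsto_nhds_iff)
    then show ?thesis using S \<gamma>(2) by (auto elim: topological_tendstoD)
  qed
  moreover have "\<forall>\<^sub>F t in nhds 0. t \<in> {-\<epsilon><..<\<epsilon>}"
    by (rule eventually_nhds_in_open) (use \<epsilon> in auto)
  ultimately have "\<forall>\<^sub>F t in nhds 0. f (\<gamma> t) = 0"
    by eventually_elim (use zero \<gamma>(1) in auto)
  then show ?thesis using has_derivative_0_of_zero_curve[of f D \<gamma> v] f \<gamma> by simp
qed

lemma independent_functionals_dual:
  fixes L :: "'d::finite \<Rightarrow> 'a::euclidean_space \<Rightarrow> real"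
  assumes lin: "\<And>j. linear (L j)"
    and ind: "\<And>a. (\<And>v. (\<Sum>j\<in>UNIV. a j * L j v) = 0) \<Longrightarrow> (\<forall>j. a j = 0)"
  obtains u where "\<And>i j. L i (u j) = (if i = j then 1 else 0)"
proof -
  define T where "T v = (\<chi> j. L j v)" for v
  have T: "linear T"
    by (rule linearI) (auto simp: T_def vec_eq_iff linear_add[OF lin] linear_cmul[OF lin])
  have "range T = UNIV"
  proof (rule ccontr)
    assume ne: "range T \<noteq> UNIV"
    have sub: "span (range T) = range T"
      by (simp add: T linear_subspace_image span_eq_iff)
    have "dim (range T) < DIM(real ^ 'd)"
      using ne sub by (metis dim_eq_full dim_subset_UNIV le_neq_implies_less)
    then obtain x where x: "x \<noteq> 0" "\<And>y. y \<in> span (range T) \<Longrightarrow> orthogonal x y"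
      using orthogonal_to_subspace_exists by blast
    have "(\<Sum>j\<in>UNIV. x $ j * L j v) = 0" for v
    proof -
      have "T v \<in> span (range T)" by (simp add: span_base)
      from x(2)[OF this] show ?thesis by (simp add: orthogonal_def inner_vec_def T_def)
    qed
    then have "\<forall>j. x $ j = 0" by (rule ind)
    with x(1) show False by (simp add: vec_eq_iff)
  qed
  then have "\<exists>w. T w = axis j 1" for j by (metis rangeE UNIV_I)
  then obtain u where u: "\<And>j. T (u j) = axis j 1" by metis
  show thesis
  proof (rule that[of u])
    show "L i (u j) = (if i = j then 1 else 0)" for i j
      using arg_cong[OF u[of j], of "\<lambda>w. w $ i"] by (auto simp: T_def axis_def)
  qed
qed

text \<open>
  The map \<open>\<Phi>\<close> below has derivative the identity at \<open>p\<close> and satisfies \<open>dr\<^sub>i(\<Phi>(x)) = r\<^sub>i(x)\<close>: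
  it straightens the common zero set, and the inverse images of lines are the required curves.
\<close>

theorem kernel_subset_tangent_space:
  fixes r :: "'d::finite \<Rightarrow> complex ^ 'n::finite \<Rightarrow> real"
  assumes S: "open S" "p \<in> S"
    and D: "\<And>j x. x \<in> S \<Longrightarrow> (r j has_derivative D j x) (at x)"
    and cont: "\<And>j v. continuous_on S (\<lambda>x. D j x v)"
    and ind: "\<And>a. (\<And>v. (\<Sum>j\<in>UNIV. a j * D j p v) = 0) \<Longrightarrow> (\<forall>j. a j = 0)"
    and r0: "\<And>j. r j p = 0"
    and M: "\<And>x. x \<in> S \<Longrightarrow> (\<And>j. r j x = 0) \<Longrightarrow> x \<in> M"
    and v: "\<And>j. D j p v = 0"
  shows "v \<in> tangent_space M p"
proof -
  have lin: "linear (D j x)" if "x \<in> S" for j x using D[OF that] has_derivative_linear by blast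
  obtain u where u: "\<And>i j. D i p (u j) = (if i = j then 1 else 0)"
    using independent_functionals_dual[of "\<lambda>j. D j p"] lin[OF S(2)] ind by blast
  define \<Phi> where "\<Phi> x = (x - p) + (\<Sum>j\<in>UNIV. (r j x - D j p (x - p)) *\<^sub>R u j)" for x
  define E where "E x w = w + (\<Sum>j\<in>UNIV. (D j x w - D j p w) *\<^sub>R u j)" for x w
  have Ed: "(\<Phi> has_derivative E x) (at x)" if "x \<in> S" for x
  proof -
    have b: "bounded_linear (D j p)" for j using D[OF S(2)] has_derivative_bounded_linear by blast
    have "((\<lambda>x. D j p (x - p)) has_derivative D j p) (at x)" for j
      by (rule bounded_linear.has_derivative[OF b]) (auto intro!: derivative_eq_intros)
    then show ?thesis unfolding \<Phi>_def E_def
      by (auto intro!: derivative_eq_intros D[OF that])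
  qed
  have Ec: "continuous_on S (\<lambda>x. E x w)" for w
    unfolding E_def by (intro continuous_intros cont)
  have Ei: "w = 0" if "E p w = 0" for w using that by (simp add: E_def)
  obtain U V G where UV: "open U" "U \<subseteq> S" "p \<in> U" "open V" "\<Phi> p \<in> V" "homeomorphism U V \<Phi> G"
    and G: "\<And>y. y \<in> V \<Longrightarrow> bij (E (G y)) \<and> (G has_derivative inv (E (G y))) (at y)"
    and Gc: "\<And>v. continuous_on V (\<lambda>y. inv (E (G y)) v)"
    by (rule C1_inverse_function[OF S Ed Ec Ei], assumption, assumption, rule that)
  have Dr: "D i p (\<Phi> x) = r i x" for i x
    using lin[OF S(2), of i]
    by (simp add: \<Phi>_def linear_add linear_diff linear_sum linear_cmul u if_distrib cong: if_cong)
  have "\<Phi> p = 0" by (simp add: \<Phi>_def r0 linear_0[OF lin[OF S(2)]])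
  then have V0: "0 \<in> V" using UV by simp
  have "open ((\<lambda>t::real. t *\<^sub>R v) -` V)"
    by (intro open_vimage UV continuous_intros)
  then obtain \<epsilon> where \<epsilon>: "\<epsilon> > 0" "ball 0 \<epsilon> \<subseteq> (\<lambda>t::real. t *\<^sub>R v) -` V"
    using V0 open_contains_ball by (metis scaleR_zero_left vimage_eq)
  have tV: "t *\<^sub>R v \<in> V" if "t \<in> {-\<epsilon><..<\<epsilon>}" for t
    using \<epsilon>(2) that by (auto simp: subset_iff dist_norm)
  define \<gamma> where "\<gamma> t = G (t *\<^sub>R v)" for t
  have d: "(\<gamma> has_vector_derivative inv (E (G (t *\<^sub>R v))) v) (at t)" if "t \<in> {-\<epsilon><..<\<epsilon>}" for t
  proof -
    have g: "(G has_derivative inv (E (G (t *\<^sub>R v)))) (at (t *\<^sub>R v))" using G tV[OF that] by blast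
    have "((\<lambda>t. t *\<^sub>R v) has_derivative (\<lambda>s. s *\<^sub>R v)) (at t)" by (auto intro!: derivative_eq_intros)
    from has_derivative_compose[OF this g]
    show ?thesis unfolding \<gamma>_def has_vector_derivative_def
      by (simp add: linear_cmul[OF has_derivative_linear[OF g]])
  qed
  have "\<gamma> C1_differentiable_on {-\<epsilon><..<\<epsilon>}"
    unfolding C1_differentiable_on_def
  proof (intro exI conjI ballI)
    show "continuous_on {-\<epsilon><..<\<epsilon>} (\<lambda>t. inv (E (G (t *\<^sub>R v))) v)"
      by (rule continuous_on_compose2[OF Gc]) (use tV in \<open>auto intro!: continuous_intros\<close>)
  qed (use d in auto)
  moreover have "\<gamma> t \<in> M" if "t \<in> {-\<epsilon><..<\<epsilon>}" for t
  proof (rule M)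
    have "\<gamma> t \<in> U" "\<Phi> (\<gamma> t) = t *\<^sub>R v"
      unfolding \<gamma>_def using homeomorphism_image2[OF UV(6)] homeomorphism_apply2[OF UV(6)] tV[OF that] by blast+
    then show "\<gamma> t \<in> S" using UV by blast
    show "r j (\<gamma> t) = 0" for j
      using Dr[of j "\<gamma> t"] \<open>\<Phi> (\<gamma> t) = t *\<^sub>R v\<close> v by (simp add: linear_cmul[OF lin[OF S(2)]])
  qed
  moreover have G0: "G 0 = p" using homeomorphism_apply1[OF UV(6,3)] \<open>\<Phi> p = 0\<close> by simp
  moreover have "(\<gamma> has_vector_derivative v) (at 0)"
  proof -
    have "E p v = v" by (simp add: E_def)
    moreover have "bij (E p)" using G[OF V0] G0 by simp
    ultimately have "inv (E p) v = v" by (metis bij_inv_eq_iff)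
    then show ?thesis using d[of 0] \<epsilon> G0 by simp
  qed
  ultimately show ?thesis unfolding tangent_space_def using \<epsilon>(1)
    by (intro CollectI exI[of _ \<gamma>] exI[of _ \<epsilon>]) (auto simp: \<gamma>_def)
qed

section \<open>Polynomial functions\<close>

text \<open>
  Closure under multiplication by a coordinate, rather than under all products, makes it easy to
  read off the coefficient family of a polynomial function by induction; closure under products is
  derived.
\<close>

inductive polyfn :: "('a::real_normed_field ^ 'k::finite \<Rightarrow> 'a) \<Rightarrow> bool" where
  polyfn_const: "polyfn (\<lambda>_. c)"
| polyfn_add: "polyfn p \<Longrightarrow> polyfn q \<Longrightarrow> polyfn (\<lambda>x. p x + q x)"
| polyfn_mult_coord: "polyfn p \<Longrightarrow> polyfn (\<lambda>x. p x * x $ i)"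

lemma polyfn_coord: "polyfn (\<lambda>x. x $ i)"
  using polyfn_mult_coord[OF polyfn_const[of 1], of i] by simp

lemma polyfn_cmult: "polyfn p \<Longrightarrow> polyfn (\<lambda>x. p x * c)"
proof (induction rule: polyfn.induct)
  case (polyfn_const d) show ?case by (rule polyfn.polyfn_const)
next
  case (polyfn_add p q) then show ?case by (simp add: distrib_right polyfn.polyfn_add)
next
  case (polyfn_mult_coord p i)
  from polyfn.polyfn_mult_coord[OF polyfn_mult_coord.IH] show ?case by (simp add: mult_ac)
qed

lemma polyfn_mult:
  assumes p: "polyfn p" and q: "polyfn q"
  shows "polyfn (\<lambda>x. p x * q x)"
  using q
proof (induction rule: polyfn.induct)
  case (polyfn_const c) show ?case by (rule polyfn_cmult[OF p])
next
  case (polyfn_add q r) then show ?case by (simp add: distrib_left polyfn.polyfn_add)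
next
  case (polyfn_mult_coord q i)
  from polyfn.polyfn_mult_coord[OF polyfn_mult_coord.IH, of i] show ?case by (simp add: mult.assoc)
qed

lemma polyfn_sum: "(\<And>a. a \<in> A \<Longrightarrow> polyfn (f a)) \<Longrightarrow> polyfn (\<lambda>x. \<Sum>a\<in>A. f a x)"
  by (induction A rule: infinite_finite_induct) (auto intro: polyfn_const polyfn_add)

lemma polyfn_prod: "(\<And>a. a \<in> A \<Longrightarrow> polyfn (f a)) \<Longrightarrow> polyfn (\<lambda>x. \<Prod>a\<in>A. f a x)"
  by (induction A rule: infinite_finite_induct) (auto intro: polyfn_const polyfn_mult)

lemma polyfn_power: "polyfn f \<Longrightarrow> polyfn (\<lambda>x. f x ^ n)"
  by (induction n) (auto intro: polyfn_const polyfn_mult)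

lemma polyfn_diff: "polyfn p \<Longrightarrow> polyfn q \<Longrightarrow> polyfn (\<lambda>x. p x - q x)"
  using polyfn_add[OF _ polyfn_cmult[of q "-1"], of p] by simp

lemma polyfn_compose:
  assumes "polyfn p" and g: "\<And>i. polyfn (\<lambda>x. g x $ i)"
  shows "polyfn (\<lambda>x. p (g x))"
  using assms(1) by (induction rule: polyfn.induct) (auto intro: polyfn_const polyfn_add polyfn_mult g)

lemma mhol_polyfn: "polyfn p \<Longrightarrow> mhol p UNIV"
  by (induction rule: polyfn.induct) (auto intro!: mhol_add mhol_mult intro: mhol_component)

lemma polyfn_eq_0_of_open:
  fixes p :: "complex ^ 'k::finite \<Rightarrow> complex"
  assumes p: "polyfn p" and S: "open S" "x0 \<in> S" and z: "\<And>x. x \<in> S \<Longrightarrow> p x = 0"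
  shows "p x = 0"
proof -
  define r where "r = norm (x - x0) + 1"
  have m: "mhol (\<lambda>y. p (y + x0)) (polydisc r)"
    by (rule mhol_subset[OF mhol_translate[OF mhol_polyfn[OF p], of x0]]) (auto simp: open_polydisc)
  have "open ((\<lambda>y. y + x0) -` S)" by (intro open_vimage S continuous_intros)
  from eventually_nhds_in_open[OF this, of 0] have "\<forall>\<^sub>F y in nhds 0. p (y + x0) = 0"
    using S by (auto elim!: eventually_mono simp: z)
  moreover have "x - x0 \<in> polydisc r"
    unfolding polydisc_def r_def
    using le_less_trans[OF Finite_Cartesian_Product.norm_nth_le[of "x - x0"], of "norm (x - x0) + 1"] by simp
  ultimately have "p ((x - x0) + x0) = 0" by (rule mhol_identity[OF m])
  then show ?thesis by simp
qed

lemma polyfn_mult_nonzero: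
  fixes p q :: "complex ^ 'k::finite \<Rightarrow> complex"
  assumes p: "polyfn p" "p v \<noteq> 0" and q: "polyfn q" "q w \<noteq> 0"
  shows "\<exists>x. p x * q x \<noteq> 0"
proof (rule ccontr)
  assume "\<not> ?thesis"
  then have z: "q x = 0" if "p x \<noteq> 0" for x using that by auto
  have "open {x. p x \<noteq> 0}"
    by (rule open_Collect_neq[OF mhol_continuous_on[OF mhol_polyfn[OF p(1)]]]) auto
  from polyfn_eq_0_of_open[OF q(1) this, of v w] z p q show False by auto
qed

text \<open>
  The coefficients with respect to one variable are again polynomial functions, so that leading and
  lowest coefficients are available without speaking of multi-indices.
\<close>

lemma polyfn_univariate:
  assumes "polyfn p"
  shows "\<exists>n Q. (\<forall>x. degree (Q x) \<le> n) \<and> (\<forall>e. polyfn (\<lambda>x. coeff (Q x) e)) \<and>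
    (\<forall>x s. p (\<chi> j. if j = i then s else x $ j) = poly (Q x) s)"
  using assms
proof (induction rule: polyfn.induct)
  case (polyfn_const c)
  show ?case
    by (rule exI[of _ 0], rule exI[of _ "\<lambda>_. [:c:]"]) (auto intro: polyfn.polyfn_const)
next
  case (polyfn_add p q)
  then obtain n1 Q1 n2 Q2 where Q: "\<forall>x. degree (Q1 x) \<le> n1" "\<forall>e. polyfn (\<lambda>x. coeff (Q1 x) e)"
    "\<forall>x s. p (\<chi> j. if j = i then s else x $ j) = poly (Q1 x) s"
    "\<forall>x. degree (Q2 x) \<le> n2" "\<forall>e. polyfn (\<lambda>x. coeff (Q2 x) e)"
    "\<forall>x s. q (\<chi> j. if j = i then s else x $ j) = poly (Q2 x) s" by blast
  show ?case
  proof (rule exI[of _ "max n1 n2"], rule exI[of _ "\<lambda>x. Q1 x + Q2 x"], intro conjI allI)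
    show "degree (Q1 x + Q2 x) \<le> max n1 n2" for x
      using Q(1,4) degree_add_le_max[of "Q1 x" "Q2 x"] by (meson max.mono order_trans)
  qed (use Q in \<open>auto intro: polyfn.polyfn_add\<close>)
next
  case (polyfn_mult_coord p k)
  then obtain n Q where Q: "\<forall>x. degree (Q x) \<le> n" "\<forall>e. polyfn (\<lambda>x. coeff (Q x) e)"
    "\<forall>x s. p (\<chi> j. if j = i then s else x $ j) = poly (Q x) s" by blast
  show ?case
  proof (cases "k = i")
    case True
    show ?thesis
    proof (rule exI[of _ "Suc n"], rule exI[of _ "\<lambda>x. pCons 0 (Q x)"], intro conjI allI)
      show "degree (pCons 0 (Q x)) \<le> Suc n" for x
        using Q(1) degree_pCons_le[of 0 "Q x"] by (meson Suc_le_mono order_trans)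
      show "polyfn (\<lambda>x. coeff (pCons 0 (Q x)) e)" for e
        using Q(2) by (cases e) (auto intro: polyfn.polyfn_const)
    qed (use Q True in \<open>auto simp: mult.commute\<close>)
  next
    case False
    show ?thesis
    proof (rule exI[of _ n], rule exI[of _ "\<lambda>x. smult (x $ k) (Q x)"], intro conjI allI)
      show "degree (smult (x $ k) (Q x)) \<le> n" for x
        using Q(1) degree_smult_le[of "x $ k" "Q x"] order_trans by blast
      show "polyfn (\<lambda>x. coeff (smult (x $ k) (Q x)) e)" for e
        using polyfn_mult[OF polyfn_coord[of k] Q(2)[rule_format, of e]] by simp
    qed (use Q False in \<open>auto simp: mult.commute\<close>)
  qed
qed

text \<open>
  Gaussian elimination: an equation with a nonzero coefficient eliminates one unknown from the others.
\<close>

lemma underdetermined_system: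
  fixes m :: "'r \<Rightarrow> 'b \<Rightarrow> 'a::field"
  assumes "finite R" "finite B" "card R < card B"
  shows "\<exists>c. (\<exists>b\<in>B. c b \<noteq> 0) \<and> (\<forall>r\<in>R. (\<Sum>b\<in>B. m r b * c b) = 0)"
  using assms
proof (induction R arbitrary: B m rule: finite_induct)
  case empty
  then obtain b where "b \<in> B" by (metis card.empty card_gt_0_iff ex_in_conv)
  then show ?case by (intro exI[of _ "\<lambda>_. 1"]) auto
next
  case (insert r R)
  show ?case
  proof (cases "\<forall>b\<in>B. m r b = 0")
    case True
    have "card R < card B" using insert by simp
    from insert.IH[OF insert.prems(1) this, of m] True show ?thesis by auto
  next
    case False
    then obtain b0 where b0: "b0 \<in> B" "m r b0 \<noteq> 0" by blast
    define m' where "m' s b = m s b - m s b0 * m r b / m r b0" for s b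
    have "card R < card (B - {b0})" using insert b0 by simp
    then obtain c where c: "\<exists>b\<in>B - {b0}. c b \<noteq> 0" "\<forall>s\<in>R. (\<Sum>b\<in>B - {b0}. m' s b * c b) = 0"
      using insert.IH[of "B - {b0}" m'] insert.prems by auto
    define s0 where "s0 = (\<Sum>b\<in>B - {b0}. m r b * c b)"
    define c' where "c' = c(b0 := - s0 / m r b0)"
    have split: "(\<Sum>b\<in>B. m s b * c' b) = m s b0 * (- s0 / m r b0) + (\<Sum>b\<in>B - {b0}. m s b * c b)" for s
      using insert.prems(1) b0 by (subst sum.remove[of B b0]) (auto simp: c'_def intro!: sum.cong)
    have "(\<Sum>b\<in>B. m s b * c' b) = 0" if "s \<in> R" for s
    proof -
      have "(\<Sum>b\<in>B - {b0}. m' s b * c b) = (\<Sum>b\<in>B - {b0}. m s b * c b) - m s b0 / m r b0 * s0"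
        unfolding m'_def s0_def sum_distrib_left sum_subtractf[symmetric]
        by (intro sum.cong) (auto simp: algebra_simps)
      then show ?thesis using c(2) that by (simp add: split)
    qed
    moreover have "(\<Sum>b\<in>B. m r b * c' b) = 0" using b0 by (simp add: split s0_def)
    moreover have "\<exists>b\<in>B. c' b \<noteq> 0" using c(1) by (auto simp: c'_def)
    ultimately show ?thesis by blast
  qed
qed


lemma ps_sum_finite:
  fixes P :: "('k::finite, 'a::real_normed_field) pseries"
  assumes "finite {\<gamma>. P \<gamma> \<noteq> 0}"
  shows "ps_sum P x = (\<Sum>\<gamma>\<in>{\<gamma>. P \<gamma> \<noteq> 0}. ps_term P x \<gamma>)"
proof -
  have "ps_sum P x = infsum (ps_term P x) {\<gamma>. P \<gamma> \<noteq> 0}"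
    unfolding ps_sum_def by (rule infsum_cong_neutral) (auto simp: ps_term_def)
  then show ?thesis using assms by simp
qed

lemma polyfn_ps_sum:
  assumes "finite {\<gamma>. P \<gamma> \<noteq> 0}"
  shows "polyfn (ps_sum P)"
proof -
  have "ps_sum P = (\<lambda>x. \<Sum>\<gamma>\<in>{\<gamma>. P \<gamma> \<noteq> 0}. ps_term P x \<gamma>)"
    using ps_sum_finite[OF assms] by blast
  then show ?thesis unfolding ps_term_def
    by (auto intro!: polyfn_sum polyfn_mult polyfn_const polyfn_prod polyfn_power polyfn_coord)
qed

lemma polyfn_imp_ps_sum:
  fixes p :: "'a::real_normed_field ^ 'k::finite \<Rightarrow> 'a"
  assumes "polyfn p"
  shows "\<exists>P. finite {\<gamma>. P \<gamma> \<noteq> 0} \<and> p = ps_sum P"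
  using assms
proof (induction rule: polyfn.induct)
  case (polyfn_const c)
  let ?P = "\<lambda>\<gamma>::'k \<Rightarrow> nat. if \<gamma> = (\<lambda>_. 0) then c else 0"
  have f: "finite {\<gamma>. ?P \<gamma> \<noteq> 0}" by (rule finite_subset[of _ "{\<lambda>_. 0}"]) auto
  have "ps_sum ?P x = (\<Sum>\<gamma>\<in>{\<lambda>_. 0}. ps_term ?P x \<gamma>)" for x
    unfolding ps_sum_finite[OF f] by (rule sum.mono_neutral_cong_left) (auto simp: ps_term_def)
  then have "(\<lambda>_. c) = ps_sum ?P" by (simp add: fun_eq_iff ps_term_def)
  with f show ?case by (intro exI[of _ ?P] conjI)
next
  case (polyfn_add p q)
  then obtain P Q where P: "finite {\<gamma>. P \<gamma> \<noteq> 0}" "p = ps_sum P"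
    and Q: "finite {\<gamma>. Q \<gamma> \<noteq> 0}" "q = ps_sum Q" by blast
  let ?S = "{\<gamma>. P \<gamma> \<noteq> 0} \<union> {\<gamma>. Q \<gamma> \<noteq> 0}"
  have f: "finite {\<gamma>. P \<gamma> + Q \<gamma> \<noteq> 0}" by (rule finite_subset[of _ ?S]) (use P Q in auto)
  have "ps_sum (\<lambda>\<gamma>. P \<gamma> + Q \<gamma>) x = p x + q x" for x
  proof -
    have "ps_sum (\<lambda>\<gamma>. P \<gamma> + Q \<gamma>) x = (\<Sum>\<gamma>\<in>?S. ps_term (\<lambda>\<gamma>. P \<gamma> + Q \<gamma>) x \<gamma>)"
      unfolding ps_sum_finite[OF f] by (rule sum.mono_neutral_left) (use P Q in \<open>auto simp: ps_term_def\<close>)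
    also have "\<dots> = (\<Sum>\<gamma>\<in>?S. ps_term P x \<gamma>) + (\<Sum>\<gamma>\<in>?S. ps_term Q x \<gamma>)"
      by (simp add: ps_term_def distrib_right sum.distrib)
    also have "(\<Sum>\<gamma>\<in>?S. ps_term P x \<gamma>) = p x"
      unfolding P(2) ps_sum_finite[OF P(1)] by (rule sum.mono_neutral_right) (use P Q in \<open>auto simp: ps_term_def\<close>)
    also have "(\<Sum>\<gamma>\<in>?S. ps_term Q x \<gamma>) = q x"
      unfolding Q(2) ps_sum_finite[OF Q(1)] by (rule sum.mono_neutral_right) (use P Q in \<open>auto simp: ps_term_def\<close>)
    finally show ?thesis .
  qed
  with f show ?case by (intro exI[of _ "\<lambda>\<gamma>. P \<gamma> + Q \<gamma>"]) auto
next
  case (polyfn_mult_coord p i)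
  then obtain P where P: "finite {\<gamma>. P \<gamma> \<noteq> 0}" "p = ps_sum P" by blast
  define h where "h = (\<lambda>\<gamma>::'k \<Rightarrow> nat. \<gamma>(i := Suc (\<gamma> i)))"
  define P' where "P' \<gamma> = (if \<gamma> i = 0 then 0 else P (\<gamma>(i := \<gamma> i - 1)))" for \<gamma>
  have inj: "inj h"
    by (rule injI) (auto simp: h_def fun_eq_iff, metis fun_upd_apply nat.inject)
  have eq: "{\<gamma>. P' \<gamma> \<noteq> 0} = h ` {\<gamma>. P \<gamma> \<noteq> 0}"
  proof (intro set_eqI iffI)
    fix \<gamma> assume "\<gamma> \<in> {\<gamma>. P' \<gamma> \<noteq> 0}"
    then have "\<gamma> i \<noteq> 0" "P (\<gamma>(i := \<gamma> i - 1)) \<noteq> 0" by (auto simp: P'_def split: if_splits)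
    moreover from this(1) have "\<gamma> = h (\<gamma>(i := \<gamma> i - 1))" by (auto simp: h_def fun_eq_iff)
    ultimately show "\<gamma> \<in> h ` {\<gamma>. P \<gamma> \<noteq> 0}" by blast
  qed (auto simp: h_def P'_def)
  have f: "finite {\<gamma>. P' \<gamma> \<noteq> 0}" unfolding eq using P by simp
  have "ps_term P' x (h \<gamma>) = ps_term P x \<gamma> * x $ i" for x \<gamma>
  proof -
    have "(\<Prod>j\<in>UNIV. x $ j ^ h \<gamma> j) = x $ i ^ Suc (\<gamma> i) * (\<Prod>j\<in>UNIV-{i}. x $ j ^ \<gamma> j)"
      by (subst prod.remove[of UNIV i]) (auto simp: h_def)
    moreover have "(\<Prod>j\<in>UNIV. x $ j ^ \<gamma> j) = x $ i ^ \<gamma> i * (\<Prod>j\<in>UNIV-{i}. x $ j ^ \<gamma> j)"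
      by (subst prod.remove[of UNIV i]) auto
    ultimately show ?thesis by (simp add: ps_term_def P'_def h_def)
  qed
  then have "ps_sum P' x = p x * x $ i" for x
    unfolding ps_sum_finite[OF f] P(2) ps_sum_finite[OF P(1)] eq
    by (subst sum.reindex) (use inj in \<open>auto simp: sum_distrib_right intro: inj_on_subset\<close>)
  with f show ?case by (intro exI[of _ P']) auto
qed

lemma converges_normally_finite:
  fixes P :: "('k::finite, 'a::real_normed_field) pseries"
  assumes "finite {\<gamma>. P \<gamma> \<noteq> 0}"
  shows "converges_normally P \<rho>"
  unfolding converges_normally_iff
proof safe
  fix r :: real
  have "(\<lambda>\<gamma>. norm (P \<gamma>) * r ^ mdeg \<gamma>) summable_on {\<gamma>. P \<gamma> \<noteq> 0}" using assms by simp
  then show "(\<lambda>\<gamma>. norm (P \<gamma>) * r ^ mdeg \<gamma>) summable_on UNIV"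
    by (rule summable_on_cong_neutral[THEN iffD1, rotated -1]) auto
qed

definition cps :: "('k, real) pseries \<Rightarrow> ('k, complex) pseries"
  where "cps c = (\<lambda>\<gamma>. complex_of_real (c \<gamma>))"

lemma converges_normally_cps:
  "converges_normally (cps c) \<rho> \<longleftrightarrow> converges_normally (c :: ('k::finite, real) pseries) \<rho>"
  by (simp add: converges_normally_iff cps_def)

lemma ps_term_cps: "ps_term (cps c) (cvec x) \<gamma> = complex_of_real (ps_term c x \<gamma>)"
  by (simp add: ps_term_def cps_def cvec_def)

lemma ps_sum_cps: "ps_sum (cps c) (cvec x) = complex_of_real (ps_sum c x)"
proof (cases "ps_term c x summable_on UNIV")
  case True
  then have "(ps_term c x has_sum ps_sum c x) UNIV" unfolding ps_sum_def by (rule has_sum_infsum)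
  from has_sum_of_real[OF this] show ?thesis unfolding ps_sum_def[of "cps c"] by (intro infsumI) (simp add: ps_term_cps[abs_def])
next
  case False
  then have "\<not> ps_term (cps c) (cvec x) summable_on UNIV"
    using summable_on_Re[of "ps_term (cps c) (cvec x)" UNIV] by (auto simp: ps_term_cps)
  with False show ?thesis by (simp add: ps_sum_def infsum_not_exists)
qed

lemma finite_ps_sum_nonzero:
  fixes P :: "('k::finite, complex) pseries"
  assumes "finite {\<gamma>. P \<gamma> \<noteq> 0}" "P \<noteq> (\<lambda>_. 0)"
  shows "\<exists>x. ps_sum P x \<noteq> 0"
proof (rule ccontr)
  assume "\<not> ?thesis"
  then have "\<forall>\<^sub>F x in nhds 0. ps_sum P x = ps_sum (\<lambda>_. 0) x" by (simp add: ps_sum_def[of "\<lambda>_. 0"] ps_term_def)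
  then have "P = (\<lambda>_. 0)"
    using ps_unique[of P 1 "\<lambda>_. 0"] converges_normally_finite[OF assms(1)] by (simp add: converges_normally_finite)
  with assms show False by simp
qed

text \<open>
  A real polynomial that vanishes at all real points vanishes at all complex points as well.
\<close>

lemma finite_ps_sum_nonzero_real:
  fixes P :: "('k::finite, real) pseries"
  assumes "finite {\<gamma>. P \<gamma> \<noteq> 0}" "P \<noteq> (\<lambda>_. 0)"
  shows "\<exists>x. ps_sum P x \<noteq> 0"
proof (rule ccontr)
  assume "\<not> ?thesis"
  then have z: "\<forall>\<^sub>F x in nhds 0. ps_sum (cps P) (cvec x) = 0" by (simp add: ps_sum_cps)
  have f: "finite {\<gamma>. cps P \<gamma> \<noteq> 0}" using assms by (simp add: cps_def)
  have "ps_sum (cps P) x = 0" if "x \<in> polydisc 1" for x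
    by (rule mhol_zero_on_reals[OF mhol_ps_sum[OF converges_normally_finite[OF f]] z that])
  moreover have "\<forall>\<^sub>F x in nhds 0. x \<in> (polydisc 1 :: (complex ^ 'k) set)"
    by (rule eventually_nhds_in_open[OF open_polydisc]) simp
  ultimately have "\<forall>\<^sub>F x in nhds 0. ps_sum (cps P) x = ps_sum (\<lambda>_. 0) x"
    by (auto elim!: eventually_mono simp: ps_sum_def[of "\<lambda>_. 0"] ps_term_def)
  then have "cps P = (\<lambda>_. 0)"
    using ps_unique[of "cps P" 1 "\<lambda>_. 0"] converges_normally_finite[OF f] by (simp add: converges_normally_finite)
  with assms show False by (auto simp: cps_def fun_eq_iff)
qed

section \<open>Algebraic dependence\<close>

definition algdep :: "'b::topological_space \<Rightarrow> ('b \<Rightarrow> 'a::real_normed_field ^ 'q::finite) \<Rightarrow> bool"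
  where "algdep x0 g \<longleftrightarrow>
    (\<exists>p. polyfn p \<and> (\<exists>v. p v \<noteq> 0) \<and> (\<forall>\<^sub>F x in nhds x0. p (g x) = 0))"

lemma algebraic_ps_iff_aux:
  fixes c :: "('k::finite, 'a::real_normed_field) pseries"
  assumes nz: "\<And>P :: ('k option, 'a) pseries. finite {\<gamma>. P \<gamma> \<noteq> 0} \<Longrightarrow> P \<noteq> (\<lambda>_. 0) \<Longrightarrow> \<exists>x. ps_sum P x \<noteq> 0"
  shows "algebraic_ps c \<longleftrightarrow> convergent_ps c \<and> algdep 0 (\<lambda>x. snoc_vec x (ps_sum c x))"
proof -
  let ?g = "\<lambda>x. snoc_vec x (ps_sum c x)"
  have "(\<exists>P :: ('k option, 'a) pseries. finite {\<gamma>. P \<gamma> \<noteq> 0} \<and> P \<noteq> (\<lambda>_. 0) \<and> (\<forall>\<^sub>F x in nhds 0. ps_sum P (?g x) = 0))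
      \<longleftrightarrow> algdep 0 ?g"
  proof safe
    fix P :: "('k option, 'a) pseries"
    assume P: "finite {\<gamma>. P \<gamma> \<noteq> 0}" "P \<noteq> (\<lambda>_. 0)" "\<forall>\<^sub>F x in nhds 0. ps_sum P (?g x) = 0"
    show "algdep 0 ?g" unfolding algdep_def
      by (intro exI[of _ "ps_sum P"] conjI polyfn_ps_sum P nz)
  next
    assume "algdep 0 ?g"
    then obtain p v where p: "polyfn p" "p v \<noteq> 0" "\<forall>\<^sub>F x in nhds 0. p (?g x) = 0"
      unfolding algdep_def by blast
    obtain P where P: "finite {\<gamma>. P \<gamma> \<noteq> 0}" "p = ps_sum P" using polyfn_imp_ps_sum[OF p(1)] by blast
    have "P \<noteq> (\<lambda>_. 0)" using p(2) P(2) by (auto simp: ps_sum_def ps_term_def)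
    with P p(3) show "\<exists>P :: ('k option, 'a) pseries. finite {\<gamma>. P \<gamma> \<noteq> 0} \<and> P \<noteq> (\<lambda>_. 0) \<and> (\<forall>\<^sub>F x in nhds 0. ps_sum P (?g x) = 0)"
      by (intro exI[of _ P]) auto
  qed
  then show ?thesis unfolding algebraic_ps_def by simp
qed

lemma algebraic_ps_iff:
  fixes c :: "('k::finite, complex) pseries"
  shows "algebraic_ps c \<longleftrightarrow> convergent_ps c \<and> algdep 0 (\<lambda>x. snoc_vec x (ps_sum c x))"
  by (rule algebraic_ps_iff_aux) (rule finite_ps_sum_nonzero)

lemma algebraic_ps_iff_real:
  fixes c :: "('k::finite, real) pseries"
  shows "algebraic_ps c \<longleftrightarrow> convergent_ps c \<and> algdep 0 (\<lambda>x. snoc_vec x (ps_sum c x))"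
  by (rule algebraic_ps_iff_aux) (rule finite_ps_sum_nonzero_real)

text \<open>
  The degree \<open>n\<close> in \<open>x\<close> may grow, while the powers of \<open>F\<^sub>j\<close> stay below the degree \<open>N\<^sub>j\<close> of its
  algebraic relation. So the number of products \<open>x\<^sup>\<alpha> F(x)\<^sup>\<gamma>\<close> grows only like \<open>n\<^sup>k\<close>, where \<open>k\<close> is
  the number of variables.
\<close>

definition growth_index :: "('l::finite \<Rightarrow> nat) \<Rightarrow> nat \<Rightarrow> (('k::finite \<Rightarrow> nat) \<times> ('l \<Rightarrow> nat)) set"
  where "growth_index N n = PiE UNIV (\<lambda>_. {..n}) \<times> PiE UNIV (\<lambda>j. {..<N j})"

definition growth_elem :: "('l::finite \<Rightarrow> complex ^ 'k::finite \<Rightarrow> complex) \<Rightarrow>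
    ('k \<Rightarrow> nat) \<times> ('l \<Rightarrow> nat) \<Rightarrow> complex ^ 'k \<Rightarrow> complex"
  where "growth_elem F r x = (\<Prod>i\<in>UNIV. x $ i ^ fst r i) * (\<Prod>j\<in>UNIV. F j x ^ snd r j)"

definition growth_space :: "(complex ^ 'k::finite) set \<Rightarrow> ('l::finite \<Rightarrow> complex ^ 'k \<Rightarrow> complex) \<Rightarrow>
    ('l \<Rightarrow> nat) \<Rightarrow> nat \<Rightarrow> (complex ^ 'k \<Rightarrow> complex) set"
  where "growth_space U F N n =
    {h. \<exists>m. \<forall>x\<in>U. h x = (\<Sum>r\<in>growth_index N n. m r * growth_elem F r x)}"

text \<open>
  Multiplication by a tame function raises the degree in \<open>x\<close> only by a constant, up to a denominator
  \<open>a\<close>. In this form sums and products of tame functions are visibly tame.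
\<close>

definition tame :: "(complex ^ 'k::finite) set \<Rightarrow> ('l::finite \<Rightarrow> complex ^ 'k \<Rightarrow> complex) \<Rightarrow>
    ('l \<Rightarrow> nat) \<Rightarrow> (complex ^ 'k \<Rightarrow> complex) \<Rightarrow> bool"
  where "tame U F N u \<longleftrightarrow> (\<exists>a K. polyfn a \<and> (\<exists>v. a v \<noteq> 0) \<and>
    (\<forall>n. \<forall>h\<in>growth_space U F N n. (\<lambda>x. a x * u x * h x) \<in> growth_space U F N (n + K)))"

lemma finite_growth_index [simp]: "finite (growth_index N n)"
  unfolding growth_index_def by (intro finite_cartesian_product finite_PiE) auto

lemma mem_growth_index: "r \<in> growth_index N n \<longleftrightarrow> (\<forall>i. fst r i \<le> n) \<and> (\<forall>j. snd r j < N j)"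
  by (cases r) (auto simp: growth_index_def)

lemma card_growth_index:
  fixes N :: "'l::finite \<Rightarrow> nat"
  shows "card (growth_index N n :: (('k::finite \<Rightarrow> nat) \<times> _) set) = (n + 1) ^ CARD('k) * (\<Prod>j\<in>UNIV. N j)"
  unfolding growth_index_def by (simp add: card_cartesian_product card_PiE)

lemma growth_space_cong:
  assumes "h \<in> growth_space U F N n" "\<And>x. x \<in> U \<Longrightarrow> h x = h' x"
  shows "h' \<in> growth_space U F N n"
proof -
  obtain m where "\<forall>x\<in>U. h x = (\<Sum>r\<in>growth_index N n. m r * growth_elem F r x)"
    using assms(1) unfolding growth_space_def by blast
  then show ?thesis unfolding growth_space_def
    by (intro CollectI exI[of _ m]) (use assms(2) in auto)
qed

lemma growth_space_add:
  assumes "h \<in> growth_space U F N n" "h' \<in> growth_space U F N n"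
  shows "(\<lambda>x. h x + h' x) \<in> growth_space U F N n"
proof -
  obtain m m' where "\<forall>x\<in>U. h x = (\<Sum>r\<in>growth_index N n. m r * growth_elem F r x)"
    "\<forall>x\<in>U. h' x = (\<Sum>r\<in>growth_index N n. m' r * growth_elem F r x)"
    using assms unfolding growth_space_def by auto
  then show ?thesis unfolding growth_space_def
    by (intro CollectI exI[of _ "\<lambda>r. m r + m' r"]) (auto simp: distrib_right sum.distrib)
qed

lemma growth_space_cmult:
  assumes "h \<in> growth_space U F N n"
  shows "(\<lambda>x. c * h x) \<in> growth_space U F N n"
proof -
  obtain m where "\<forall>x\<in>U. h x = (\<Sum>r\<in>growth_index N n. m r * growth_elem F r x)"
    using assms unfolding growth_space_def by auto
  then show ?thesis unfolding growth_space_def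
    by (intro CollectI exI[of _ "\<lambda>r. c * m r"]) (auto simp: sum_distrib_left mult.assoc)
qed

lemma growth_space_0: "(\<lambda>x. 0) \<in> growth_space U F N n"
  unfolding growth_space_def by (intro CollectI exI[of _ "\<lambda>_. 0"]) auto

lemma growth_space_sum:
  "(\<And>a. a \<in> A \<Longrightarrow> h a \<in> growth_space U F N n) \<Longrightarrow> (\<lambda>x. \<Sum>a\<in>A. h a x) \<in> growth_space U F N n"
  by (induction A rule: infinite_finite_induct) (auto intro: growth_space_0 growth_space_add)

lemma growth_elem_in_space:
  assumes "r \<in> growth_index N n"
  shows "growth_elem F r \<in> growth_space U F N n"
  unfolding growth_space_def
proof (intro CollectI exI[of _ "\<lambda>s. if s = r then 1 else 0"] ballI)
  fix x
  show "growth_elem F r x = (\<Sum>s\<in>growth_index N n. (if s = r then 1 else 0) * growth_elem F s x)"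
    using assms by (simp add: if_distrib[of "\<lambda>c. c * _"] cong: if_cong)
qed

lemma growth_space_linear:
  assumes h: "h \<in> growth_space U F N n"
    and e: "\<And>r. r \<in> growth_index N n \<Longrightarrow> (\<lambda>x. u x * growth_elem F r x) \<in> growth_space U F N n'"
  shows "(\<lambda>x. u x * h x) \<in> growth_space U F N n'"
proof -
  obtain m where m: "\<forall>x\<in>U. h x = (\<Sum>r\<in>growth_index N n. m r * growth_elem F r x)"
    using h unfolding growth_space_def by auto
  have "(\<lambda>x. \<Sum>r\<in>growth_index N n. m r * (u x * growth_elem F r x)) \<in> growth_space U F N n'"
    by (intro growth_space_sum growth_space_cmult e)
  then show ?thesis
    by (rule growth_space_cong) (simp add: m sum_distrib_left mult_ac)
qed

lemma growth_space_mono: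
  fixes F :: "'l::finite \<Rightarrow> complex ^ 'k::finite \<Rightarrow> complex"
  assumes "h \<in> growth_space U F N n" "n \<le> n'"
  shows "h \<in> growth_space U F N n'"
proof -
  have "(\<lambda>x. 1 * h x) \<in> growth_space U F N n'"
  proof (rule growth_space_linear[OF assms(1)])
    fix r :: "('k \<Rightarrow> nat) \<times> ('l \<Rightarrow> nat)" assume "r \<in> growth_index N n"
    then have "r \<in> growth_index N n'" using assms(2) by (auto simp: mem_growth_index intro: order_trans)
    from growth_elem_in_space[OF this] show "(\<lambda>x. 1 * growth_elem F r x) \<in> growth_space U F N n'" by simp
  qed
  then show ?thesis by simp
qed

lemma growth_elem_mult_coord:
  "x $ i * growth_elem F r x = growth_elem F ((fst r)(i := Suc (fst r i)), snd r) x"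
proof -
  have "(\<Prod>k\<in>UNIV. x $ k ^ ((fst r)(i := Suc (fst r i))) k)
      = x $ i ^ Suc (fst r i) * (\<Prod>k\<in>UNIV-{i}. x $ k ^ fst r k)"
    by (subst prod.remove[of UNIV i]) auto
  moreover have "(\<Prod>k\<in>UNIV. x $ k ^ fst r k) = x $ i ^ fst r i * (\<Prod>k\<in>UNIV-{i}. x $ k ^ fst r k)"
    by (subst prod.remove[of UNIV i]) auto
  ultimately show ?thesis by (simp add: growth_elem_def)
qed

lemma growth_elem_split:
  "growth_elem F (\<alpha>, \<gamma>(j := e)) x
    = F j x ^ e * ((\<Prod>i\<in>UNIV. x $ i ^ \<alpha> i) * (\<Prod>l\<in>UNIV-{j}. F l x ^ \<gamma> l))"
  unfolding growth_elem_def fst_conv snd_conv by (subst prod.remove[of UNIV j]) auto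

lemma growth_space_polyfn:
  assumes "polyfn q"
  shows "\<exists>K. \<forall>n. \<forall>h\<in>growth_space U F N n. (\<lambda>x. q x * h x) \<in> growth_space U F N (n + K)"
  using assms
proof (induction rule: polyfn.induct)
  case (polyfn_const c)
  show ?case by (rule exI[of _ 0]) (auto intro: growth_space_cmult)
next
  case (polyfn_add p q)
  then obtain K L where K: "\<forall>n. \<forall>h\<in>growth_space U F N n. (\<lambda>x. p x * h x) \<in> growth_space U F N (n + K)"
    and L: "\<forall>n. \<forall>h\<in>growth_space U F N n. (\<lambda>x. q x * h x) \<in> growth_space U F N (n + L)" by blast
  show ?case
  proof (intro exI[of _ "max K L"] allI ballI)
    fix n h assume h: "h \<in> growth_space U F N n"
    have "(\<lambda>x. p x * h x) \<in> growth_space U F N (n + max K L)"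
      by (rule growth_space_mono[OF K[rule_format, OF h]]) simp
    moreover have "(\<lambda>x. q x * h x) \<in> growth_space U F N (n + max K L)"
      by (rule growth_space_mono[OF L[rule_format, OF h]]) simp
    ultimately show "(\<lambda>x. (p x + q x) * h x) \<in> growth_space U F N (n + max K L)"
      unfolding distrib_right by (rule growth_space_add)
  qed
next
  case (polyfn_mult_coord p i)
  then obtain K where K: "\<And>n h. h \<in> growth_space U F N n \<Longrightarrow> (\<lambda>x. p x * h x) \<in> growth_space U F N (n + K)" by blast
  show ?case
  proof (intro exI[of _ "Suc K"] allI ballI)
    fix n h assume h: "h \<in> growth_space U F N n"
    have "(\<lambda>x. x $ i * (p x * h x)) \<in> growth_space U F N (Suc (n + K))"
    proof (rule growth_space_linear[OF K[OF h]])
      fix r :: "('a \<Rightarrow> nat) \<times> ('b \<Rightarrow> nat)" assume "r \<in> growth_index N (n + K)"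
      then have "((fst r)(i := Suc (fst r i)), snd r) \<in> growth_index N (Suc (n + K))"
        by (auto simp: mem_growth_index le_SucI)
      from growth_elem_in_space[OF this]
      show "(\<lambda>x. x $ i * growth_elem F r x) \<in> growth_space U F N (Suc (n + K))"
        by (simp add: growth_elem_mult_coord[abs_def])
    qed
    then show "(\<lambda>x. p x * x $ i * h x) \<in> growth_space U F N (n + Suc K)" by (simp add: mult_ac)
  qed
qed

lemma tame_polyfn: "polyfn q \<Longrightarrow> tame U F N q"
  unfolding tame_def using growth_space_polyfn[of q U F N]
  by (intro exI[of _ "\<lambda>_. 1"]) (auto intro: polyfn_const)

lemma tame_mult:
  assumes "tame U F N u" "tame U F N w"
  shows "tame U F N (\<lambda>x. u x * w x)"
proof -
  obtain a K where a: "polyfn a" "\<exists>v. a v \<noteq> 0"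
    "\<And>n h. h \<in> growth_space U F N n \<Longrightarrow> (\<lambda>x. a x * u x * h x) \<in> growth_space U F N (n + K)"
    using assms(1) unfolding tame_def by blast
  obtain b L where b: "polyfn b" "\<exists>v. b v \<noteq> 0"
    "\<And>n h. h \<in> growth_space U F N n \<Longrightarrow> (\<lambda>x. b x * w x * h x) \<in> growth_space U F N (n + L)"
    using assms(2) unfolding tame_def by blast
  show ?thesis unfolding tame_def
  proof (rule exI[of _ "\<lambda>x. a x * b x"], rule exI[of _ "L + K"], intro conjI allI ballI)
    show "polyfn (\<lambda>x. a x * b x)" "\<exists>v. a v * b v \<noteq> 0"
      using a b polyfn_mult polyfn_mult_nonzero by blast+
    fix n h assume "h \<in> growth_space U F N n"
    from a(3)[OF b(3)[OF this]]
    show "(\<lambda>x. a x * b x * (u x * w x) * h x) \<in> growth_space U F N (n + (L + K))" by (simp add: mult_ac add_ac)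
  qed
qed

lemma tame_add:
  assumes "tame U F N u" "tame U F N w"
  shows "tame U F N (\<lambda>x. u x + w x)"
proof -
  obtain a K where a: "polyfn a" "\<exists>v. a v \<noteq> 0"
    "\<And>n h. h \<in> growth_space U F N n \<Longrightarrow> (\<lambda>x. a x * u x * h x) \<in> growth_space U F N (n + K)"
    using assms(1) unfolding tame_def by blast
  obtain b L where b: "polyfn b" "\<exists>v. b v \<noteq> 0"
    "\<And>n h. h \<in> growth_space U F N n \<Longrightarrow> (\<lambda>x. b x * w x * h x) \<in> growth_space U F N (n + L)"
    using assms(2) unfolding tame_def by blast
  obtain K' where K': "\<And>n h. h \<in> growth_space U F N n \<Longrightarrow> (\<lambda>x. a x * h x) \<in> growth_space U F N (n + K')"
    using growth_space_polyfn[OF a(1), of U F N] by blast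
  obtain L' where L': "\<And>n h. h \<in> growth_space U F N n \<Longrightarrow> (\<lambda>x. b x * h x) \<in> growth_space U F N (n + L')"
    using growth_space_polyfn[OF b(1), of U F N] by blast
  let ?K = "max (K + L') (L + K')"
  show ?thesis unfolding tame_def
  proof (rule exI[of _ "\<lambda>x. a x * b x"], rule exI[of _ ?K], intro conjI allI ballI)
    show "polyfn (\<lambda>x. a x * b x)" "\<exists>v. a v * b v \<noteq> 0"
      using a b polyfn_mult polyfn_mult_nonzero by blast+
    fix n h assume h: "h \<in> growth_space U F N n"
    have "(\<lambda>x. b x * (a x * u x * h x)) \<in> growth_space U F N (n + ?K)"
      by (rule growth_space_mono[OF L'[OF a(3)[OF h]]]) auto
    moreover have "(\<lambda>x. a x * (b x * w x * h x)) \<in> growth_space U F N (n + ?K)"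
      by (rule growth_space_mono[OF K'[OF b(3)[OF h]]]) auto
    ultimately have "(\<lambda>x. b x * (a x * u x * h x) + a x * (b x * w x * h x)) \<in> growth_space U F N (n + ?K)"
      by (rule growth_space_add)
    then show "(\<lambda>x. a x * b x * (u x + w x) * h x) \<in> growth_space U F N (n + ?K)"
      by (simp add: algebra_simps)
  qed
qed

text \<open>
  The degree \<open>n\<close> is positive because a polynomial function of \<open>x\<close> alone that vanishes on an open
  set is zero.
\<close>

lemma algebraic_relation_leading:
  fixes f :: "complex ^ 'k::finite \<Rightarrow> complex"
  assumes p: "polyfn p" "p v \<noteq> 0" and U: "open U" "U \<noteq> {}"
    and z: "\<And>x. x \<in> U \<Longrightarrow> p (snoc_vec x (f x)) = 0"
  obtains n a where "n \<ge> 1" "\<And>e. polyfn (a e)" "\<exists>x. a n x \<noteq> 0"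
    "\<And>x. x \<in> U \<Longrightarrow> a n x * f x ^ n = - (\<Sum>e<n. a e x * f x ^ e)"
proof -
  obtain d Q where Q: "\<forall>x. degree (Q x) \<le> d" "\<forall>e. polyfn (\<lambda>x. coeff (Q x) e)"
    "\<forall>x s. p (\<chi> j. if j = None then s else x $ j) = poly (Q x) s"
    using polyfn_univariate[OF p(1), of None] by blast
  define a where "a e x = coeff (Q (snoc_vec x 0)) e" for e x
  have snoc: "(\<chi> j. if j = None then s else snoc_vec x 0 $ j) = snoc_vec x s" for s and x :: "complex ^ 'k"
    by (auto simp: vec_eq_iff snoc_vec_def split: option.split)
  have pa: "polyfn (a e)" for e
    unfolding a_def
  proof (rule polyfn_compose[OF Q(2)[rule_format]])
    show "polyfn (\<lambda>x. snoc_vec x (0::complex) $ i)" for i :: "'k option"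
      by (cases i) (auto simp: snoc_vec_def intro: polyfn_const polyfn_coord)
  qed
  have val: "p (snoc_vec x s) = (\<Sum>e\<le>d. a e x * s ^ e)" for x s
  proof -
    have "poly (Q (snoc_vec x 0)) s = (\<Sum>e\<le>d. a e x * s ^ e)"
      unfolding poly_altdef a_def
      by (rule sum.mono_neutral_left) (use Q(1) in \<open>auto simp: coeff_eq_0\<close>)
    then show ?thesis using Q(3)[rule_format, where x = "snoc_vec x 0" and s = s] by (simp add: snoc)
  qed
  have high: "a e x = 0" if "e > d" for e x
    unfolding a_def using Q(1) that coeff_eq_0 le_less_trans by blast
  have v: "v = snoc_vec (\<chi> k. v $ Some k) (v $ None)"
    by (auto simp: vec_eq_iff snoc_vec_def split: option.split)
  have "\<exists>e x. a e x \<noteq> 0"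
  proof (rule ccontr)
    assume "\<not> ?thesis"
    then have "p v = 0" by (subst v, subst val) simp
    with p show False by simp
  qed
  then obtain e0 where e0: "\<exists>x. a e0 x \<noteq> 0" by blast
  define n where "n = Max {e. \<exists>x. a e x \<noteq> 0}"
  have fin: "finite {e. \<exists>x. a e x \<noteq> 0}"
    by (rule finite_subset[of _ "{..d}"]) (use high in \<open>auto simp: not_less[symmetric]\<close>)
  have n: "\<exists>x. a n x \<noteq> 0" using Max_in[OF fin] e0 unfolding n_def by blast
  have above: "a e x = 0" if "e > n" for e x
    using Max_ge[OF fin, of e] that unfolding n_def by (metis (mono_tags) mem_Collect_eq not_less)
  have nd: "n \<le> d" using n high by (meson not_less)
  have rel: "(\<Sum>e\<le>n. a e x * f x ^ e) = 0" if "x \<in> U" for x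
  proof -
    have "(\<Sum>e\<le>n. a e x * f x ^ e) = (\<Sum>e\<le>d. a e x * f x ^ e)"
      by (rule sum.mono_neutral_left) (use nd above in auto)
    then show ?thesis using z[OF that] by (simp add: val)
  qed
  show thesis
  proof (rule that[of n a])
    show "n \<ge> 1"
    proof (rule ccontr)
      assume "\<not> n \<ge> 1"
      then have n0: "n = 0" by simp
      have "a 0 x = 0" if "x \<in> U" for x using rel[OF that] by (simp add: n0)
      then have "a 0 x = 0" for x using polyfn_eq_0_of_open[OF pa U(1)] U(2) by blast
      with n show False by (simp add: n0)
    qed
    show "a n x * f x ^ n = - (\<Sum>e<n. a e x * f x ^ e)" if "x \<in> U" for x
      using rel[OF that] by (simp add: lessThan_Suc_atMost[symmetric] add_eq_0_iff2 add.commute)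
  qed (use pa n in auto)
qed

text \<open>
  The top power of \<open>F\<^sub>j\<close> can be eliminated after multiplication with the leading coefficient, at the
  cost of raising the degree in \<open>x\<close> by a constant.
\<close>

lemma tame_generator:
  fixes F :: "'l::finite \<Rightarrow> complex ^ 'k::finite \<Rightarrow> complex"
  assumes a: "\<And>e. polyfn (a e)" "\<exists>v. a (N j) v \<noteq> 0" and N: "N j \<ge> 1"
    and rel: "\<And>x. x \<in> U \<Longrightarrow> a (N j) x * F j x ^ N j = - (\<Sum>e<N j. a e x * F j x ^ e)"
  shows "tame U F N (F j)"
proof -
  have "\<exists>K. \<forall>n. \<forall>h\<in>growth_space U F N n. (\<lambda>x. a e x * h x) \<in> growth_space U F N (n + K)" for e
    by (rule growth_space_polyfn[OF a(1)])
  then obtain K where K: "\<And>e n h. h \<in> growth_space U F N n \<Longrightarrow> (\<lambda>x. a e x * h x) \<in> growth_space U F N (n + K e)"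
    by metis
  define L where "L = Max (K ` {..N j})"
  have KL: "(\<lambda>x. a e x * h x) \<in> growth_space U F N (n + L)" if "h \<in> growth_space U F N n" "e \<le> N j" for e n h
  proof (rule growth_space_mono[OF K[OF that(1)]])
    have "K e \<le> L" unfolding L_def using that(2) by (intro Max_ge) auto
    then show "n + K e \<le> n + L" by simp
  qed
  show ?thesis unfolding tame_def
  proof (rule exI[of _ "a (N j)"], rule exI[of _ L], intro conjI allI ballI a)
    fix n h assume h: "h \<in> growth_space U F N n"
    show "(\<lambda>x. a (N j) x * F j x * h x) \<in> growth_space U F N (n + L)"
    proof (rule growth_space_linear[OF h])
      fix r :: "('k \<Rightarrow> nat) \<times> ('l \<Rightarrow> nat)" assume r: "r \<in> growth_index N n"
      obtain \<alpha> \<gamma> where r': "r = (\<alpha>, \<gamma>)" by (cases r)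
      define R where "R x = (\<Prod>i\<in>UNIV. x $ i ^ \<alpha> i) * (\<Prod>l\<in>UNIV-{j}. F l x ^ \<gamma> l)" for x
      have ge: "growth_elem F (\<alpha>, \<gamma>(j := e)) x = F j x ^ e * R x" for e x
        unfolding R_def by (rule growth_elem_split)
      have rx: "growth_elem F r x = F j x ^ \<gamma> j * R x" for x
        using ge[of "\<gamma> j" x] by (simp add: r')
      have mem: "growth_elem F (\<alpha>, \<gamma>(j := e)) \<in> growth_space U F N n" if "e < N j" for e
        by (rule growth_elem_in_space) (use r that in \<open>auto simp: mem_growth_index r'\<close>)
      show "(\<lambda>x. a (N j) x * F j x * growth_elem F r x) \<in> growth_space U F N (n + L)"
      proof (cases "Suc (\<gamma> j) < N j")
        case True
        from KL[OF mem[OF this] order_refl] show ?thesis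
          by (rule growth_space_cong) (simp add: ge rx)
      next
        case False
        then have eq: "Suc (\<gamma> j) = N j" using r by (auto simp: mem_growth_index r' not_less_eq_eq Suc_le_eq intro: antisym)
        have "(\<lambda>x. \<Sum>e<N j. (-1) * (a e x * growth_elem F (\<alpha>, \<gamma>(j := e)) x)) \<in> growth_space U F N (n + L)"
          by (intro growth_space_sum growth_space_cmult KL mem) auto
        then show ?thesis
        proof (rule growth_space_cong)
          fix x assume x: "x \<in> U"
          have "a (N j) x * F j x * growth_elem F r x = (a (N j) x * F j x ^ N j) * R x"
            by (simp add: rx eq[symmetric] mult_ac)
          also have "\<dots> = (\<Sum>e<N j. (-1) * (a e x * growth_elem F (\<alpha>, \<gamma>(j := e)) x))"
            unfolding rel[OF x] ge by (simp add: sum_distrib_left sum_distrib_right sum_negf mult_ac)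
          finally show "(\<Sum>e<N j. (-1) * (a e x * growth_elem F (\<alpha>, \<gamma>(j := e)) x)) = a (N j) x * F j x * growth_elem F r x" ..
        qed
      qed
    qed
  qed
qed

text \<open>
  Counting: there are \<open>(D+1)\<^sup>q\<close> monomials of degree at most \<open>D\<close> in each of \<open>q\<close> tame functions,
  but after multiplication with a common denominator they lie in a space of dimension \<open>O(D\<^sup>k)\<close>.
\<close>

theorem tame_dependent:
  fixes F :: "'l::finite \<Rightarrow> complex ^ 'k::finite \<Rightarrow> complex" and g :: "complex ^ 'k \<Rightarrow> complex ^ 'q::finite"
  assumes U: "open U" and N: "\<And>j. N j \<ge> 1" and g: "\<And>i. tame U F N (\<lambda>x. g x $ i)"
    and cont: "continuous_on U g" and card: "CARD('k) < CARD('q)"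
  shows "\<exists>p. polyfn p \<and> (\<exists>v. p v \<noteq> 0) \<and> (\<forall>x\<in>U. p (g x) = 0)"
proof -
  let ?W = "growth_space U F N"
  have "\<exists>a K. polyfn a \<and> (\<exists>v. a v \<noteq> 0) \<and> (\<forall>n. \<forall>h\<in>?W n. (\<lambda>x. a x * h x) \<in> ?W (n + K)) \<and>
      (\<forall>i\<in>I. \<forall>n. \<forall>h\<in>?W n. (\<lambda>x. a x * g x $ i * h x) \<in> ?W (n + K))" if "finite I" for I
    using that
  proof (induction I rule: finite_induct)
    case empty
    show ?case by (rule exI[of _ "\<lambda>_. 1"], rule exI[of _ 0]) (auto intro: polyfn_const)
  next
    case (insert i I)
    then obtain a K where a: "polyfn a" "\<exists>v. a v \<noteq> 0" "\<And>n h. h \<in> ?W n \<Longrightarrow> (\<lambda>x. a x * h x) \<in> ?W (n + K)"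
      "\<And>i n h. i \<in> I \<Longrightarrow> h \<in> ?W n \<Longrightarrow> (\<lambda>x. a x * g x $ i * h x) \<in> ?W (n + K)" by blast
    obtain b L where b: "polyfn b" "\<exists>v. b v \<noteq> 0" "\<And>n h. h \<in> ?W n \<Longrightarrow> (\<lambda>x. b x * g x $ i * h x) \<in> ?W (n + L)"
      using g[of i] unfolding tame_def by blast
    obtain L' where L': "\<And>n h. h \<in> ?W n \<Longrightarrow> (\<lambda>x. b x * h x) \<in> ?W (n + L')"
      using growth_space_polyfn[OF b(1), of U F N] by blast
    let ?K = "K + max L L'"
    show ?case
    proof (rule exI[of _ "\<lambda>x. a x * b x"], rule exI[of _ ?K], intro conjI allI ballI)
      show "polyfn (\<lambda>x. a x * b x)" "\<exists>v. a v * b v \<noteq> 0"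
        using a b polyfn_mult polyfn_mult_nonzero by blast+
    next
      fix n h assume h: "h \<in> ?W n"
      show "(\<lambda>x. a x * b x * h x) \<in> ?W (n + ?K)"
        by (rule growth_space_mono[OF growth_space_cong[OF L'[OF a(3)[OF h]]]]) auto
    next
      fix i' n h assume i': "i' \<in> insert i I" and h: "h \<in> ?W n"
      show "(\<lambda>x. a x * b x * g x $ i' * h x) \<in> ?W (n + ?K)"
      proof (cases "i' = i")
        case True
        show ?thesis
          by (rule growth_space_mono[OF growth_space_cong[OF b(3)[OF a(3)[OF h]]]]) (auto simp: True)
      next
        case False
        then have "i' \<in> I" using i' by simp
        from L'[OF a(4)[OF this h]] show ?thesis
          by (rule growth_space_mono[OF growth_space_cong]) auto
      qed
    qed
  qed
  from this[of UNIV] obtain a K where a: "polyfn a" "\<exists>v. a v \<noteq> 0"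
    "\<And>n h. h \<in> ?W n \<Longrightarrow> (\<lambda>x. a x * h x) \<in> ?W (n + K)"
    "\<And>i n h. h \<in> ?W n \<Longrightarrow> (\<lambda>x. a x * g x $ i * h x) \<in> ?W (n + K)"
    using finite_class.finite_UNIV by blast
  define G where "G \<beta> x = (\<Prod>i\<in>UNIV. g x $ i ^ \<beta> i)" for \<beta> :: "'q \<Rightarrow> nat" and x
  have powers: "(\<lambda>x. a x ^ s * G \<beta> x) \<in> ?W (K * s)" if "mdeg \<beta> \<le> s" for s \<beta>
    using that
  proof (induction s arbitrary: \<beta>)
    case 0
    then have "\<beta> = (\<lambda>_. 0)" by (auto simp: fun_eq_iff)
    have "growth_elem F (\<lambda>_. 0, \<lambda>_. 0) \<in> ?W 0"
      by (rule growth_elem_in_space) (use N in \<open>auto simp: mem_growth_index Suc_le_eq\<close>)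
    then show ?case by (simp add: \<open>\<beta> = _\<close> G_def growth_elem_def[abs_def])
  next
    case (Suc s)
    show ?case
    proof (cases "mdeg \<beta> \<le> s")
      case True
      from a(3)[OF Suc.IH[OF this]] show ?thesis by (simp add: mult_ac add.commute)
    next
      case False
      then obtain i where i: "\<beta> i \<noteq> 0" by (metis sum.neutral zero_le)
      define \<beta>' where "\<beta>' = \<beta>(i := \<beta> i - 1)"
      have "mdeg \<beta>' \<le> s" using Suc.prems i unfolding \<beta>'_def mdeg_upd by (simp add: mdeg_remove[of \<beta> i])
      from a(4)[OF Suc.IH[OF this], of i] have "(\<lambda>x. a x * g x $ i * (a x ^ s * G \<beta>' x)) \<in> ?W (K * s + K)" .
      moreover have "g x $ i * G \<beta>' x = G \<beta> x" for x
      proof -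
        have "G \<beta>' x = g x $ i ^ (\<beta> i - 1) * (\<Prod>l\<in>UNIV-{i}. g x $ l ^ \<beta> l)"
          unfolding G_def by (subst prod.remove[of UNIV i]) (auto simp: \<beta>'_def)
        moreover have "G \<beta> x = g x $ i ^ \<beta> i * (\<Prod>l\<in>UNIV-{i}. g x $ l ^ \<beta> l)"
          unfolding G_def by (subst prod.remove[of UNIV i]) auto
        moreover have "g x $ i * g x $ i ^ (\<beta> i - 1) = g x $ i ^ \<beta> i"
          using i by (cases "\<beta> i") auto
        ultimately show ?thesis by (metis mult.assoc)
      qed
      ultimately show ?thesis
        by (elim growth_space_cong[THEN back_subst[of "\<lambda>n. _ \<in> ?W n"]]) (auto simp: mult_ac)
    qed
  qed
  define E where "E = (\<Prod>j\<in>UNIV. N j)"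
  define q where "q = CARD('q)"
  define k where "k = CARD('k)"
  \<comment> \<open>\<open>(K q D + 1)\<^sup>k E \<le> (K q + 1)\<^sup>k (D + 1)\<^sup>k E = D (D + 1)\<^sup>k < (D + 1)\<^sup>q\<close>, so there are more monomials than equations.\<close>
  define D where "D = (K * q + 1) ^ k * E"
  define s where "s = q * D"
  define B where "B = (PiE UNIV (\<lambda>_. {..D}) :: ('q \<Rightarrow> nat) set)"
  have finB: "finite B" unfolding B_def by (intro finite_PiE) auto
  have cardB: "card B = (D + 1) ^ q" unfolding B_def q_def by (simp add: card_PiE)
  have degB: "mdeg \<beta> \<le> s" if "\<beta> \<in> B" for \<beta>
  proof -
    have "mdeg \<beta> \<le> (\<Sum>i\<in>(UNIV::'q set). D)"
      using that by (intro sum_mono) (auto simp: B_def)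
    then show ?thesis by (simp add: s_def q_def)
  qed
  have "\<exists>m. \<forall>x\<in>U. a x ^ s * G \<beta> x = (\<Sum>r\<in>growth_index N (K * s). m r * growth_elem F r x)" if "\<beta> \<in> B" for \<beta>
    using powers[OF degB[OF that]] unfolding growth_space_def by blast
  then obtain m where m: "\<And>\<beta> x. \<beta> \<in> B \<Longrightarrow> x \<in> U \<Longrightarrow>
      a x ^ s * G \<beta> x = (\<Sum>r\<in>growth_index N (K * s). m \<beta> r * growth_elem F r x)" by metis
  have "card (growth_index N (K * s) :: (('k \<Rightarrow> nat) \<times> _) set) < card B"
  proof -
    have "(K * s + 1) ^ k * E \<le> ((K * q + 1) * (D + 1)) ^ k * E"
      by (intro mult_right_mono power_mono) (auto simp: s_def algebra_simps)
    also have "\<dots> = ((K * q + 1) ^ k * E) * (D + 1) ^ k" by (simp only: power_mult_distrib mult_ac)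
    also have "\<dots> = D * (D + 1) ^ k" by (simp only: D_def)
    also have "\<dots> < (D + 1) ^ Suc k" by simp
    also have "\<dots> \<le> (D + 1) ^ q" using card unfolding q_def k_def by (intro power_increasing) auto
    finally show ?thesis by (simp add: card_growth_index cardB k_def E_def)
  qed
  from underdetermined_system[OF finite_growth_index finB this, of "\<lambda>r \<beta>. m \<beta> r"]
  obtain c where c: "\<exists>\<beta>\<in>B. c \<beta> \<noteq> 0"
    "\<And>r. r \<in> growth_index N (K * s) \<Longrightarrow> (\<Sum>\<beta>\<in>B. m \<beta> r * c \<beta>) = 0" by auto
  define P where "P \<beta> = (if \<beta> \<in> B then c \<beta> else 0)" for \<beta>
  have finP: "finite {\<beta>. P \<beta> \<noteq> 0}" by (rule finite_subset[OF _ finB]) (auto simp: P_def)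
  have Pval: "ps_sum P (g x) = (\<Sum>\<beta>\<in>B. c \<beta> * G \<beta> x)" for x
  proof -
    have "ps_sum P (g x) = (\<Sum>\<beta>\<in>B. ps_term P (g x) \<beta>)"
      unfolding ps_sum_finite[OF finP] by (rule sum.mono_neutral_left) (use finB in \<open>auto simp: P_def ps_term_def\<close>)
    then show ?thesis by (simp add: ps_term_def P_def G_def)
  qed
  \<comment> \<open>The common denominator \<open>a\<^sup>s\<close> cancels where it is not zero.\<close>
  have off: "ps_sum P (g x) = 0" if x: "x \<in> U" "a x \<noteq> 0" for x
  proof -
    have "a x ^ s * ps_sum P (g x) = (\<Sum>\<beta>\<in>B. c \<beta> * (a x ^ s * G \<beta> x))"
      unfolding Pval by (simp add: sum_distrib_left mult_ac)
    also have "\<dots> = (\<Sum>\<beta>\<in>B. c \<beta> * (\<Sum>r\<in>growth_index N (K * s). m \<beta> r * growth_elem F r x))"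
      by (intro sum.cong refl) (simp only: m[OF _ x(1)])
    also have "\<dots> = (\<Sum>r\<in>growth_index N (K * s). growth_elem F r x * (\<Sum>\<beta>\<in>B. m \<beta> r * c \<beta>))"
      unfolding sum_distrib_left by (subst sum.swap) (intro sum.cong, auto)
    also have "\<dots> = 0" by (simp add: c(2))
    finally show ?thesis using x by simp
  qed
  \<comment> \<open>The relation extends by continuity: an open set on which it fails would lie in the zero set of \<open>a\<close>.\<close>
  have pc: "continuous_on U (\<lambda>x. ps_sum P (g x))"
    by (rule continuous_on_compose2[OF mhol_continuous_on[OF mhol_polyfn[OF polyfn_ps_sum[OF finP]]] cont]) auto
  have "ps_sum P (g x) = 0" if x: "x \<in> U" for x
  proof (rule ccontr)
    assume nz: "ps_sum P (g x) \<noteq> 0"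
    have "open (U \<inter> (\<lambda>x. ps_sum P (g x)) -` (- {0}))"
      by (rule continuous_open_preimage[OF pc U]) (rule open_Compl[OF closed_singleton])
    moreover have "x \<in> U \<inter> (\<lambda>x. ps_sum P (g x)) -` (- {0})" using x nz by simp
    ultimately have "a y = 0" for y
      by (rule polyfn_eq_0_of_open[OF a(1)]) (use off in auto)
    with a(2) show False by blast
  qed
  moreover have "\<exists>v. ps_sum P v \<noteq> 0"
    by (rule finite_ps_sum_nonzero[OF finP]) (use c(1) in \<open>auto simp: P_def fun_eq_iff\<close>)
  ultimately show ?thesis using polyfn_ps_sum[OF finP] by blast
qed

section \<open>Algebraic germs\<close>

definition alg_at :: "complex ^ 'k::finite \<Rightarrow> (complex ^ 'k \<Rightarrow> complex) \<Rightarrow> bool"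
  where "alg_at x0 f \<longleftrightarrow> algdep x0 (\<lambda>x. snoc_vec x (f x))"

lemma snoc_vec_nth [simp]: "snoc_vec x y $ None = y" "snoc_vec x y $ Some k = x $ k"
  by (simp_all add: snoc_vec_def)

lemma vjoin_nth [simp]: "vjoin x y $ Inl k = x $ k" "vjoin x y $ Inr l = y $ l"
  by (simp_all add: vjoin_def)

theorem algdep_combinations:
  fixes F :: "'l::finite \<Rightarrow> complex ^ 'k::finite \<Rightarrow> complex"
    and q :: "'q::finite \<Rightarrow> complex ^ ('k + 'l) \<Rightarrow> complex"
  assumes F: "\<And>j. mhol (F j) S" "x0 \<in> S" and alg: "\<And>j. alg_at x0 (F j)"
    and q: "\<And>i. polyfn (q i)" and card: "CARD('k) < CARD('q)"
  shows "algdep x0 (\<lambda>x. \<chi> i. q i (vjoin x (\<chi> j. F j x)))"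
proof -
  have "\<exists>p U. polyfn p \<and> (\<exists>v. p v \<noteq> 0) \<and> open U \<and> x0 \<in> U \<and> (\<forall>x\<in>U. p (snoc_vec x (F j x)) = 0)" for j
    using alg[of j] unfolding alg_at_def algdep_def eventually_nhds by blast
  then obtain p U where p: "\<And>j. polyfn (p j)" "\<And>j. \<exists>v. p j v \<noteq> 0" "\<And>j. open (U j)" "\<And>j. x0 \<in> U j"
    "\<And>j x. x \<in> U j \<Longrightarrow> p j (snoc_vec x (F j x)) = 0" by metis
  have "open S" using F(1) mhol_open by blast
  define V where "V = S \<inter> (\<Inter>j. U j)"
  have V: "open V" "x0 \<in> V" "V \<subseteq> S"
    using \<open>open S\<close> F p by (auto simp: V_def intro!: open_Int open_INT)
  define R where "R j n a \<longleftrightarrow> n \<ge> 1 \<and> (\<forall>e. polyfn (a e)) \<and> (\<exists>x. a n x \<noteq> 0) \<and>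
    (\<forall>x\<in>V. a n x * F j x ^ n = - (\<Sum>e<n. a e x * F j x ^ e))" for j n a
  have "\<exists>n a. R j n a" for j
  proof -
    obtain v where v: "p j v \<noteq> 0" using p(2) by blast
    have ne: "V \<noteq> {}" using V by blast
    have z: "p j (snoc_vec x (F j x)) = 0" if "x \<in> V" for x using that p(5) by (auto simp: V_def)
    obtain n a where "n \<ge> 1" "\<And>e. polyfn (a e)" "\<exists>x. a n x \<noteq> 0"
      "\<And>x. x \<in> V \<Longrightarrow> a n x * F j x ^ n = - (\<Sum>e<n. a e x * F j x ^ e)"
      by (rule algebraic_relation_leading[OF p(1) v V(1) ne z], assumption, rule that)
    then have "R j n a" by (simp add: R_def)
    then show ?thesis by blast
  qed
  then obtain N a where "\<And>j. R j (N j) (a j)" by metis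
  then have Na: "\<And>j. N j \<ge> 1" "\<And>j e. polyfn (a j e)" "\<And>j. \<exists>x. a j (N j) x \<noteq> 0"
    "\<And>j x. x \<in> V \<Longrightarrow> a j (N j) x * F j x ^ N j = - (\<Sum>e<N j. a j e x * F j x ^ e)"
    unfolding R_def by blast+
  have tF: "tame V F N (F j)" for j
    by (rule tame_generator[where a = "a j"]) (use Na in auto)
  have tq: "tame V F N (\<lambda>x. r (vjoin x (\<chi> j. F j x)))" if "polyfn r" for r :: "complex ^ ('k + 'l) \<Rightarrow> complex"
    using that
  proof (induction rule: polyfn.induct)
    case (polyfn_const c) show ?case by (rule tame_polyfn[OF polyfn.polyfn_const])
  next
    case (polyfn_add r s) show ?case by (rule tame_add[OF polyfn_add.IH])
  next
    case (polyfn_mult_coord r i)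
    have "tame V F N (\<lambda>x. vjoin x (\<chi> j. F j x) $ i)"
      by (cases i) (auto intro: tF tame_polyfn polyfn_coord)
    from tame_mult[OF polyfn_mult_coord.IH this] show ?case .
  qed
  have cont: "continuous_on V (\<lambda>x. \<chi> i. q i (vjoin x (\<chi> j. F j x)))"
  proof (intro continuous_intros)
    fix i
    have "mhol (\<lambda>x. q i (vjoin x (\<chi> j. F j x))) V"
    proof (rule mhol_compose[OF mhol_polyfn[OF q]])
      show "mhol (\<lambda>x. vjoin x (\<chi> j. F j x) $ k) V" for k
        by (cases k) (auto intro: mhol_component[OF V(1)] mhol_subset[OF F(1) V(1,3)])
    qed auto
    then show "continuous_on V (\<lambda>x. q i (vjoin x (\<chi> j. F j x)))" by (rule mhol_continuous_on)
  qed
  have "\<exists>p. polyfn p \<and> (\<exists>v. p v \<noteq> 0) \<and> (\<forall>x\<in>V. p (\<chi> i. q i (vjoin x (\<chi> j. F j x))) = 0)"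
    by (rule tame_dependent[OF V(1) _ _ cont card, of N F]) (use Na(1) tq[OF q] in simp_all)
  then show ?thesis unfolding algdep_def eventually_nhds using V by metis
qed

lemma alg_at_combination:
  fixes F :: "'l::finite \<Rightarrow> complex ^ 'k::finite \<Rightarrow> complex"
  assumes F: "\<And>j. mhol (F j) S" "x0 \<in> S" "\<And>j. alg_at x0 (F j)" and q: "polyfn q"
  shows "alg_at x0 (\<lambda>x. q (vjoin x (\<chi> j. F j x)))"
proof -
  define Q where "Q i = (case i of None \<Rightarrow> q | Some k \<Rightarrow> (\<lambda>y. y $ Inl k))" for i :: "'k option"
  have pQ: "polyfn (Q i)" for i by (cases i) (auto simp: Q_def q polyfn_coord)
  have "CARD('k) < CARD('k option)" by simp
  from algdep_combinations[OF F pQ this]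
  have "algdep x0 (\<lambda>x. \<chi> i. Q i (vjoin x (\<chi> j. F j x)))" by simp
  also have "(\<lambda>x. \<chi> i. Q i (vjoin x (\<chi> j. F j x))) = (\<lambda>x. snoc_vec x (q (vjoin x (\<chi> j. F j x))))"
    by (auto simp: fun_eq_iff vec_eq_iff Q_def snoc_vec_def split: option.split)
  finally show ?thesis by (simp add: alg_at_def)
qed

text \<open>
  The \<open>k + 1\<close> functions \<open>\<Phi>\<^sub>1(x), ..., \<Phi>\<^sub>k(x), x\<^sub>i\<close> of \<open>k\<close> variables are dependent. Substituting
  \<open>x = \<Psi>(y)\<close> turns a relation between them into one between \<open>y\<close> and \<open>\<Psi>\<^sub>i(y)\<close>.
\<close>

lemma alg_at_inverse:
  fixes \<Phi> :: "complex ^ 'k::finite \<Rightarrow> complex ^ 'k"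
  assumes \<Phi>: "\<And>j. mhol (\<lambda>x. \<Phi> x $ j) S" "x0 \<in> S" "\<And>j. alg_at x0 (\<lambda>x. \<Phi> x $ j)"
    and \<Psi>: "(\<Psi> \<longlongrightarrow> x0) (nhds y0)" "\<forall>\<^sub>F y in nhds y0. \<Phi> (\<Psi> y) = y"
  shows "alg_at y0 (\<lambda>y. \<Psi> y $ i)"
proof -
  define Q :: "'k option \<Rightarrow> complex ^ ('k + 'k) \<Rightarrow> complex"
    where "Q t = (case t of None \<Rightarrow> (\<lambda>y. y $ Inl i) | Some k \<Rightarrow> (\<lambda>y. y $ Inr k))" for t
  have pQ: "polyfn (Q t)" for t by (cases t) (auto simp: Q_def polyfn_coord)
  have "CARD('k) < CARD('k option)" by simp
  have "algdep x0 (\<lambda>x. \<chi> t. Q t (vjoin x (\<chi> j. \<Phi> x $ j)))"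
    by (rule algdep_combinations[OF \<Phi> pQ \<open>CARD('k) < CARD('k option)\<close>])
  also have "(\<lambda>x. \<chi> t. Q t (vjoin x (\<chi> j. \<Phi> x $ j))) = (\<lambda>x. snoc_vec (\<Phi> x) (x $ i))"
    by (auto simp: fun_eq_iff vec_eq_iff Q_def snoc_vec_def split: option.split)
  finally obtain p v where p: "polyfn p" "p v \<noteq> 0" "\<forall>\<^sub>F x in nhds x0. p (snoc_vec (\<Phi> x) (x $ i)) = 0"
    unfolding algdep_def by blast
  have "\<forall>\<^sub>F y in nhds y0. p (snoc_vec y (\<Psi> y $ i)) = 0"
    using eventually_compose_filterlim[OF p(3) \<Psi>(1)] \<Psi>(2) by eventually_elim simp
  with p show ?thesis unfolding alg_at_def algdep_def by blast
qed

text \<open>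
  Setting the last variables to zero may kill the polynomial relation. On a line \<open>s u\<close> through a
  point where the relation does not vanish identically, the lowest power of \<open>s\<close> can be divided out.
\<close>

lemma alg_at_restrict:
  fixes h :: "complex ^ ('k::finite + 'l::finite) \<Rightarrow> complex"
  assumes h: "mhol h S" "0 \<in> S" and alg: "alg_at 0 h"
  shows "alg_at 0 (\<lambda>v. h (vjoin v 0))"
proof -
  obtain p w where p: "polyfn p" "p w \<noteq> 0" "\<forall>\<^sub>F x in nhds 0. p (snoc_vec x (h x)) = 0"
    using alg unfolding alg_at_def algdep_def by blast
  define u where "u = (\<chi> l. w $ Some (Inr l))"
  define T where "T y = snoc_vec (vjoin (\<chi> k. y $ Some (Some k)) (\<chi> l. y $ None * u $ l)) (y $ Some None)"
    for y :: "complex ^ 'k option option"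
  have pT: "polyfn (\<lambda>y. p (T y))"
  proof (rule polyfn_compose[OF p(1)])
    fix i show "polyfn (\<lambda>y. T y $ i)"
    proof (cases i)
      case (Some j)
      then show ?thesis by (cases j) (auto simp: T_def intro: polyfn_coord polyfn_cmult)
    qed (auto simp: T_def polyfn_coord)
  qed
  then obtain d Q where Q: "\<forall>x. degree (Q x) \<le> d" "\<forall>e. polyfn (\<lambda>x. coeff (Q x) e)"
    "\<forall>x s. p (T (\<chi> j. if j = None then s else x $ j)) = poly (Q x) s"
    using polyfn_univariate[OF pT, of None] by blast
  define a where "a e y = coeff (Q (snoc_vec y 0)) e" for e y
  have pa: "polyfn (a e)" for e
    unfolding a_def
  proof (rule polyfn_compose[OF Q(2)[rule_format]])
    show "polyfn (\<lambda>x. snoc_vec x (0::complex) $ i)" for i :: "'k option option"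
      by (cases i) (auto intro: polyfn_const polyfn_coord)
  qed
  have val: "p (snoc_vec (vjoin v (s *s u)) y) = (\<Sum>e\<le>d. a e (snoc_vec v y) * s ^ e)" for v s y
  proof -
    have "poly (Q (snoc_vec (snoc_vec v y) 0)) s = (\<Sum>e\<le>d. a e (snoc_vec v y) * s ^ e)"
      unfolding poly_altdef a_def
      by (rule sum.mono_neutral_left) (use Q(1) in \<open>auto simp: coeff_eq_0\<close>)
    moreover have "T (\<chi> j. if j = None then s else snoc_vec (snoc_vec v y) 0 $ j) = snoc_vec (vjoin v (s *s u)) y"
      by (auto simp: T_def vec_eq_iff snoc_vec_def vjoin_def split: option.split sum.split)
    ultimately show ?thesis using Q(3)[rule_format, where x = "snoc_vec (snoc_vec v y) 0" and s = s] by simp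
  qed
  have w: "w = snoc_vec (vjoin (\<chi> k. w $ Some (Inl k)) (1 *s u)) (w $ None)"
    by (auto simp: vec_eq_iff snoc_vec_def vjoin_def u_def split: option.split sum.split)
  have "\<exists>e y. a e y \<noteq> 0"
  proof (rule ccontr)
    assume "\<not> ?thesis"
    then have "p w = 0" by (subst w, subst val) simp
    with p show False by simp
  qed
  \<comment> \<open>The lowest power of \<open>s\<close> whose coefficient does not vanish identically.\<close>
  define e0 where "e0 = (LEAST e. \<exists>y. a e y \<noteq> 0)"
  have e0: "\<exists>y. a e0 y \<noteq> 0" unfolding e0_def by (rule LeastI_ex) fact
  have low: "a e y = 0" if "e < e0" for e y
    using not_less_Least[OF that[unfolded e0_def]] by blast
  have e0d: "e0 \<le> d"
  proof (rule ccontr)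
    assume "\<not> e0 \<le> d"
    then have "a e0 y = 0" for y unfolding a_def using Q(1) by (meson coeff_eq_0 le_less_trans not_le)
    with e0 show False by blast
  qed
  obtain W where W: "open W" "0 \<in> W" "\<And>x. x \<in> W \<Longrightarrow> p (snoc_vec x (h x)) = 0"
    using p(3) unfolding eventually_nhds by blast
  have oWS: "open (W \<inter> S)" using W(1) mhol_open[OF h(1)] by (rule open_Int)
  define j where "j v s = vjoin v (s *s u)" for v :: "complex ^ 'k" and s
  have cj: "continuous_on A (\<lambda>v. j v s)" for A s
  proof -
    have "continuous_on A (\<lambda>v. case i of Inl k \<Rightarrow> v $ k | Inr l \<Rightarrow> (s *s u) $ l)" for i
      by (cases i) (auto intro!: continuous_intros)
    then show ?thesis unfolding j_def vjoin_def by (intro continuous_intros)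
  qed
  have cj': "continuous_on A (\<lambda>s. j v s)" for A v
  proof -
    have "continuous_on A (\<lambda>s. case i of Inl k \<Rightarrow> v $ k | Inr l \<Rightarrow> (s *s u) $ l)" for i
      by (cases i) (auto intro!: continuous_intros)
    then show ?thesis unfolding j_def vjoin_def by (intro continuous_intros)
  qed
  have j0: "j v 0 = vjoin v 0" for v by (simp add: j_def)
  define Y where "Y = (\<lambda>v. j v 0) -` (W \<inter> S)"
  have "vjoin 0 0 = (0 :: complex ^ ('k + 'l))" by (auto simp: vec_eq_iff vjoin_def split: sum.split)
  moreover have "open Y" unfolding Y_def by (rule open_vimage[OF oWS cj])
  ultimately have Y: "open Y" "0 \<in> Y"
    using W(2) h(2) by (auto simp: Y_def j0)
  have "a e0 (snoc_vec v (h (vjoin v 0))) = 0" if v: "v \<in> Y" for v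
  proof -
    define f where "f s = (\<Sum>e\<in>{e0..d}. a e (snoc_vec v (h (j v s))) * s ^ (e - e0))" for s
    define X where "X = (\<lambda>s. j v s) -` (W \<inter> S)"
    have X: "open X" "0 \<in> X"
      using v open_vimage[OF oWS cj'[of UNIV v]] by (auto simp: X_def Y_def)
    have "continuous_on X (\<lambda>s. h (j v s))"
      by (rule continuous_on_compose2[OF mhol_continuous_on[OF h(1)] cj']) (auto simp: X_def)
    then have "continuous_on X (\<lambda>s. case i of None \<Rightarrow> h (j v s) | Some k \<Rightarrow> v $ k)" for i
      by (cases i) auto
    then have sn: "continuous_on X (\<lambda>s. snoc_vec v (h (j v s)))"
      unfolding snoc_vec_def by (intro continuous_intros)
    have "continuous_on X f" unfolding f_def
      by (intro continuous_intros continuous_on_compose2[OF mhol_continuous_on[OF mhol_polyfn[OF pa]] sn]) auto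
    then have lim: "(f \<longlongrightarrow> f 0) (at 0)"
      using X continuous_on_eq_continuous_at continuous_at by blast
    have "\<forall>\<^sub>F s in at 0. s \<in> X - {0}"
      using eventually_at_in_open[OF X(1,2)] .
    then have "\<forall>\<^sub>F s in at 0. f s = 0"
    proof eventually_elim
      case (elim s)
      have "0 = (\<Sum>e\<le>d. a e (snoc_vec v (h (j v s))) * s ^ e)"
        using W(3)[of "j v s"] elim val[of v s "h (j v s)"] by (simp add: X_def j_def)
      also have "\<dots> = (\<Sum>e\<in>{e0..d}. a e (snoc_vec v (h (j v s))) * s ^ e)"
        by (rule sum.mono_neutral_right) (use low in \<open>auto simp: not_le\<close>)
      also have "\<dots> = s ^ e0 * f s"
        unfolding f_def sum_distrib_left by (intro sum.cong) (auto simp: power_add[symmetric])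
      finally show ?case using elim by simp
    qed
    then have "(f \<longlongrightarrow> 0) (at 0)" by (rule tendsto_eventually)
    then have "f 0 = 0" using lim tendsto_unique by (metis trivial_limit_at)
    moreover have "f 0 = a e0 (snoc_vec v (h (vjoin v 0)))"
    proof -
      have "f 0 = (\<Sum>e\<in>{e0}. a e (snoc_vec v (h (j v 0))) * 0 ^ (e - e0))"
        unfolding f_def by (rule sum.mono_neutral_right) (use e0d in auto)
      then show ?thesis by (simp add: j0)
    qed
    ultimately show ?thesis by simp
  qed
  then have "\<forall>\<^sub>F v in nhds 0. a e0 (snoc_vec v (h (vjoin v 0))) = 0"
    unfolding eventually_nhds using Y by blast
  then show ?thesis unfolding alg_at_def algdep_def using pa e0 by blast
qed

text \<open>
  Surjectivity of \<open>L\<close> is needed for the relation to stay nontrivial after the substitution.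
\<close>

lemma alg_at_compose_surj:
  fixes L :: "complex ^ 'k'::finite \<Rightarrow> complex ^ 'k::finite"
  assumes f: "alg_at (L x0) f" and L: "\<And>i. polyfn (\<lambda>x. L x $ i)" "surj L"
  shows "alg_at x0 (\<lambda>x. f (L x))"
proof -
  obtain p w where p: "polyfn p" "p w \<noteq> 0" "\<forall>\<^sub>F x in nhds (L x0). p (snoc_vec x (f x)) = 0"
    using f unfolding alg_at_def algdep_def by blast
  have "continuous_on UNIV L"
  proof -
    have "continuous_on UNIV (\<lambda>x. \<chi> i. L x $ i)"
      by (intro continuous_intros mhol_continuous_on mhol_polyfn L)
    then show ?thesis by simp
  qed
  then have tL: "(L \<longlongrightarrow> L x0) (nhds x0)"
    by (intro continuous_on_tendsto_compose[OF _ filterlim_ident]) auto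
  define q where "q y = p (snoc_vec (L (\<chi> k. y $ Some k)) (y $ None))" for y
  have "polyfn q" unfolding q_def
  proof (rule polyfn_compose[OF p(1)])
    fix i show "polyfn (\<lambda>y. snoc_vec (L (\<chi> k. y $ Some k)) (y $ None) $ i)"
    proof (cases i)
      case (Some k)
      have "polyfn (\<lambda>y. L (\<chi> k. y $ Some k) $ k)"
        by (rule polyfn_compose[OF L(1)]) (simp add: polyfn_coord)
      then show ?thesis by (simp add: Some)
    qed (simp add: polyfn_coord)
  qed
  moreover obtain v where v: "L v = (\<chi> k. w $ Some k)" using L(2) by (metis surjD)
  have "q (snoc_vec v (w $ None)) = p w"
  proof -
    have "snoc_vec (L (\<chi> k. snoc_vec v (w $ None) $ Some k)) (snoc_vec v (w $ None) $ None) = w"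
      by (auto simp: v vec_eq_iff snoc_vec_def split: option.split)
    then show ?thesis by (simp add: q_def)
  qed
  moreover have "\<forall>\<^sub>F x in nhds x0. q (snoc_vec x (f (L x))) = 0"
    using eventually_compose_filterlim[OF p(3) tL] by (simp add: q_def)
  ultimately show ?thesis unfolding alg_at_def algdep_def using p(2) by metis
qed

text \<open>
  By the identity theorem the polynomial relation at the origin holds on the whole polydisc.
\<close>

lemma alg_at_continuation:
  assumes c: "converges_normally c \<rho>" and alg: "alg_at 0 (ps_sum c)" and x0: "x0 \<in> polydisc \<rho>"
  shows "alg_at x0 (ps_sum c)"
proof -
  obtain p w where p: "polyfn p" "p w \<noteq> 0" "\<forall>\<^sub>F x in nhds 0. p (snoc_vec x (ps_sum c x)) = 0"
    using alg unfolding alg_at_def algdep_def by blast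
  have "mhol (\<lambda>x. p (snoc_vec x (ps_sum c x))) (polydisc \<rho>)"
  proof (rule mhol_compose[OF mhol_polyfn[OF p(1)]])
    show "mhol (\<lambda>x. snoc_vec x (ps_sum c x) $ i) (polydisc \<rho>)" for i
      by (cases i) (auto intro: mhol_ps_sum[OF c] mhol_component open_polydisc)
  qed auto
  then have "p (snoc_vec x (ps_sum c x)) = 0" if "x \<in> polydisc \<rho>" for x
    using mhol_identity p(3) that by blast
  then have "\<forall>\<^sub>F x in nhds x0. p (snoc_vec x (ps_sum c x)) = 0"
    using eventually_nhds_in_open[OF open_polydisc x0] by (auto elim: eventually_mono)
  with p show ?thesis unfolding alg_at_def algdep_def by blast
qed

lemma alg_at_cong:
  assumes "alg_at x0 f" "\<forall>\<^sub>F x in nhds x0. f x = g x"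
  shows "alg_at x0 g"
proof -
  obtain p w where p: "polyfn p" "p w \<noteq> 0" "\<forall>\<^sub>F x in nhds x0. p (snoc_vec x (f x)) = 0"
    using assms(1) unfolding alg_at_def algdep_def by blast
  from p(3) assms(2) have "\<forall>\<^sub>F x in nhds x0. p (snoc_vec x (g x)) = 0" by eventually_elim simp
  with p show ?thesis unfolding alg_at_def algdep_def by blast
qed

lemma polyfn_cnj: "polyfn p \<Longrightarrow> polyfn (\<lambda>x. cnj (p (cnj_vec x)))"
proof (induction rule: polyfn.induct)
  case (polyfn_const c) show ?case by (rule polyfn.polyfn_const)
next
  case (polyfn_add p q) then show ?case by (simp add: polyfn.polyfn_add)
next
  case (polyfn_mult_coord p i)
  from polyfn.polyfn_mult_coord[OF polyfn_mult_coord.IH, of i] show ?case by (simp add: cnj_vec_def)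
qed

lemma cnj_vec_nth [simp]: "cnj_vec z $ i = cnj (z $ i)"
  by (simp add: cnj_vec_def)

lemma cnj_vec_cnj_vec [simp]: "cnj_vec (cnj_vec z) = z"
  by (simp add: vec_eq_iff)

lemma continuous_on_cnj_vec: "continuous_on A cnj_vec"
  unfolding cnj_vec_def by (intro continuous_intros)

lemma tendsto_cnj_vec: "(cnj_vec \<longlongrightarrow> cnj_vec x) (nhds x)"
  by (intro continuous_on_tendsto_compose[OF continuous_on_cnj_vec[of UNIV] filterlim_ident]) auto

lemma alg_at_cnj:
  assumes "alg_at (cnj_vec x0) f"
  shows "alg_at x0 (\<lambda>x. cnj (f (cnj_vec x)))"
proof -
  obtain p w where p: "polyfn p" "p w \<noteq> 0" "\<forall>\<^sub>F x in nhds (cnj_vec x0). p (snoc_vec x (f x)) = 0"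
    using assms unfolding alg_at_def algdep_def by blast
  have "cnj_vec (snoc_vec x (cnj (f (cnj_vec x)))) = snoc_vec (cnj_vec x) (f (cnj_vec x))" for x
    by (auto simp: vec_eq_iff snoc_vec_def split: option.split)
  then have "\<forall>\<^sub>F x in nhds x0. cnj (p (cnj_vec (snoc_vec x (cnj (f (cnj_vec x)))))) = 0"
    using eventually_compose_filterlim[OF p(3) tendsto_cnj_vec] by simp
  moreover have "cnj (p (cnj_vec (cnj_vec w))) \<noteq> 0" using p by simp
  ultimately show ?thesis unfolding alg_at_def algdep_def using polyfn_cnj[OF p(1)] by blast
qed

section \<open>Real and complex algebraic power series\<close>

lemma polyfn_complexify:
  assumes "polyfn (p :: real ^ 'k::finite \<Rightarrow> real)"
  shows "\<exists>q. polyfn q \<and> (\<forall>x. q (cvec x) = complex_of_real (p x))"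
  using assms
proof (induction rule: polyfn.induct)
  case (polyfn_const c)
  show ?case by (rule exI[of _ "\<lambda>_. complex_of_real c"]) (auto intro: polyfn.polyfn_const)
next
  case (polyfn_add p q)
  then obtain p' q' where "polyfn p'" "\<forall>x. p' (cvec x) = complex_of_real (p x)"
    "polyfn q'" "\<forall>x. q' (cvec x) = complex_of_real (q x)" by blast
  then show ?case by (intro exI[of _ "\<lambda>x. p' x + q' x"]) (auto intro: polyfn.polyfn_add)
next
  case (polyfn_mult_coord p i)
  then obtain p' where "polyfn p'" "\<forall>x. p' (cvec x) = complex_of_real (p x)" by blast
  then show ?case by (intro exI[of _ "\<lambda>x. p' x * x $ i"]) (auto intro: polyfn.polyfn_mult_coord simp: cvec_def)
qed

lemma polyfn_real_imag:
  assumes "polyfn (p :: complex ^ 'k::finite \<Rightarrow> complex)"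
  shows "\<exists>q r. polyfn q \<and> polyfn r \<and> (\<forall>x. p (cvec x) = Complex (q x) (r x))"
  using assms
proof (induction rule: polyfn.induct)
  case (polyfn_const c)
  show ?case by (intro exI[of _ "\<lambda>_. Re c"] exI[of _ "\<lambda>_. Im c"]) (auto intro: polyfn.polyfn_const)
next
  case (polyfn_add p p')
  then obtain q r q' r' where "polyfn q" "polyfn r" "\<forall>x. p (cvec x) = Complex (q x) (r x)"
    "polyfn q'" "polyfn r'" "\<forall>x. p' (cvec x) = Complex (q' x) (r' x)" by blast
  then show ?case
    by (intro exI[of _ "\<lambda>x. q x + q' x"] exI[of _ "\<lambda>x. r x + r' x"]) (auto intro: polyfn.polyfn_add simp: complex_add)
next
  case (polyfn_mult_coord p i)
  then obtain q r where "polyfn q" "polyfn r" "\<forall>x. p (cvec x) = Complex (q x) (r x)" by blast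
  then show ?case
    by (intro exI[of _ "\<lambda>x. q x * x $ i"] exI[of _ "\<lambda>x. r x * x $ i"])
      (auto intro: polyfn.polyfn_mult_coord simp: cvec_def complex_eq_iff)
qed

lemma snoc_vec_cvec: "snoc_vec (cvec x) (complex_of_real y) = cvec (snoc_vec x y)"
  by (auto simp: vec_eq_iff snoc_vec_def cvec_def split: option.split)

lemma convergent_ps_cps: "convergent_ps (cps c) \<longleftrightarrow> convergent_ps c"
  by (simp add: convergent_ps_def converges_normally_cps)

text \<open>
  The relation extends from the real points to the complex ones by the identity theorem.
\<close>

lemma algebraic_ps_cps:
  fixes c :: "('k::finite, real) pseries"
  assumes "algebraic_ps c"
  shows "algebraic_ps (cps c)"
proof -
  from assms have conv: "convergent_ps c" and "algdep 0 (\<lambda>x. snoc_vec x (ps_sum c x))"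
    by (auto simp: algebraic_ps_iff_real)
  then obtain p w where p: "polyfn p" "p w \<noteq> 0" "\<forall>\<^sub>F x in nhds 0. p (snoc_vec x (ps_sum c x)) = 0"
    unfolding algdep_def by blast
  obtain q where q: "polyfn q" "\<And>x. q (cvec x) = complex_of_real (p x)"
    using polyfn_complexify[OF p(1)] by blast
  obtain \<rho> where \<rho>: "\<rho> > 0" "converges_normally (cps c) \<rho>"
    using conv by (auto simp: convergent_ps_def converges_normally_cps)
  have "mhol (\<lambda>x. q (snoc_vec x (ps_sum (cps c) x))) (polydisc \<rho>)"
  proof (rule mhol_compose[OF mhol_polyfn[OF q(1)]])
    show "mhol (\<lambda>x. snoc_vec x (ps_sum (cps c) x) $ i) (polydisc \<rho>)" for i
      by (cases i) (auto intro: mhol_ps_sum[OF \<rho>(2)] mhol_component open_polydisc)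
  qed auto
  moreover have "\<forall>\<^sub>F x in nhds 0. q (snoc_vec (cvec x) (ps_sum (cps c) (cvec x))) = 0"
    using p(3) by eventually_elim (simp add: ps_sum_cps snoc_vec_cvec q(2))
  ultimately have "q (snoc_vec x (ps_sum (cps c) x)) = 0" if "x \<in> polydisc \<rho>" for x
    using mhol_zero_on_reals[of "\<lambda>x. q (snoc_vec x (ps_sum (cps c) x))"] that by blast
  then have "\<forall>\<^sub>F x in nhds 0. q (snoc_vec x (ps_sum (cps c) x)) = 0"
    using eventually_nhds_in_open[OF open_polydisc, of 0 \<rho>] \<rho> by (auto elim: eventually_mono)
  moreover have "q (cvec w) \<noteq> 0" using p q by simp
  ultimately show ?thesis
    unfolding algebraic_ps_iff algdep_def using q(1) conv by (auto simp: convergent_ps_cps)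
qed

text \<open>
  Real and imaginary parts of a complex relation are real relations, and one of them is nontrivial.
\<close>

lemma algebraic_ps_real_coefficients:
  fixes c :: "('k::finite, real) pseries"
  assumes "algebraic_ps (cps c)"
  shows "algebraic_ps c"
proof -
  from assms have conv: "convergent_ps c" and "algdep 0 (\<lambda>x. snoc_vec x (ps_sum (cps c) x))"
    by (auto simp: algebraic_ps_iff convergent_ps_cps)
  then obtain p w where p: "polyfn p" "p w \<noteq> 0" "\<forall>\<^sub>F x in nhds 0. p (snoc_vec x (ps_sum (cps c) x)) = 0"
    unfolding algdep_def by blast
  have tc: "(cvec \<longlongrightarrow> 0) (nhds (0 :: real ^ 'k))"
    using continuous_on_tendsto_compose[OF continuous_on_cvec[of UNIV] filterlim_ident, of 0] by simp
  obtain q r where qr: "polyfn q" "polyfn r" "\<And>x. p (cvec x) = Complex (q x) (r x)"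
    using polyfn_real_imag[OF p(1)] by blast
  have "\<forall>\<^sub>F x in nhds 0. p (cvec (snoc_vec x (ps_sum c x))) = 0"
    using eventually_compose_filterlim[OF p(3) tc] by (simp add: ps_sum_cps snoc_vec_cvec)
  then have z: "\<forall>\<^sub>F x in nhds 0. q (snoc_vec x (ps_sum c x)) = 0 \<and> r (snoc_vec x (ps_sum c x)) = 0"
    by eventually_elim (simp add: qr(3) complex_eq_iff)
  have "(\<exists>v. q v \<noteq> 0) \<or> (\<exists>v. r v \<noteq> 0)"
  proof (rule ccontr)
    assume "\<not> ?thesis"
    then have "\<forall>\<^sub>F x in nhds 0. p (cvec x) = 0" by (simp add: qr(3) complex_eq_iff)
    moreover have "mhol p (polydisc (norm w + 1))"
      by (rule mhol_subset[OF mhol_polyfn[OF p(1)]]) (auto simp: open_polydisc)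
    moreover have "w \<in> polydisc (norm w + 1)"
      using le_less_trans[OF Finite_Cartesian_Product.norm_nth_le[of w], of "norm w + 1"] by (simp add: polydisc_def)
    ultimately have "p w = 0" using mhol_zero_on_reals by blast
    with p show False by simp
  qed
  then have "algdep 0 (\<lambda>x. snoc_vec x (ps_sum c x))"
    unfolding algdep_def using qr(1,2) z by (auto elim: eventually_mono)
  with conv show ?thesis by (simp add: algebraic_ps_iff_real)
qed

section \<open>The points of \<open>\<bar>w = \<Theta>(\<bar>z, z, w)\<close>\<close>

definition w_part :: "'a ^ ('m::finite + 'd::finite) \<Rightarrow> 'a ^ 'd"
  where "w_part t = (\<chi> l. t $ Inr l)"

lemma z_part_nth [simp]: "z_part t $ k = t $ Inl k"
  and w_part_nth [simp]: "w_part t $ l = t $ Inr l"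
  by (simp_all add: z_part_def w_part_def)

lemma z_part_vjoin [simp]: "z_part (vjoin z w) = z"
  and w_part_vjoin [simp]: "w_part (vjoin z w) = w"
  by (simp_all add: vec_eq_iff)

lemma vjoin_parts [simp]: "vjoin (z_part t) (w_part t) = t"
  by (auto simp: vec_eq_iff vjoin_def split: sum.split)

lemma vec_eq_sum_iff: "x = y \<longleftrightarrow> (\<forall>k. x $ Inl k = y $ Inl k) \<and> (\<forall>l. x $ Inr l = y $ Inr l)"
  by (auto simp: vec_eq_iff split: sum.split) (metis sum.exhaust)

lemma vec_eq_sum3_iff: "x = y \<longleftrightarrow> (\<forall>k. x $ Inl k = y $ Inl k) \<and> (\<forall>k. x $ Inr (Inl k) = y $ Inr (Inl k)) \<and>
    (\<forall>l. x $ Inr (Inr l) = y $ Inr (Inr l))"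
  by (auto simp: vec_eq_iff) (metis sum.exhaust)

lemma scaleR_vec_complex: "r *\<^sub>R v = complex_of_real r *s v"
  unfolding vec_eq_iff
proof
  fix i
  have "(r *\<^sub>R v) $ i = r *\<^sub>R (v $ i)" by (rule vector_scaleR_component)
  also have "\<dots> = complex_of_real r * v $ i" by (rule scaleR_conv_of_real)
  finally show "(r *\<^sub>R v) $ i = (complex_of_real r *s v) $ i" by simp
qed

text \<open>
  The point \<open>(\<bar>z, z, w)\<close> over \<open>(z, w)\<close>: the points of a generic submanifold are lifted to the domain
  of \<open>\<Theta>\<close>.
\<close>

definition lift :: "complex ^ ('m::finite + 'd::finite) \<Rightarrow> complex ^ ('m + 'm + 'd)"
  where "lift t = vjoin (cnj_vec (z_part t)) t"

lemma lift_nth [simp]: "lift t $ Inl k = cnj (t $ Inl k)" "lift t $ Inr i = t $ i"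
  by (simp_all add: lift_def)

lemma norm_vjoin_0: "norm (vjoin (0 :: 'a ^ 'c::finite) v) = norm (v :: 'a::real_normed_vector ^ 'b::finite)"
proof -
  have "(\<Sum>i\<in>UNIV. (norm (vjoin (0 :: 'a ^ 'c) v $ i))\<^sup>2) = (\<Sum>i\<in>(UNIV <+> UNIV :: ('c + 'b) set). (norm (vjoin (0 :: 'a ^ 'c) v $ i))\<^sup>2)"
    by simp
  also have "\<dots> = (\<Sum>i\<in>UNIV. (norm (v $ i))\<^sup>2)" by (subst sum.Plus) auto
  finally show ?thesis by (simp add: norm_vec_def L2_set_def)
qed

lemma norm_cnj_vec [simp]: "norm (cnj_vec v) = norm v"
  by (simp add: norm_vec_def L2_set_def)

lemma linear_lift: "bounded_linear lift"
proof -
  have "linear (lift :: complex ^ ('m::finite + 'd::finite) \<Rightarrow> complex ^ ('m + 'm + 'd))"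
    by (rule linearI) (auto simp: vec_eq_sum_iff)
  then show ?thesis by (rule linear_conv_bounded_linear[THEN iffD1])
qed

lemma has_derivative_lift: "(lift has_derivative lift) (at t)"
  by (rule bounded_linear_imp_has_derivative[OF linear_lift])

lemma tendsto_lift: "(lift \<longlongrightarrow> lift t) (nhds t)"
  using linear_continuous_at[OF linear_lift, of t] by (simp add: continuous_at tendsto_nhds_iff)

text \<open>
  The determinant of \<open>\<lambda> - B\<close> is a nonzero polynomial in \<open>\<lambda>\<close>, so not every number of modulus one
  is an eigenvalue of \<open>B\<close>.
\<close>

lemma unimodular_non_eigenvalue:
  fixes B :: "complex ^ 'd::finite \<Rightarrow> complex ^ 'd"
  assumes B: "\<And>v w. B (v + w) = B v + B w" "\<And>c v. B (c *s v) = c *s B v"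
  obtains \<mu> where "norm \<mu> = 1" "\<And>e. cnj \<mu> *s e - \<mu> *s B e = 0 \<Longrightarrow> e = 0"
proof (rule ccontr)
  assume no: "\<not> thesis"
  note main = that
  interpret linear: Vector_Spaces.linear "(*s)" "(*s)" B
    by standard (use B in auto)
  have lB: "Vector_Spaces.linear (*s) (*s) B" ..
  define M where "M = matrix B"
  have M: "M *v e = B e" for e unfolding M_def by (rule matrix_works[OF lB])
  define f where "f s = det (mat s - M)" for s
  have mv: "(mat s - M) *v e = s *s e - B e" for s e
  proof -
    have "mat s *v e = s *s e"
      by (simp add: vec_eq_iff matrix_vector_mult_def mat_def if_distrib[of "\<lambda>x. x * _"] cong: if_cong)
    then show ?thesis by (simp add: matrix_vector_mult_diff_rdistrib M)
  qed
  have f0: "f s = 0 \<longleftrightarrow> (\<exists>e. e \<noteq> 0 \<and> s *s e - B e = 0)" for s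
    unfolding f_def
    by (metis mv invertible_det_nz invertible_left_inverse matrix_left_invertible_ker)
  have hol: "f holomorphic_on UNIV"
  proof -
    have "f = (\<lambda>s. \<Sum>p\<in>{p. p permutes UNIV}. of_int (sign p) * (\<Prod>i\<in>UNIV. ((if i = p i then s else 0) - M $ i $ p i)))"
      by (simp add: f_def det_def mat_def fun_eq_iff)
    moreover have "(\<lambda>s. (if i = p i then s else 0) - M $ i $ p i) holomorphic_on UNIV" for i and p :: "'d \<Rightarrow> 'd"
      by (cases "i = p i") (auto intro!: holomorphic_intros)
    ultimately show ?thesis
      by (auto intro!: holomorphic_on_sum holomorphic_on_mult holomorphic_on_const holomorphic_on_prod)
  qed
  have circ: "f s = 0" if s: "norm s = 1" for s
  proof -
    define \<mu> where "\<mu> = cnj (csqrt s)"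
    have n: "norm \<mu> = 1" using s by (simp add: \<mu>_def norm_csqrt)
    have "\<exists>e. cnj \<mu> *s e - \<mu> *s B e = 0 \<and> e \<noteq> 0" using main[OF n] no by blast
    then obtain e where e: "cnj \<mu> *s e - \<mu> *s B e = 0" "e \<noteq> 0" by blast
    have "cnj \<mu> * \<mu> = 1" using n by (simp add: complex_norm_square[symmetric] mult.commute)
    moreover have "cnj \<mu> * cnj \<mu> = s" by (simp add: \<mu>_def power2_eq_square[symmetric])
    ultimately have "s *s e - B e = cnj \<mu> *s (cnj \<mu> *s e - \<mu> *s B e)"
      by (simp add: vector_ssub_ldistrib vector_smult_assoc)
    then show ?thesis using e f0 by auto
  qed
  have "f s = 0" for s
  proof (rule analytic_continuation[OF hol open_UNIV connected_UNIV, of "sphere 0 1" 1])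
    show "1 islimpt sphere (0::complex) 1"
    proof (rule connected_imp_perfect)
      show "connected (sphere (0::complex) 1)" by (rule connected_sphere) simp
      show "\<not> sphere (0::complex) 1 = {a}" for a
        by (metis insertE mem_sphere_0 norm_minus_cancel norm_one one_neq_neg_one singletonD singletonI)
    qed simp
  qed (use circ in auto)
  moreover obtain K where K: "\<And>e. norm (B e) \<le> norm e * K" "K > 0"
  proof -
    have "linear B" by (rule linearI) (simp_all add: B scaleR_vec_complex)
    then have "bounded_linear B" by (rule linear_conv_bounded_linear[THEN iffD1])
    from bounded_linear.pos_bounded[OF this] show thesis using that by auto
  qed
  ultimately obtain e where e: "e \<noteq> 0" "of_real (K + 1) *s e - B e = 0" using f0 by blast
  have "norm (of_real (K + 1) *s e) = (K + 1) * norm e"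
  proof -
    have "of_real (K + 1) *s e = (K + 1) *\<^sub>R e" by (rule scaleR_vec_complex[symmetric])
    then show ?thesis using K by simp
  qed
  with e K(1)[of e] have "(K + 1) * norm e \<le> norm e * K" by simp
  with e show False by (simp add: algebra_simps)
qed

text \<open>
  \<open>p\<close> is a point of \<open>N\<close>, which near \<open>p\<close> is given by \<open>\<bar>w = T(\<bar>z, z, w)\<close>, and \<open>refl\<close> is the
  functional equation near the point \<open>(\<bar>z, z, w)\<close>. It says that \<open>\<sigma>\<close> is an involution.
\<close>

locale theta_point =
  fixes T :: "'d::finite \<Rightarrow> complex ^ ('m::finite + 'm + 'd) \<Rightarrow> complex"
    and \<Omega> :: "(complex ^ ('m + 'm + 'd)) set"
    and N :: "(complex ^ ('m + 'd)) set" and p :: "complex ^ ('m + 'd)"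
    and \<sigma> :: "complex ^ ('m + 'm + 'd) \<Rightarrow> complex ^ ('m + 'm + 'd)"
  assumes T: "\<And>j. mhol (T j) \<Omega>" and q: "lift p \<in> \<Omega>" and Tq: "\<And>j. T j (lift p) = cnj (p $ Inr j)"
    and \<sigma>: "\<And>X. \<sigma> X = vjoin (\<chi> k. cnj (X $ Inr (Inl k))) (vjoin (\<chi> k. cnj (X $ Inl k)) (\<chi> j. cnj (T j X)))"
    and refl: "\<forall>\<^sub>F X in nhds (lift p). \<forall>j. cnj (T j (\<sigma> X)) = X $ Inr (Inr j)"
    and N: "\<forall>\<^sub>F t in nhds p. t \<in> N \<longleftrightarrow> (\<forall>j. cnj (t $ Inr j) = T j (lift t))"
begin

definition D where "D V = (\<chi> j. cdiff (T j) (lift p) V)"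
definition S where "S V = vjoin (\<chi> k. cnj (V $ Inr (Inl k))) (vjoin (\<chi> k. cnj (V $ Inl k)) (\<chi> j. cnj (D V $ j)))"
definition B where "B e = D (vjoin 0 (vjoin 0 e))"
definition f where "f j t = cnj (t $ Inr j) - T j (lift t)"
definition df where "df j t v = cnj (v $ Inr j) - cdiff (T j) (lift t) (lift v)"

lemma D_add: "D (V + W) = D V + D W" and D_scale: "D (c *s V) = c *s D V" and D_diff: "D (V - W) = D V - D W"
  by (simp_all add: D_def vec_eq_iff cdiff_add cdiff_scale cdiff_diff)

lemma \<sigma>_fix: "\<sigma> (lift p) = lift p"
  unfolding \<sigma> by (auto simp: vec_eq_sum3_iff Tq)

lemma \<sigma>_derivative: "(\<sigma> has_derivative S) (at (lift p))"
proof (rule has_derivative_vecI)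
  fix i :: "'m + 'm + 'd"
  have c: "((\<lambda>X. cnj (g X)) has_derivative (\<lambda>V. cnj (g' V))) (at (lift p))"
    if "(g has_derivative g') (at (lift p))" for g :: "complex ^ ('m + 'm + 'd) \<Rightarrow> complex" and g'
    by (rule bounded_linear.has_derivative[OF bounded_linear_cnj that])
  have nth: "((\<lambda>X. X $ i) has_derivative (\<lambda>V. V $ i)) (at (lift p))" for i :: "'m + 'm + 'd"
    by (rule bounded_linear_imp_has_derivative[OF bounded_linear_vec_nth])
  show "((\<lambda>X. \<sigma> X $ i) has_derivative (\<lambda>V. S V $ i)) (at (lift p))"
  proof (cases i)
    case (Inl k)
    then show ?thesis unfolding \<sigma> S_def by (simp add: c nth)
  next
    case (Inr i')
    then show ?thesis unfolding \<sigma> S_def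
      by (cases i') (simp_all add: c nth D_def mhol_has_derivative[OF T q])
  qed
qed

text \<open>
  The functional equation, differentiated at the lifted point, says that the last component of
  \<open>S (S V)\<close> is that of \<open>V\<close>; for the other components this is obvious.
\<close>

lemma S_involutive: "cnj (D (S V) $ j) = V $ Inr (Inr j)"
proof -
  have 1: "((\<lambda>X. T j (\<sigma> X)) has_derivative (\<lambda>V. cdiff (T j) (lift p) (S V))) (at (lift p))"
    using has_derivative_compose[OF \<sigma>_derivative, of "T j" "cdiff (T j) (lift p)"] mhol_has_derivative[OF T q] \<sigma>_fix by simp
  have 2: "((\<lambda>X. cnj (T j (\<sigma> X)) - X $ Inr (Inr j)) has_derivative
      (\<lambda>V. cnj (cdiff (T j) (lift p) (S V)) - V $ Inr (Inr j))) (at (lift p + 0 *\<^sub>R V))"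
    using has_derivative_diff[OF bounded_linear.has_derivative[OF bounded_linear_cnj 1]
        bounded_linear_imp_has_derivative[OF bounded_linear_vec_nth]] by simp
  have "cnj (cdiff (T j) (lift p) (S V)) - V $ Inr (Inr j) = 0"
  proof (rule has_derivative_0_of_zero_curve[where \<gamma> = "\<lambda>t::real. lift p + t *\<^sub>R V", OF 2])
    show "((\<lambda>t. lift p + t *\<^sub>R V) has_vector_derivative V) (at 0)"
      by (auto intro!: derivative_eq_intros)
    have "((\<lambda>t. lift p + t *\<^sub>R V) \<longlongrightarrow> lift p + 0 *\<^sub>R V) (nhds 0)"
      by (intro tendsto_intros filterlim_ident)
    then have "((\<lambda>t. lift p + t *\<^sub>R V) \<longlongrightarrow> lift p) (nhds 0)" by simp
    from eventually_compose_filterlim[OF refl this]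
    show "\<forall>\<^sub>F t in nhds 0. cnj (T j (\<sigma> (lift p + t *\<^sub>R V))) - (lift p + t *\<^sub>R V) $ Inr (Inr j) = 0"
      by eventually_elim simp
  qed
  then show ?thesis by (simp add: D_def)
qed

lemma open_domain: "open (lift -` \<Omega>)"
  by (intro open_vimage mhol_open[OF T] linear_continuous_on[OF linear_lift])

lemma f_derivative:
  assumes "lift t \<in> \<Omega>"
  shows "(f j has_derivative df j t) (at t)"
  unfolding f_def df_def
  by (intro has_derivative_diff bounded_linear.has_derivative[OF bounded_linear_cnj]
      bounded_linear_imp_has_derivative[OF bounded_linear_vec_nth]
      has_derivative_compose[OF has_derivative_lift mhol_has_derivative[OF T assms]])

lemma B_add: "B (v + w) = B v + B w" and B_scale: "B (c *s v) = c *s B v"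
proof -
  have 1: "vjoin 0 (vjoin 0 (v + w)) = vjoin 0 (vjoin 0 v) + (vjoin 0 (vjoin 0 w) :: complex ^ ('m + 'm + 'd))"
    by (auto simp: vec_eq_sum3_iff)
  show "B (v + w) = B v + B w" unfolding B_def 1 by (rule D_add)
  have 2: "vjoin 0 (vjoin 0 (c *s v)) = c *s (vjoin 0 (vjoin 0 v) :: complex ^ ('m + 'm + 'd))"
    by (auto simp: vec_eq_sum3_iff)
  show "B (c *s v) = c *s B v" unfolding B_def 2 by (rule D_scale)
qed

definition \<mu> where "\<mu> = (SOME \<mu>. norm \<mu> = 1 \<and> (\<forall>e. cnj \<mu> *s e - \<mu> *s B e = 0 \<longrightarrow> e = 0))"

lemma \<mu>: "norm \<mu> = 1" "cnj \<mu> *s e - \<mu> *s B e = 0 \<Longrightarrow> e = 0"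
proof -
  have "\<exists>\<mu>. norm \<mu> = 1 \<and> (\<forall>e. cnj \<mu> *s e - \<mu> *s B e = 0 \<longrightarrow> e = 0)"
    using unimodular_non_eigenvalue[OF B_add B_scale] by metis
  from someI_ex[OF this] show "norm \<mu> = 1" "cnj \<mu> *s e - \<mu> *s B e = 0 \<Longrightarrow> e = 0"
    unfolding \<mu>_def[symmetric] by blast+
qed

lemma \<mu>_cnj: "\<mu> * cnj \<mu> = 1"
  using \<mu>(1) by (simp add: complex_norm_square[symmetric])

definition L where "L b = cnj \<mu> *s b - \<mu> *s B b"

lemma linear_L: "linear L"
proof (rule linearI)
  show "L (b + b') = L b + L b'" for b b' by (simp add: L_def B_add vec_eq_iff algebra_simps)
  show "L (r *\<^sub>R b) = r *\<^sub>R L b" for r b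
    unfolding L_def scaleR_vec_complex B_scale by (simp add: vec_eq_iff algebra_simps)
qed

lemma inj_L: "inj L"
  unfolding linear_injective_0[OF linear_L] using \<mu>(2) by (auto simp: L_def)

lemma re_zero_repr:
  fixes e :: "complex ^ 'd"
  assumes "\<And>j. Re (\<mu> * e $ j) = 0"
  obtains s where "e = (\<i> * cnj \<mu>) *s s" "(\<chi> j. cnj (e $ j)) = (- \<i> * \<mu>) *s s" "norm s = norm e"
proof (rule that[of "\<chi> j. complex_of_real (Im (\<mu> * e $ j))"])
  have "\<mu> * e $ j = \<i> * complex_of_real (Im (\<mu> * e $ j))" for j
    using assms[of j] by (simp add: complex_eq_iff)
  then have "cnj \<mu> * (\<mu> * e $ j) = cnj \<mu> * (\<i> * complex_of_real (Im (\<mu> * e $ j)))" for j by (rule arg_cong)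
  then have e: "e $ j = \<i> * cnj \<mu> * complex_of_real (Im (\<mu> * e $ j))" for j
    using \<mu>_cnj by (simp add: mult.assoc[symmetric] mult.commute[of "cnj \<mu>"])
  then show e': "e = (\<i> * cnj \<mu>) *s (\<chi> j. complex_of_real (Im (\<mu> * e $ j)))"
    unfolding vec_eq_iff by simp
  have "cnj (e $ j) = (- \<i> * \<mu>) * complex_of_real (Im (\<mu> * e $ j))" for j
    by (subst e) simp
  then show "(\<chi> j. cnj (e $ j)) = (- \<i> * \<mu>) *s (\<chi> j. complex_of_real (Im (\<mu> * e $ j)))"
    unfolding vec_eq_iff by simp
  have "norm (e $ j) = norm (complex_of_real (Im (\<mu> * e $ j)))" for j
    by (subst e) (simp add: norm_mult \<mu>(1))
  then show "norm (\<chi> j. complex_of_real (Im (\<mu> * e $ j))) = norm e"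
    by (simp add: norm_vec_def L2_set_def)
qed

text \<open>
  On the vectors \<open>(0, b)\<close> the functionals are the real parts of the components of \<open>L b\<close>, and \<open>L\<close> is
  onto by the choice of \<open>\<mu>\<close>.
\<close>

lemma df_independent:
  assumes "\<And>v. (\<Sum>j\<in>UNIV. a j * Re (\<mu> * df j p v)) = 0"
  shows "\<forall>j. a j = 0"
proof -
  have surj: "surj L" using linear_L inj_L linear_injective_imp_surjective by blast
  have z: "(\<Sum>j\<in>UNIV. a j * Re (L b $ j)) = 0" for b
  proof -
    define v where "v = (vjoin 0 b :: complex ^ ('m + 'd))"
    have "lift v = vjoin 0 (vjoin 0 b)" by (auto simp: v_def vec_eq_sum3_iff)
    then have "df j p v = cnj (b $ j) - B b $ j" for j
      by (simp add: df_def v_def B_def D_def)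
    moreover have "Re (\<mu> * cnj (b $ j)) = Re (cnj \<mu> * b $ j)" for j by simp
    ultimately have "Re (\<mu> * df j p v) = Re (L b $ j)" for j
      by (simp add: L_def right_diff_distrib)
    then show ?thesis using assms[of v] by simp
  qed
  show ?thesis
  proof
    fix j
    obtain b where "L b = axis j 1" using surj by (metis surjD)
    then have "(\<Sum>i\<in>UNIV. a i * Re ((axis j 1 :: complex ^ 'd) $ i)) = 0" using z by metis
    moreover have "(\<Sum>i\<in>UNIV. a i * Re ((axis j 1 :: complex ^ 'd) $ i)) = (\<Sum>i\<in>{j}. a i)"
      by (rule sum.mono_neutral_cong_right) (auto simp: axis_def)
    ultimately show "a j = 0" by simp
  qed
qed

text \<open>
  Of the \<open>2d\<close> real equations only \<open>d\<close> are kept. The functional equation gives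
  \<open>f = T(\<bar>z, z, w - \<bar>f) - T(\<bar>z, z, w)\<close>, that is, \<open>f + B \<bar>f = o(|f|)\<close>, and the kept equations
  bound \<open>f + B \<bar>f\<close> from below by a multiple of \<open>|f|\<close>.
\<close>

lemma real_equations_suffice: "\<forall>\<^sub>F t in nhds p. (\<forall>j. Re (\<mu> * f j t) = 0) \<longrightarrow> (\<forall>j. f j t = 0)"
proof -
  obtain c where c: "c > 0" "\<And>s. c * norm s \<le> norm (L s)"
    using linear_inj_bounded_below_pos[OF linear_L inj_L] by metis
  define \<epsilon> where "\<epsilon> = c / (2 * CARD('d))"
  have \<epsilon>: "\<epsilon> > 0" using c by (simp add: \<epsilon>_def)
  have "\<exists>d>0. \<forall>y\<in>ball (lift p) d. \<forall>z\<in>ball (lift p) d.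
      norm (T j y - T j z - cdiff (T j) (lift p) (y - z)) \<le> \<epsilon> * norm (y - z)" for j
    using mhol_strict_derivative[OF T q \<epsilon>, of j] by metis
  then obtain d where d: "\<And>j. d j > 0" "\<And>j y z. y \<in> ball (lift p) (d j) \<Longrightarrow> z \<in> ball (lift p) (d j) \<Longrightarrow>
      norm (T j y - T j z - cdiff (T j) (lift p) (y - z)) \<le> \<epsilon> * norm (y - z)" by metis
  have nb: "\<forall>\<^sub>F X in nhds (lift p). \<forall>j. X \<in> ball (lift p) (d j)"
    by (intro eventually_all_finite eventually_nhds_in_open) (use d in auto)
  have t\<sigma>: "(\<sigma> \<longlongrightarrow> lift p) (nhds (lift p))"
    using has_derivative_continuous[OF \<sigma>_derivative] \<sigma>_fix by (simp add: continuous_at tendsto_nhds_iff)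
  have "\<forall>\<^sub>F X in nhds (lift p). (\<forall>j. X \<in> ball (lift p) (d j)) \<and> (\<forall>j. \<sigma> X \<in> ball (lift p) (d j)) \<and>
      (\<forall>j. cnj (T j (\<sigma> X)) = X $ Inr (Inr j))"
    by (intro eventually_conj nb refl eventually_compose_filterlim[OF nb t\<sigma>])
  from eventually_compose_filterlim[OF this tendsto_lift]
  show ?thesis
  proof eventually_elim
    case (elim t)
    show ?case
    proof
      assume re: "\<forall>j. Re (\<mu> * f j t) = 0"
      define e where "e = (\<chi> j. f j t)"
      have XY: "lift t - \<sigma> (lift t) = vjoin 0 (vjoin 0 (\<chi> j. cnj (e $ j)))"
        unfolding \<sigma> e_def f_def by (auto simp: vec_eq_sum3_iff)
      have nXY: "norm (lift t - \<sigma> (lift t)) = norm e"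
        unfolding XY norm_vjoin_0 by (simp add: norm_vec_def L2_set_def)
      have est: "norm ((e + B (\<chi> j. cnj (e $ j))) $ j) \<le> \<epsilon> * norm e" for j
      proof -
        have "T j (\<sigma> (lift t)) = cnj (t $ Inr j)" using elim by (metis complex_cnj_cnj lift_nth(2))
        then have "T j (lift t) - T j (\<sigma> (lift t)) = - e $ j" by (simp add: e_def f_def)
        moreover have "cdiff (T j) (lift p) (lift t - \<sigma> (lift t)) = B (\<chi> j. cnj (e $ j)) $ j"
          unfolding XY by (simp add: B_def D_def)
        ultimately have "norm (- e $ j - B (\<chi> j. cnj (e $ j)) $ j) \<le> \<epsilon> * norm e"
          using d(2)[of "lift t" j "\<sigma> (lift t)"] elim nXY by simp
        then show ?thesis by (metis minus_add_distrib norm_minus_cancel vector_add_component diff_conv_add_uminus)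
      qed
      obtain s where s: "e = (\<i> * cnj \<mu>) *s s" "(\<chi> j. cnj (e $ j)) = (- \<i> * \<mu>) *s s" "norm s = norm e"
        using re_zero_repr[of e] re by (auto simp: e_def)
      have "e + B (\<chi> j. cnj (e $ j)) = \<i> *s L s"
        unfolding s(2) B_scale L_def by (subst s(1)) (simp add: vec_eq_iff algebra_simps)
      then have "norm (e + B (\<chi> j. cnj (e $ j))) = norm (L s)"
        by (simp add: norm_vec_def L2_set_def norm_mult)
      then have "c * norm e \<le> norm (e + B (\<chi> j. cnj (e $ j)))" using c(2)[of s] s(3) by simp
      also have "\<dots> \<le> (\<Sum>j\<in>UNIV. norm ((e + B (\<chi> j. cnj (e $ j))) $ j))"
        unfolding norm_vec_def by (rule L2_set_le_sum) simp
      also have "\<dots> \<le> (\<Sum>j\<in>(UNIV::'d set). \<epsilon> * norm e)" by (intro sum_mono est)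
      also have "\<dots> = c / 2 * norm e" by (simp add: \<epsilon>_def)
      finally have "norm e = 0" using c(1) by (simp add: field_simps)
      then show "\<forall>j. f j t = 0" by (simp add: e_def vec_eq_iff)
    qed
  qed
qed

theorem tangent_space_eq: "tangent_space N p = {v. \<forall>j. df j p v = 0}"
proof safe
  fix v j assume v: "v \<in> tangent_space N p"
  obtain U where U: "open U" "p \<in> U" "\<And>t. t \<in> U \<Longrightarrow> t \<in> N \<longleftrightarrow> (\<forall>j. cnj (t $ Inr j) = T j (lift t))"
    using N unfolding eventually_nhds by blast
  show "df j p v = 0"
    by (rule tangent_space_subset_kernel[OF v f_derivative[OF q] U(1,2)]) (use U(3) in \<open>simp add: f_def\<close>)
next
  fix v assume v: "\<forall>j. df j p v = 0"
  have "\<forall>\<^sub>F t in nhds p. ((\<forall>j. Re (\<mu> * f j t) = 0) \<longrightarrow> (\<forall>j. f j t = 0)) \<and>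
      (t \<in> N \<longleftrightarrow> (\<forall>j. cnj (t $ Inr j) = T j (lift t)))"
    by (intro eventually_conj real_equations_suffice N)
  then obtain U where U: "open U" "p \<in> U" "\<And>t. t \<in> U \<Longrightarrow> (\<forall>j. Re (\<mu> * f j t) = 0) \<Longrightarrow> t \<in> N"
    unfolding eventually_nhds by (auto simp: f_def)
  show "v \<in> tangent_space N p"
  proof (rule kernel_subset_tangent_space[where r = "\<lambda>j t. Re (\<mu> * f j t)" and D = "\<lambda>j t v. Re (\<mu> * df j t v)"
        and S = "U \<inter> lift -` \<Omega>"])
    show "open (U \<inter> lift -` \<Omega>)" "p \<in> U \<inter> lift -` \<Omega>" using U open_domain q by auto
    show "((\<lambda>t. Re (\<mu> * f j t)) has_derivative (\<lambda>v. Re (\<mu> * df j t v))) (at t)" if "t \<in> U \<inter> lift -` \<Omega>" for j t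
      by (intro bounded_linear.has_derivative[OF bounded_linear_Re] has_derivative_mult_right f_derivative) (use that in simp)
    show "continuous_on (U \<inter> lift -` \<Omega>) (\<lambda>t. Re (\<mu> * df j t v))" for j v
    proof -
      have "continuous_on (U \<inter> lift -` \<Omega>) (\<lambda>t. partial_deriv (T j) i (lift t))" for i
        by (rule continuous_on_compose2[OF mhol_continuous_on[OF mhol_partial_deriv[OF T]] linear_continuous_on[OF linear_lift]]) auto
      then show ?thesis unfolding df_def cdiff_def by (intro continuous_intros)
    qed
    show "Re (\<mu> * f j p) = 0" for j by (simp add: f_def Tq)
    show "t \<in> N" if "t \<in> U \<inter> lift -` \<Omega>" "\<And>j. Re (\<mu> * f j t) = 0" for t using U(3) that by blast
    show "\<forall>j. a j = 0" if "\<And>v. (\<Sum>j\<in>UNIV. a j * Re (\<mu> * df j p v)) = 0" for a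
      by (rule df_independent[OF that])
    show "Re (\<mu> * df j p v) = 0" for j using v by simp
  qed
qed

lemma tangent_iff: "v \<in> tangent_space N p \<longleftrightarrow> (\<forall>j. D (lift v) $ j = cnj (v $ Inr j))"
  by (auto simp: tangent_space_eq df_def D_def)

text \<open>
  \<open>V\<close> is the sum of \<open>(V + S V)/2\<close> and \<open>(V - S V)/2\<close>. The first vector and \<open>-\<i>\<close> times the second are
  fixed by the antilinear involution \<open>S\<close>, and the fixed vectors are the lifts of the tangent vectors.
\<close>

lemma lift_tangent_decomposition:
  "\<exists>u\<in>tangent_space N p. \<exists>v\<in>tangent_space N p. V = lift u + \<i> *s lift v"
proof -
  define u :: "complex ^ ('m + 'd)" where "u = (\<chi> i. ((1 / 2) *s (V + S V)) $ Inr i)"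
  define v :: "complex ^ ('m + 'd)" where "v = (\<chi> i. ((- \<i> / 2) *s (V - S V)) $ Inr i)"
  have DS: "D (S V) $ j = cnj (V $ Inr (Inr j))" for j
    using S_involutive[of V j] by (metis complex_cnj_cnj)
  have Sw: "S V $ Inr (Inr j) = cnj (D V $ j)" for j by (simp add: S_def)
  have lu: "lift u = (1 / 2) *s (V + S V)" and lv: "lift v = (- \<i> / 2) *s (V - S V)"
    unfolding u_def v_def S_def by (auto simp: vec_eq_sum3_iff)
  have "u \<in> tangent_space N p"
    unfolding tangent_iff lu by (simp add: D_scale D_add DS u_def Sw)
  moreover have "v \<in> tangent_space N p"
    unfolding tangent_iff lv by (simp add: D_scale D_diff DS v_def Sw)
  moreover have "V = lift u + \<i> *s lift v"
    unfolding lu lv by (simp add: vec_eq_iff field_simps)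
  ultimately show ?thesis by blast
qed

lemma generic_at: "{u + \<i> *s v | u v. u \<in> tangent_space N p \<and> v \<in> tangent_space N p} = UNIV"
proof (intro set_eqI iffI UNIV_I)
  fix x :: "complex ^ ('m + 'd)"
  obtain u v where uv: "u \<in> tangent_space N p" "v \<in> tangent_space N p"
    "vjoin (0 :: complex ^ 'm) x = lift u + \<i> *s lift v"
    using lift_tangent_decomposition by blast
  have "x $ i = (u + \<i> *s v) $ i" for i
    using arg_cong[OF uv(3), of "\<lambda>V. V $ Inr i"] by simp
  then have "x = u + \<i> *s v" by (simp add: vec_eq_iff)
  with uv show "x \<in> {u + \<i> *s v | u v. u \<in> tangent_space N p \<and> v \<in> tangent_space N p}" by blast
qed

text \<open>
  Tangency of \<open>\<bar>c/2\<close> and \<open>\<i>\<bar>c/2\<close> amounts to two complex linear equations, on \<open>c\<close> and on \<open>\<bar>c\<close>. The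
  second follows from the first: the vector \<open>a = (c\<^sub>z, 0, 0)\<close> is mapped by \<open>S\<close> to \<open>b = (0, \<bar>c)\<close>, and
  \<open>D (S a)\<close> is determined by the last component of \<open>a\<close>, which is zero.
\<close>

lemma tangent_space_01_iff: "c \<in> tangent_space_01 N p \<longleftrightarrow> (\<forall>j. c $ Inr j = D (vjoin (z_part c) 0) $ j)"
proof -
  define a :: "complex ^ ('m + 'm + 'd)" where "a = vjoin (z_part c) 0"
  define b :: "complex ^ ('m + 'm + 'd)" where "b = vjoin 0 (cnj_vec c)"
  have 1: "lift ((1 / 2) *s cnj_vec c) = (1 / 2) *s (a + b)"
    by (auto simp: vec_eq_sum3_iff a_def b_def)
  have 2: "lift ((\<i> / 2) *s cnj_vec c) = (\<i> / 2) *s (b - a)"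
    by (auto simp: vec_eq_sum3_iff a_def b_def)
  have half: "\<i> * x / 2 - \<i> * y / 2 = - (\<i> * z / 2) \<longleftrightarrow> x - y = - z" for x y z :: complex
  proof -
    have "\<i> * x / 2 - \<i> * y / 2 - - (\<i> * z / 2) = (\<i> / 2) * (x - y - - z)"
      by (simp add: field_simps)
    then have "\<i> * x / 2 - \<i> * y / 2 - - (\<i> * z / 2) = 0 \<longleftrightarrow> x - y - - z = 0"
      by (simp only: mult_eq_0_iff divide_eq_0_iff complex_i_not_zero) simp
    then show ?thesis by (simp only: right_minus_eq)
  qed
  have two_eqs: "x + y = z \<and> y - x = - z \<longleftrightarrow> z = x \<and> y = 0" for x y z :: complex
  proof safe
    assume "y - x = - (x + y)"
    then have "(y - x) + (x + y) = 0" by simp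
    then show "y = 0" by simp
    then show "x + y = x" by simp
  qed auto
  have "c \<in> tangent_space_01 N p \<longleftrightarrow>
      (\<forall>j. D a $ j + D b $ j = c $ Inr j) \<and> (\<forall>j. D b $ j - D a $ j = - c $ Inr j)"
    unfolding tangent_space_01_def tangent_iff mem_Collect_eq 1 2
    by (simp add: D_scale D_add D_diff half)
  also have "\<dots> \<longleftrightarrow> (\<forall>j. c $ Inr j = D a $ j) \<and> (\<forall>j. D b $ j = 0)"
    unfolding all_conj_distrib[symmetric] two_eqs ..
  also have "\<dots> \<longleftrightarrow> (\<forall>j. c $ Inr j = D a $ j)"
  proof -
    have "D b $ j = 0" if "\<forall>j. c $ Inr j = D a $ j" for j
    proof -
      have "S a = b" unfolding S_def a_def b_def
        using that by (auto simp: vec_eq_sum3_iff a_def)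
      then show ?thesis using S_involutive[of a j] by (simp add: a_def)
    qed
    then show ?thesis by blast
  qed
  finally show ?thesis by (simp add: a_def)
qed

definition Lb where "Lb k = vjoin (axis k 1) (\<chi> j. partial_deriv (T j) (Inl k) (lift p))"

lemma D_z: "D (vjoin u 0) $ j = (\<Sum>k\<in>UNIV. partial_deriv (T j) (Inl k) (lift p) * u $ k)"
proof -
  have "D (vjoin u 0) $ j = (\<Sum>i\<in>(UNIV <+> UNIV). partial_deriv (T j) i (lift p) * vjoin u 0 $ i)"
    by (simp add: D_def cdiff_def)
  also have "\<dots> = (\<Sum>k\<in>UNIV. partial_deriv (T j) (Inl k) (lift p) * u $ k)"
    by (subst sum.Plus) auto
  finally show ?thesis .
qed

lemma sum_Lb: "(\<Sum>k\<in>UNIV. a k *s Lb k) = vjoin (\<chi> k. a k) (\<chi> j. D (vjoin (\<chi> k. a k) 0) $ j)"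
  unfolding D_z by (auto simp: vec_eq_sum_iff Lb_def axis_def if_distrib[of "\<lambda>x. _ * x"] mult.commute cong: if_cong)

lemma inj_Lb: "inj Lb"
proof (rule injI)
  fix k l assume "Lb k = Lb l"
  then have "Lb k $ Inl k = Lb l $ Inl k" by simp
  then show "k = l" by (auto simp: Lb_def axis_def split: if_splits)
qed

lemma Lb_frame: "vec.independent (range Lb)" "vec.span (range Lb) = tangent_space_01 N p"
proof -
  show "vec.independent (range Lb)"
  proof (rule vec.independent_if_scalars_zero)
    fix g x assume g: "(\<Sum>x\<in>range Lb. g x *s x) = 0" and x: "x \<in> range Lb"
    then obtain k where k: "x = Lb k" by blast
    have "(\<Sum>k\<in>UNIV. g (Lb k) *s Lb k) = 0"
      using g by (subst (asm) sum.reindex[OF inj_Lb]) (simp add: o_def)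
    then have "(\<Sum>k\<in>UNIV. g (Lb k) *s Lb k) $ Inl k = 0" by simp
    then show "g x = 0" unfolding sum_Lb by (simp add: k)
  qed simp
  have "c \<in> vec.span (range Lb)" if "c \<in> tangent_space_01 N p" for c
  proof -
    have "c = (\<Sum>k\<in>UNIV. c $ Inl k *s Lb k)"
      unfolding sum_Lb using that unfolding tangent_space_01_iff
      by (auto simp: vec_eq_sum_iff z_part_def)
    then show ?thesis
      by (metis (no_types, lifting) rangeI vec.span_base vec.span_scale vec.span_sum)
  qed
  moreover have "vec.span (range Lb) \<subseteq> tangent_space_01 N p"
  proof (rule vec.span_minimal)
    show "range Lb \<subseteq> tangent_space_01 N p"
    proof safe
      fix k
      have "Lb k = (\<Sum>l\<in>UNIV. (if l = k then 1 else 0) *s Lb l)"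
        by (simp add: if_distrib[of "\<lambda>x. x *s _"] cong: if_cong)
      then show "Lb k \<in> tangent_space_01 N p"
        unfolding sum_Lb by (simp add: tangent_space_01_iff)
    qed
    show "vec.subspace (tangent_space_01 N p)"
    proof (rule vec.subspaceI)
      have zp: "z_part (x + y) = z_part x + z_part y" "z_part (c *s x) = c *s z_part x" "z_part 0 = 0"
        for x y :: "complex ^ ('m + 'd)" and c by (simp_all add: vec_eq_iff)
      show "0 \<in> tangent_space_01 N p" by (simp add: tangent_space_01_iff D_z zp)
      show "x + y \<in> tangent_space_01 N p" if "x \<in> tangent_space_01 N p" "y \<in> tangent_space_01 N p" for x y
        using that by (simp add: tangent_space_01_iff D_z zp distrib_left sum.distrib)
      show "c *s x \<in> tangent_space_01 N p" if "x \<in> tangent_space_01 N p" for c x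
        using that by (simp add: tangent_space_01_iff D_z zp sum_distrib_left mult_ac)
    qed
  qed
  ultimately show "vec.span (range Lb) = tangent_space_01 N p" by blast
qed

end

section \<open>Real power series equations\<close>

definition Re_ps :: "('k, complex) pseries \<Rightarrow> ('k, real) pseries"
  where "Re_ps c = (\<lambda>\<gamma>. Re (c \<gamma>))"

lemma converges_normally_Re_ps:
  "converges_normally (c :: ('k::finite, complex) pseries) \<rho> \<Longrightarrow> converges_normally (Re_ps c) \<rho>"
  unfolding converges_normally_iff Re_ps_def
proof safe
  fix r assume c: "\<forall>r. 0 \<le> r \<and> r < \<rho> \<longrightarrow> (\<lambda>\<gamma>. norm (c \<gamma>) * r ^ mdeg \<gamma>) summable_on UNIV" and r: "0 \<le> r" "r < \<rho>"
  have "(\<lambda>\<gamma>. norm (c \<gamma>) * r ^ mdeg \<gamma>) summable_on UNIV" using c r by blast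
  then show "(\<lambda>\<gamma>. norm (Re (c \<gamma>)) * r ^ mdeg \<gamma>) summable_on UNIV"
    by (rule summable_on_comparison_test) (use r in \<open>auto intro!: mult_right_mono abs_Re_le_cmod\<close>)
qed

lemma converges_normally_cnj_ps:
  "converges_normally (c :: ('k::finite, complex) pseries) \<rho> \<Longrightarrow> converges_normally (cnj_ps c) \<rho>"
  by (simp add: converges_normally_iff cnj_ps_def)

lemma cvec_polydisc [simp]: "cvec y \<in> polydisc \<rho> \<longleftrightarrow> y \<in> polydisc \<rho>"
  by (simp add: polydisc_def cvec_def)

lemma cnj_vec_polydisc [simp]: "cnj_vec y \<in> polydisc \<rho> \<longleftrightarrow> y \<in> polydisc \<rho>"
  by (simp add: polydisc_def)

lemma ps_sum_Re_ps:
  fixes c :: "('k::finite, complex) pseries"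
  assumes "converges_normally c \<rho>" "y \<in> polydisc \<rho>"
  shows "ps_sum (Re_ps c) y = Re (ps_sum c (cvec y))"
proof -
  have "(ps_term c (cvec y) has_sum ps_sum c (cvec y)) UNIV"
    using ps_summable assms by (metis cvec_polydisc)
  then have "((\<lambda>\<gamma>. Re (ps_term c (cvec y) \<gamma>)) has_sum Re (ps_sum c (cvec y))) UNIV"
    by (rule has_sum_Re)
  moreover have "Re (ps_term c (cvec y) \<gamma>) = ps_term (Re_ps c) y \<gamma>" for \<gamma>
  proof -
    define P where "P = (\<Prod>i\<in>UNIV. y $ i ^ \<gamma> i)"
    have "(\<Prod>i\<in>UNIV. cvec y $ i ^ \<gamma> i) = complex_of_real P"
      by (simp add: cvec_def P_def)
    then show ?thesis by (simp add: ps_term_def Re_ps_def P_def[symmetric])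
  qed
  ultimately show ?thesis unfolding ps_sum_def[of "Re_ps c"] by (simp add: infsumI)
qed

lemma ps_sum_cnj_ps: "ps_sum (cnj_ps c) x = cnj (ps_sum c (cnj_vec x))"
proof -
  have "ps_term (cnj_ps c) x = (\<lambda>\<gamma>. cnj (ps_term c (cnj_vec x) \<gamma>))"
    by (simp add: fun_eq_iff ps_term_def cnj_ps_def)
  then show ?thesis unfolding ps_sum_def by simp
qed

lemma algebraic_ps_iff_alg_at:
  "algebraic_ps c \<longleftrightarrow> convergent_ps c \<and> alg_at 0 (ps_sum c)"
  by (simp add: algebraic_ps_iff alg_at_def)

lemma cps_Re_ps:
  fixes c :: "('k::finite, complex) pseries"
  assumes "converges_normally c \<rho>" "x \<in> polydisc \<rho>"
  shows "ps_sum (cps (Re_ps c)) x = (ps_sum c x + ps_sum (cnj_ps c) x) / 2"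
proof -
  have "((\<lambda>\<gamma>. (ps_term c x \<gamma> + ps_term (cnj_ps c) x \<gamma>) * (1 / 2)) has_sum (ps_sum c x + ps_sum (cnj_ps c) x) * (1 / 2)) UNIV"
    by (intro has_sum_cmult_left has_sum_add ps_summable[OF assms] ps_summable[OF converges_normally_cnj_ps[OF assms(1)] assms(2)])
  moreover have "(ps_term c x \<gamma> + ps_term (cnj_ps c) x \<gamma>) * (1 / 2) = ps_term (cps (Re_ps c)) x \<gamma>" for \<gamma>
  proof -
    have eq: "complex_of_real (Re (c \<gamma>)) = (c \<gamma> + cnj (c \<gamma>)) / 2" by (simp add: complex_add_cnj)
    show ?thesis unfolding ps_term_def cps_def Re_ps_def cnj_ps_def eq by (simp add: field_simps)
  qed
  ultimately show ?thesis unfolding ps_sum_def[of "cps _"] by (simp add: infsumI)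
qed

text \<open>
  The series of real parts is half the sum of the series and its conjugate, both of which are
  algebraic.
\<close>

lemma algebraic_Re_ps:
  fixes c :: "('k::finite, complex) pseries"
  assumes "algebraic_ps c"
  shows "algebraic_ps (Re_ps c)"
proof (rule algebraic_ps_real_coefficients)
  obtain \<rho> where \<rho>: "\<rho> > 0" "converges_normally c \<rho>" and alg: "alg_at 0 (ps_sum c)"
    using assms by (auto simp: algebraic_ps_iff_alg_at convergent_ps_def)
  define F where "F b = (if b then ps_sum c else ps_sum (cnj_ps c))" for b
  have FH: "mhol (F b) (polydisc \<rho>)" for b
    using mhol_ps_sum[OF \<rho>(2)] mhol_ps_sum[OF converges_normally_cnj_ps[OF \<rho>(2)]] by (simp add: F_def)
  have "cnj_vec 0 = (0 :: complex ^ 'k)" by (simp add: vec_eq_iff)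
  then have "alg_at 0 (ps_sum (cnj_ps c))"
    using alg_at_cnj[of 0 "ps_sum c"] alg by (simp add: ps_sum_cnj_ps[abs_def])
  then have Fa: "alg_at 0 (F b)" for b using alg by (simp add: F_def)
  have "polyfn (\<lambda>y :: complex ^ ('k + bool). (y $ Inr True + y $ Inr False) * (1 / 2))"
    by (intro polyfn_cmult polyfn_add polyfn_coord)
  from alg_at_combination[where F = F, OF FH _ Fa this] \<rho>(1)
  have "alg_at 0 (\<lambda>x. (F True x + F False x) * (1 / 2))" by simp
  then have "alg_at 0 (\<lambda>x. (ps_sum c x + ps_sum (cnj_ps c) x) * (1 / 2))" by (simp add: F_def)
  moreover have "\<forall>\<^sub>F x in nhds 0. (ps_sum c x + ps_sum (cnj_ps c) x) * (1 / 2) = ps_sum (cps (Re_ps c)) x"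
    using eventually_nhds_in_open[OF open_polydisc, of 0 \<rho>] \<rho>
    by (auto elim!: eventually_mono simp: cps_Re_ps)
  ultimately have "alg_at 0 (ps_sum (cps (Re_ps c)))" by (rule alg_at_cong)
  then show "algebraic_ps (cps (Re_ps c))"
    using \<rho> converges_normally_Re_ps by (auto simp: algebraic_ps_iff_alg_at convergent_ps_def converges_normally_cps)
qed

lemma ps_class_Re_ps: "ps_class reg (c :: ('k::finite, complex) pseries) \<Longrightarrow> ps_class reg (Re_ps c)"
  using algebraic_Re_ps converges_normally_Re_ps
  by (auto simp: ps_class_def convergent_ps_def split: regularity.splits)

lemma real_coords_nth [simp]: "real_coords x $ Inl k = Re (x $ k)" "real_coords x $ Inr k = Im (x $ k)"
  by (simp_all add: real_coords_def)

text \<open>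
  The complexification of \<open>X \<mapsto> lift X\<close>, written in the real and imaginary parts of \<open>X\<close>.
\<close>

definition clift :: "complex ^ (('m::finite + 'd::finite) + ('m + 'd)) \<Rightarrow> complex ^ ('m + 'm + 'd)"
  where "clift Y = vjoin (\<chi> k. Y $ Inl (Inl k) - \<i> * Y $ Inr (Inl k)) (\<chi> i. Y $ Inl i + \<i> * Y $ Inr i)"

lemma clift_real_coords: "clift (cvec (real_coords X)) = lift X"
  by (auto simp: vec_eq_sum_iff clift_def cvec_def complex_eq_iff)

lemma surj_clift:
  fixes a :: "complex ^ ('m::finite + 'm + 'd::finite)"
  shows "surj (\<lambda>Y. a + clift Y)"
proof (rule surjI)
  fix V :: "complex ^ ('m + 'm + 'd)"
  let ?Y = "\<lambda>V :: complex ^ ('m + 'm + 'd). vjoin (\<chi> i. case i of Inl k \<Rightarrow> (V $ Inl k + V $ Inr (Inl k)) / 2 | Inr l \<Rightarrow> V $ Inr (Inr l))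
    (\<chi> i. case i of Inl k \<Rightarrow> (V $ Inr (Inl k) - V $ Inl k) / (2 * \<i>) | Inr l \<Rightarrow> 0)"
  show "a + clift (?Y (V - a)) = V"
    by (auto simp: vec_eq_sum3_iff clift_def field_simps)
qed

lemma polyfn_clift: "polyfn (\<lambda>Y. (a + clift Y) $ i)"
proof (cases i)
  case (Inl k)
  have "polyfn (\<lambda>Y :: complex ^ (('a + 'b) + ('a + 'b)). a $ i + (Y $ Inl (Inl k) - Y $ Inr (Inl k) * \<i>))"
    by (intro polyfn_add polyfn_const polyfn_diff polyfn_cmult polyfn_coord)
  then show ?thesis by (simp add: clift_def Inl mult.commute)
next
  case (Inr k)
  have "polyfn (\<lambda>Y :: complex ^ (('a + 'b) + ('a + 'b)). a $ i + (Y $ Inl k + Y $ Inr k * \<i>))"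
    by (intro polyfn_add polyfn_const polyfn_cmult polyfn_coord)
  then show ?thesis by (simp add: clift_def Inr mult.commute)
qed

lemma ps_class_ps_sum_at:
  assumes "ps_class reg c" "converges_normally c \<rho>" "x \<in> polydisc \<rho>"
  shows "reg = Algebraic \<Longrightarrow> alg_at x (ps_sum c)"
  using assms alg_at_continuation[OF assms(2) _ assms(3)]
  by (auto simp: ps_class_def algebraic_ps_iff_alg_at)

context theta_point
begin

text \<open>
  The function \<open>\<mu>f\<^sub>j\<close> is the restriction to the real points of a holomorphic function \<open>G\<^sub>j\<close> of the
  complexified real coordinates; the real parts of the Taylor coefficients of \<open>G\<^sub>j\<close> are those of
  \<open>Re(\<mu>f\<^sub>j)\<close>.
\<close>

lemma real_power_series_equations:
  assumes alg: "\<And>j. reg = Algebraic \<Longrightarrow> alg_at (lift p) (T j)"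
  obtains \<rho> r where "\<rho> > 0" "\<And>j. ps_class reg (r j)" "\<And>j. converges_normally (r j) \<rho>"
    "\<And>j x. real_coords (x - p) \<in> polydisc \<rho> \<Longrightarrow> ps_sum (r j) (real_coords (x - p)) = Re (\<mu> * f j x)"
proof -
  define L where "L Y = lift p + clift Y" for Y :: "complex ^ (('m + 'd) + ('m + 'd))"
  define G where "G j Y = \<mu> * (cnj (p $ Inr j) + (Y $ Inl (Inr j) - \<i> * Y $ Inr (Inr j)) - T j (L Y))"
    for j and Y :: "complex ^ (('m + 'd) + ('m + 'd))"
  have Lp: "polyfn (\<lambda>Y. L Y $ i)" for i unfolding L_def by (rule polyfn_clift)
  have Lc: "continuous_on UNIV L"
  proof -
    have "continuous_on UNIV (\<lambda>Y. \<chi> i. L Y $ i)"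
      by (intro continuous_intros mhol_continuous_on mhol_polyfn Lp)
    then show ?thesis by simp
  qed
  have L0: "L 0 = lift p" by (auto simp: L_def clift_def vec_eq_sum_iff)
  have op: "open (L -` \<Omega>)" by (rule open_vimage[OF mhol_open[OF T] Lc])
  obtain \<rho> where \<rho>: "\<rho> > 0" "polydisc \<rho> \<subseteq> L -` \<Omega>"
    using polydisc_in_nhd[OF op] q by (auto simp: L0)
  have TL: "mhol (\<lambda>Y. T j (L Y)) (L -` \<Omega>)" for j
    by (rule mhol_compose[OF T]) (auto intro: mhol_subset[OF mhol_polyfn[OF Lp] op])
  have GH: "mhol (G j) (polydisc \<rho>)" for j
    unfolding G_def
    by (intro mhol_mult mhol_diff mhol_add mhol_const mhol_component open_polydisc mhol_subset[OF TL] \<rho>)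
  have "\<exists>c. converges_normally c \<rho> \<and> (\<forall>x\<in>polydisc \<rho>. ps_sum c x = G j x)" for j
    using mhol_ps_expansion[OF GH \<rho>(1)] by metis
  then obtain c where c: "\<And>j. converges_normally (c j) \<rho>" "\<And>j x. x \<in> polydisc \<rho> \<Longrightarrow> ps_sum (c j) x = G j x"
    by metis
  have cl: "ps_class reg (c j)" for j
  proof (cases reg)
    case Analytic
    then show ?thesis using c(1) \<rho>(1) by (auto simp: ps_class_def convergent_ps_def)
  next
    case Algebraic
    have sL: "surj L" unfolding L_def by (rule surj_clift)
    have a: "alg_at 0 (\<lambda>Y. T j (L Y))" for j
    proof (rule alg_at_compose_surj[OF _ Lp sL])
      show "alg_at (L 0) (T j)" unfolding L0 by (rule alg[OF Algebraic])
    qed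
    define Q :: "complex ^ ((('m + 'd) + ('m + 'd)) + 'd) \<Rightarrow> complex" where
      "Q y = ((cnj (p $ Inr j) + (y $ Inl (Inl (Inr j)) - y $ Inl (Inr (Inr j)) * \<i>)) - y $ Inr j) * \<mu>" for y
    have "polyfn Q" unfolding Q_def
      by (intro polyfn_cmult polyfn_diff polyfn_add polyfn_const polyfn_coord)
    from alg_at_combination[OF TL _ a this] have "alg_at 0 (\<lambda>Y. Q (vjoin Y (\<chi> j. T j (L Y))))"
      using q by (simp add: L0)
    moreover have "\<forall>\<^sub>F Y in nhds 0. Q (vjoin Y (\<chi> j. T j (L Y))) = ps_sum (c j) Y"
      using eventually_nhds_in_open[OF open_polydisc, of 0 \<rho>] \<rho>(1)
      by (auto elim!: eventually_mono simp: c(2) Q_def G_def mult_ac)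
    ultimately have "alg_at 0 (ps_sum (c j))" by (rule alg_at_cong)
    then show ?thesis using Algebraic c(1) \<rho>(1)
      by (auto simp: ps_class_def algebraic_ps_iff_alg_at convergent_ps_def)
  qed
  show thesis
  proof (rule that[of \<rho> "\<lambda>j. Re_ps (c j)"])
    show "ps_class reg (Re_ps (c j))" for j by (rule ps_class_Re_ps[OF cl])
    show "converges_normally (Re_ps (c j)) \<rho>" for j by (rule converges_normally_Re_ps[OF c(1)])
    fix j x assume x: "real_coords (x - p) \<in> polydisc \<rho>"
    have "L (cvec (real_coords (x - p))) = lift x"
      unfolding L_def clift_real_coords by (auto simp: vec_eq_sum_iff)
    moreover have "cvec (real_coords (x - p)) $ Inl (Inr j) - \<i> * cvec (real_coords (x - p)) $ Inr (Inr j)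
        = cnj (x $ Inr j) - cnj (p $ Inr j)"
      by (simp add: cvec_def complex_eq_iff)
    ultimately have "G j (cvec (real_coords (x - p))) = \<mu> * f j x"
      by (simp add: G_def f_def)
    then show "ps_sum (Re_ps (c j)) (real_coords (x - p)) = Re (\<mu> * f j x)"
      using ps_sum_Re_ps[OF c(1) x] c(2)[of "cvec (real_coords (x - p))"] x by simp
  qed (rule \<rho>)
qed

lemma real_coords_polydisc_nhd:
  assumes "\<rho> > 0"
  shows "\<forall>\<^sub>F x in nhds p. real_coords (x - p) \<in> polydisc \<rho>"
proof -
  have "open {x. real_coords (x - p) \<in> polydisc \<rho>}"
  proof -
    have "continuous_on UNIV (\<lambda>x. real_coords (x - p))"
    proof -
      have "continuous_on UNIV (\<lambda>x. case i of Inl k \<Rightarrow> Re ((x - p) $ k) | Inr k \<Rightarrow> Im ((x - p) $ k))" for i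
        by (cases i) (auto intro!: continuous_intros)
      then show ?thesis unfolding real_coords_def by (intro continuous_intros)
    qed
    from open_vimage[OF open_polydisc this] show ?thesis by (simp add: vimage_def)
  qed
  from eventually_nhds_in_open[OF this, of p] assms show ?thesis
    by (simp add: polydisc_def real_coords_def split: sum.split)
qed

lemma real_submanifold_at:
  assumes alg: "\<And>j. reg = Algebraic \<Longrightarrow> alg_at (lift p) (T j)"
  shows "\<exists>\<rho>>0. \<exists>r :: nat \<Rightarrow> (('m + 'd) + ('m + 'd), real) pseries.
       (\<forall>j<CARD('d). ps_class reg (r j) \<and> converges_normally (r j) \<rho>) \<and>
       (\<forall>a :: nat \<Rightarrow> real.
          (\<forall>v. (\<Sum>j<CARD('d). a j * frechet_derivative (\<lambda>x. ps_sum (r j) (real_coords (x - p))) (at p) v) = 0)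
          \<longrightarrow> (\<forall>j<CARD('d). a j = 0)) \<and>
       (\<forall>x. real_coords (x - p) \<in> polydisc \<rho> \<longrightarrow>
          (x \<in> N \<longleftrightarrow> (\<forall>j<CARD('d). ps_sum (r j) (real_coords (x - p)) = 0)))"
proof -
  obtain \<rho>0 r where r: "\<rho>0 > 0" "\<And>j. ps_class reg (r j)" "\<And>j. converges_normally (r j) \<rho>0"
    "\<And>j x. real_coords (x - p) \<in> polydisc \<rho>0 \<Longrightarrow> ps_sum (r j) (real_coords (x - p)) = Re (\<mu> * f j x)"
    by (rule real_power_series_equations[where reg = reg]) (use alg in auto)
  have "\<forall>\<^sub>F t in nhds p. ((\<forall>j. Re (\<mu> * f j t) = 0) \<longrightarrow> (\<forall>j. f j t = 0)) \<and>
      (t \<in> N \<longleftrightarrow> (\<forall>j. cnj (t $ Inr j) = T j (lift t)))"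
    by (intro eventually_conj real_equations_suffice N)
  then have "\<forall>\<^sub>F t in nhds p. t \<in> N \<longleftrightarrow> (\<forall>j. Re (\<mu> * f j t) = 0)"
  proof eventually_elim
    case (elim t)
    have "f j t = 0 \<longleftrightarrow> cnj (t $ Inr j) = T j (lift t)" for j by (simp add: f_def)
    with elim show ?case by (metis mult_zero_right zero_complex.sel(1))
  qed
  then obtain e where e: "e > 0" "\<And>t. dist t p < e \<Longrightarrow> t \<in> N \<longleftrightarrow> (\<forall>j. Re (\<mu> * f j t) = 0)"
    unfolding eventually_nhds_metric by blast
  define K where "K = real CARD('m + 'd)"
  have K: "K > 0" unfolding K_def of_nat_0_less_iff by (rule zero_less_card_finite)
  define \<rho> where "\<rho> = min \<rho>0 (e / (2 * K))"
  have \<rho>: "\<rho> > 0" "\<rho> \<le> \<rho>0" using r(1) e(1) K by (auto simp: \<rho>_def)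
  have near: "dist x p < e" if x: "real_coords (x - p) \<in> polydisc \<rho>" for x
  proof -
    have "norm ((x - p) $ i) < 2 * \<rho>" for i
    proof -
      have "\<bar>Re ((x - p) $ i)\<bar> < \<rho>" "\<bar>Im ((x - p) $ i)\<bar> < \<rho>"
        using x unfolding polydisc_def by (auto dest: spec[of _ "Inl i"] spec[of _ "Inr i"])
      then show ?thesis using cmod_le[of "(x - p) $ i"] by linarith
    qed
    then have "(\<Sum>i\<in>UNIV. norm ((x - p) $ i)) < (\<Sum>i\<in>(UNIV :: ('m + 'd) set). 2 * \<rho>)"
      by (intro sum_strict_mono) auto
    also have "\<dots> = K * (2 * \<rho>)" by (simp add: K_def)
    also have "\<dots> \<le> K * (2 * (e / (2 * K)))"
      using K by (intro mult_left_mono) (auto simp: \<rho>_def)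
    also have "\<dots> = e" using K by simp
    finally have "(\<Sum>i\<in>UNIV. norm ((x - p) $ i)) < e" .
    moreover have "norm (x - p) \<le> (\<Sum>i\<in>UNIV. norm ((x - p) $ i))"
      unfolding norm_vec_def by (rule L2_set_le_sum) simp
    ultimately show ?thesis by (simp add: dist_norm)
  qed
  obtain h :: "nat \<Rightarrow> 'd" where h: "bij_betw h {..<CARD('d)} UNIV"
    using ex_bij_betw_nat_finite[of "UNIV :: 'd set"] by (auto simp: atLeast0LessThan)
  have all_h: "(\<forall>j<CARD('d). P (h j)) \<longleftrightarrow> (\<forall>i. P i)" for P
    using bij_betw_imp_surj_on[OF h] by (metis UNIV_I imageE imageI lessThan_iff)
  have fd: "frechet_derivative (\<lambda>x. ps_sum (r j) (real_coords (x - p))) (at p) = (\<lambda>v. Re (\<mu> * df j p v))" for j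
  proof -
    have "((\<lambda>x. Re (\<mu> * f j x)) has_derivative (\<lambda>v. Re (\<mu> * df j p v))) (at p)"
      by (intro bounded_linear.has_derivative[OF bounded_linear_Re] has_derivative_mult_right f_derivative q)
    moreover have ev: "\<forall>\<^sub>F x in nhds p. Re (\<mu> * f j x) = ps_sum (r j) (real_coords (x - p))"
      using real_coords_polydisc_nhd[OF r(1)] by eventually_elim (simp add: r(4))
    have "((\<lambda>x. ps_sum (r j) (real_coords (x - p))) has_derivative (\<lambda>v. Re (\<mu> * df j p v))) (at p)"
      by (rule has_derivative_transform_eventually[OF calculation])
        (use ev eventually_nhds_x_imp_x[OF ev] in \<open>auto simp: eventually_at_filter elim: eventually_mono\<close>)
    then show ?thesis by (rule frechet_derivative_at[symmetric])
  qed
  show ?thesis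
  proof (intro exI[of _ \<rho>] exI[of _ "\<lambda>j. r (h j)"] conjI allI impI)
    show "\<rho> > 0" by (rule \<rho>)
    show "ps_class reg (r (h j))" "converges_normally (r (h j)) \<rho>" for j
      using r(2,3) converges_normally_mono \<rho>(2) by blast+
  next
    fix a :: "nat \<Rightarrow> real" and j
    assume z: "\<forall>v. (\<Sum>j<CARD('d). a j * frechet_derivative (\<lambda>x. ps_sum (r (h j)) (real_coords (x - p))) (at p) v) = 0"
      and j: "j < CARD('d)"
    define b where "b i = a (the_inv_into {..<CARD('d)} h i)" for i
    have ba: "b (h j) = a j" if "j < CARD('d)" for j
      unfolding b_def using h that by (simp add: bij_betw_def the_inv_into_f_f)
    have "(\<Sum>i\<in>UNIV. b i * Re (\<mu> * df i p v)) = (\<Sum>j<CARD('d). b (h j) * Re (\<mu> * df (h j) p v))" for v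
      using sum.reindex_bij_betw[OF h, of "\<lambda>i. b i * Re (\<mu> * df i p v)"] by simp
    then have "(\<Sum>i\<in>UNIV. b i * Re (\<mu> * df i p v)) = 0" for v
      using z by (simp add: fd ba)
    then have "\<forall>i. b i = 0" by (rule df_independent)
    then show "a j = 0" using ba[OF j] by simp
  next
    fix x assume x: "real_coords (x - p) \<in> polydisc \<rho>"
    then have x0: "real_coords (x - p) \<in> polydisc \<rho>0" using polydisc_mono[OF \<rho>(2)] by blast
    show "x \<in> N \<longleftrightarrow> (\<forall>j<CARD('d). ps_sum (r (h j)) (real_coords (x - p)) = 0)"
      unfolding e(2)[OF near[OF x]] r(4)[OF x0] by (rule all_h[symmetric])
  qed
qed

end

section \<open>From the functional equations to generic submanifolds\<close>

definition theta_refl :: "('m::finite, 'd::finite) theta \<Rightarrow> complex ^ ('m + 'm + 'd) \<Rightarrow> complex ^ ('m + 'm + 'd)"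
  where "theta_refl \<Theta> X = vjoin (\<chi> k. cnj (X $ Inr (Inl k)))
    (vjoin (\<chi> k. cnj (X $ Inl k)) (\<chi> j. cnj (ps_sum (\<Theta> j) X)))"

abbreviation theta_pt :: "real \<Rightarrow> ('m::finite, 'd::finite) theta \<Rightarrow> (complex ^ ('m + 'd)) set \<Rightarrow> complex ^ ('m + 'd) \<Rightarrow> bool"
  where "theta_pt \<rho> \<Theta> N p \<equiv> theta_point (\<lambda>j. ps_sum (\<Theta> j)) (polydisc (2 * \<rho>)) N p (theta_refl \<Theta>)"

lemma generic_and_basis_of_points:
  fixes \<Theta> :: "('m::finite, 'd::finite) theta"
  assumes adm: "admissible_theta reg \<rho> \<Theta>" and pts: "\<And>p. p \<in> N \<Longrightarrow> theta_pt \<rho> \<Theta> N p"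
  shows "generic_submanifold reg CARD('d) N \<and> L_bar_basis \<Theta> N"
proof
  have sub: "real_submanifold reg CARD('d) N"
    unfolding real_submanifold_def
  proof
    fix p assume "p \<in> N"
    then interpret theta_point "\<lambda>j. ps_sum (\<Theta> j)" "polydisc (2 * \<rho>)" N p "theta_refl \<Theta>" by (rule pts)
    show "\<exists>\<rho>>0. \<exists>r :: nat \<Rightarrow> (('m + 'd) + ('m + 'd), real) pseries.
       (\<forall>j<CARD('d). ps_class reg (r j) \<and> converges_normally (r j) \<rho>) \<and>
       (\<forall>a :: nat \<Rightarrow> real.
          (\<forall>v. (\<Sum>j<CARD('d). a j * frechet_derivative (\<lambda>x. ps_sum (r j) (real_coords (x - p))) (at p) v) = 0)
          \<longrightarrow> (\<forall>j<CARD('d). a j = 0)) \<and>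
       (\<forall>x. real_coords (x - p) \<in> polydisc \<rho> \<longrightarrow>
          (x \<in> N \<longleftrightarrow> (\<forall>j<CARD('d). ps_sum (r j) (real_coords (x - p)) = 0)))"
    proof (rule real_submanifold_at)
      fix j assume "reg = Algebraic"
      with adm q show "alg_at (lift p) (ps_sum (\<Theta> j))"
        unfolding admissible_theta_def using ps_class_ps_sum_at by blast
    qed
  qed
  show "generic_submanifold reg CARD('d) N"
    unfolding generic_submanifold_def
  proof (intro conjI sub ballI)
    fix p assume "p \<in> N"
    then interpret theta_point "\<lambda>j. ps_sum (\<Theta> j)" "polydisc (2 * \<rho>)" N p "theta_refl \<Theta>" by (rule pts)
    show "{u + \<i> *s v | u v. u \<in> tangent_space N p \<and> v \<in> tangent_space N p} = UNIV" by (rule generic_at)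
  qed
  show "L_bar_basis \<Theta> N"
    unfolding L_bar_basis_def
  proof (intro allI impI)
    fix z :: "complex ^ 'm" and w :: "complex ^ 'd"
    assume "vjoin z w \<in> N"
    then interpret theta_point "\<lambda>j. ps_sum (\<Theta> j)" "polydisc (2 * \<rho>)" N "vjoin z w" "theta_refl \<Theta>" by (rule pts)
    have "L_bar \<Theta> k z w = Lb k" for k by (simp add: L_bar_def Lb_def lift_def)
    then show "inj (\<lambda>k. L_bar \<Theta> k z w) \<and> vec.independent (range (\<lambda>k. L_bar \<Theta> k z w)) \<and>
       vec.span (range (\<lambda>k. L_bar \<Theta> k z w)) = tangent_space_01 N (vjoin z w)"
      using inj_Lb Lb_frame by simp
  qed
qed

lemma theta_set_iff: "t \<in> theta_set \<rho> \<Theta> \<longleftrightarrow> t \<in> polydisc \<rho> \<and> (\<forall>j. cnj (t $ Inr j) = ps_sum (\<Theta> j) (lift t))"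
proof -
  have "t \<in> theta_set \<rho> \<Theta> \<longleftrightarrow> t \<in> polydisc \<rho> \<and> cnj_vec (w_part t) = theta_map \<Theta> (cnj_vec (z_part t)) (z_part t) (w_part t)"
    unfolding theta_set_def by (auto, metis vjoin_parts)
  also have "\<dots> \<longleftrightarrow> t \<in> polydisc \<rho> \<and> (\<forall>j. cnj (t $ Inr j) = ps_sum (\<Theta> j) (lift t))"
    by (simp add: vec_eq_iff theta_map_def lift_def)
  finally show ?thesis .
qed

lemma cnj_vec_vjoin: "cnj_vec (vjoin x y) = vjoin (cnj_vec x) (cnj_vec y)"
  by (auto simp: vec_eq_sum_iff)

lemma theta_map_cnj:
  "theta_map (cnj_theta \<Theta>) z \<zeta> \<omega> = cnj_vec (theta_map \<Theta> (cnj_vec z) (cnj_vec \<zeta>) (cnj_vec \<omega>))"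
  by (simp add: vec_eq_iff theta_map_def cnj_theta_def ps_sum_cnj_ps cnj_vec_vjoin)

lemma cnj_theta_set_eq: "cnj_theta_set \<rho> \<Theta> = theta_set \<rho> \<Theta>"
proof -
  have "w = cnj_vec x \<longleftrightarrow> cnj_vec w = x" for w x :: "complex ^ 'b"
    by (metis cnj_vec_cnj_vec)
  then show ?thesis unfolding cnj_theta_set_def theta_set_def theta_map_cnj by simp
qed

lemma theta_refl_equation:
  fixes \<Theta> :: "('m::finite, 'd::finite) theta"
  shows "w = theta_map (cnj_theta \<Theta>) z \<zeta> (theta_map \<Theta> \<zeta> z w) \<longleftrightarrow>
    (\<forall>j. cnj (ps_sum (\<Theta> j) (theta_refl \<Theta> (vjoin \<zeta> (vjoin z w)))) = w $ j)"
proof -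
  have "vjoin (cnj_vec z) (vjoin (cnj_vec \<zeta>) (cnj_vec (theta_map \<Theta> \<zeta> z w))) = theta_refl \<Theta> (vjoin \<zeta> (vjoin z w))"
    by (auto simp: vec_eq_sum3_iff theta_refl_def theta_map_def)
  then have "theta_map (cnj_theta \<Theta>) z \<zeta> (theta_map \<Theta> \<zeta> z w) $ j
      = cnj (ps_sum (\<Theta> j) (theta_refl \<Theta> (vjoin \<zeta> (vjoin z w))))" for j
    unfolding theta_map_cnj by (simp add: theta_map_def)
  then show ?thesis unfolding vec_eq_iff by auto
qed

lemma lift_in_polydisc [simp]: "lift p \<in> polydisc \<rho> \<longleftrightarrow> p \<in> polydisc \<rho>"
proof -
  have "(\<forall>i. norm (lift p $ i) < \<rho>) \<longleftrightarrow> (\<forall>i. norm (p $ i) < \<rho>)"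
  proof (intro iffI allI)
    fix i assume "\<forall>i. norm (lift p $ i) < \<rho>"
    from this[rule_format, of "Inr i"] show "norm (p $ i) < \<rho>" by simp
  next
    fix i assume "\<forall>i. norm (p $ i) < \<rho>"
    then show "norm (lift p $ i) < \<rho>" by (cases i) auto
  qed
  then show ?thesis by (simp add: polydisc_def)
qed

lemma theta_ptI:
  fixes \<Theta> :: "('m::finite, 'd::finite) theta"
  assumes adm: "admissible_theta reg \<rho> \<Theta>" and p: "p \<in> theta_set \<rho> \<Theta>"
    and N: "\<forall>\<^sub>F t in nhds p. t \<in> N \<longleftrightarrow> t \<in> theta_set \<rho> \<Theta>"
    and refl: "\<forall>\<^sub>F X in nhds (lift p). \<forall>j. cnj (ps_sum (\<Theta> j) (theta_refl \<Theta> X)) = X $ Inr (Inr j)"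
  shows "theta_pt \<rho> \<Theta> N p"
proof
  show "mhol (ps_sum (\<Theta> j)) (polydisc (2 * \<rho>))" for j
    using adm by (auto simp: admissible_theta_def intro: mhol_ps_sum)
  have pr: "p \<in> polydisc \<rho>" and Tp: "\<And>j. cnj (p $ Inr j) = ps_sum (\<Theta> j) (lift p)" using p by (auto simp: theta_set_iff)
  show "ps_sum (\<Theta> j) (lift p) = cnj (p $ Inr j)" for j using Tp by simp
  show "lift p \<in> polydisc (2 * \<rho>)"
  proof -
    obtain r where "0 \<le> r" "r < \<rho>" using polydisc_radius[OF pr] by blast
    then have "\<rho> \<le> 2 * \<rho>" by simp
    from subsetD[OF polydisc_mono[OF this]] pr show ?thesis by simp
  qed
  show "theta_refl \<Theta> X = vjoin (\<chi> k. cnj (X $ Inr (Inl k))) (vjoin (\<chi> k. cnj (X $ Inl k)) (\<chi> j. cnj (ps_sum (\<Theta> j) X)))" for X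
    by (rule theta_refl_def)
  show "\<forall>\<^sub>F X in nhds (lift p). \<forall>j. cnj (ps_sum (\<Theta> j) (theta_refl \<Theta> X)) = X $ Inr (Inr j)" by (rule refl)
  show "\<forall>\<^sub>F t in nhds p. t \<in> N \<longleftrightarrow> (\<forall>j. cnj (t $ Inr j) = ps_sum (\<Theta> j) (lift t))"
    using N eventually_nhds_in_open[OF open_polydisc pr] by eventually_elim (simp add: theta_set_iff)
qed

lemma vjoin3_parts:
  fixes X :: "'a ^ ('m::finite + 'm + 'd::finite)"
  shows "vjoin (z_part X) (vjoin (z_part (w_part X)) (w_part (w_part X))) = X"
  by simp

text \<open>
  At a point of \<open>theta_set\<close> the value of \<open>\<Theta>\<close> is \<open>\<bar>w\<close>, which lies strictly inside the polydisc. By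
  continuity the composition in the functional equation is defined near that point.
\<close>

lemma functional_equations_on_refl:
  fixes \<Theta> :: "('m::finite, 'd::finite) theta"
  assumes adm: "admissible_theta reg \<rho> \<Theta>" and \<rho>: "\<rho> > 0" and fe: "functional_equations_on (2 * \<rho>) \<Theta>"
    and p: "p \<in> theta_set \<rho> \<Theta>"
  shows "\<forall>\<^sub>F X in nhds (lift p). \<forall>j. cnj (ps_sum (\<Theta> j) (theta_refl \<Theta> X)) = X $ Inr (Inr j)"
proof -
  have conv: "converges_normally (\<Theta> j) (2 * \<rho>)" for j using adm by (simp add: admissible_theta_def)
  have pr: "p \<in> polydisc \<rho>" and Tp: "\<And>j. cnj (p $ Inr j) = ps_sum (\<Theta> j) (lift p)" using p by (auto simp: theta_set_iff)
  have lp: "lift p \<in> polydisc (2 * \<rho>)"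
    using pr polydisc_mono[of \<rho> "2 * \<rho>"] \<rho> by auto
  have "\<forall>\<^sub>F X in nhds (lift p). norm (ps_sum (\<Theta> j) X) < 2 * \<rho>" for j
  proof -
    have "isCont (ps_sum (\<Theta> j)) (lift p)"
      using mhol_continuous_on[OF mhol_ps_sum[OF conv]] lp open_polydisc continuous_on_eq_continuous_at by blast
    then have "((\<lambda>X. norm (ps_sum (\<Theta> j) X)) \<longlongrightarrow> norm (ps_sum (\<Theta> j) (lift p))) (nhds (lift p))"
      by (intro tendsto_norm) (simp add: continuous_at tendsto_nhds_iff)
    moreover have "norm (ps_sum (\<Theta> j) (lift p)) < 2 * \<rho>"
    proof -
      have "norm (p $ Inr j) < \<rho>" using pr by (auto simp: polydisc_def)
      then show ?thesis using \<rho> by (simp add: Tp[symmetric])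
    qed
    ultimately show ?thesis by (rule order_tendstoD(2))
  qed
  then have "\<forall>\<^sub>F X in nhds (lift p). \<forall>j. norm (ps_sum (\<Theta> j) X) < 2 * \<rho>" by (rule eventually_all_finite)
  with eventually_nhds_in_open[OF open_polydisc lp] show ?thesis
  proof eventually_elim
    case (elim X)
    let ?\<zeta> = "z_part X" and ?z = "z_part (w_part X)" and ?w = "w_part (w_part X)"
    have "vjoin ?\<zeta> (vjoin ?z ?w) \<in> polydisc (2 * \<rho>)" using elim by simp
    moreover have "theta_map \<Theta> ?\<zeta> ?z ?w \<in> polydisc (2 * \<rho>)" using elim by (simp add: polydisc_def theta_map_def)
    ultimately have "?w = theta_map (cnj_theta \<Theta>) ?z ?\<zeta> (theta_map \<Theta> ?\<zeta> ?z ?w)"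
      using fe unfolding functional_equations_on_def by blast
    then show ?case unfolding theta_refl_equation by simp
  qed
qed

lemma tendsto_parts: "((\<lambda>X. (z_part X, z_part (w_part X), w_part (w_part X))) \<longlongrightarrow> (0, 0, 0)) (nhds (0 :: complex ^ ('m::finite + 'm + 'd::finite)))"
proof -
  have nth: "((\<lambda>X. X $ i) \<longlongrightarrow> 0) (nhds (0 :: complex ^ ('m + 'm + 'd)))" for i
    by (rule tendsto_eq_rhs[OF tendsto_vec_nth[OF filterlim_ident]]) simp
  have "((\<lambda>X. z_part X) \<longlongrightarrow> 0) (nhds (0 :: complex ^ ('m + 'm + 'd)))"
    "((\<lambda>X. z_part (w_part X)) \<longlongrightarrow> 0) (nhds (0 :: complex ^ ('m + 'm + 'd)))"
    "((\<lambda>X. w_part (w_part X)) \<longlongrightarrow> 0) (nhds (0 :: complex ^ ('m + 'm + 'd)))"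
    by (rule vec_tendstoI, simp add: nth)+
  then show ?thesis by (intro tendsto_Pair)
qed

lemma functional_equations_refl:
  fixes \<Theta> :: "('m::finite, 'd::finite) theta"
  assumes "functional_equations \<Theta>"
  shows "\<forall>\<^sub>F X in nhds 0. \<forall>j. cnj (ps_sum (\<Theta> j) (theta_refl \<Theta> X)) = X $ Inr (Inr j)"
proof -
  have fe: "\<forall>\<^sub>F (\<zeta>, z, w) in nhds (0, 0, 0). w = theta_map (cnj_theta \<Theta>) z \<zeta> (theta_map \<Theta> \<zeta> z w)"
    using assms by (simp add: functional_equations_def zero_prod_def)
  from eventually_compose_filterlim[OF fe tendsto_parts]
  show ?thesis unfolding theta_refl_equation case_prod_conv by (simp add: vjoin3_parts del: vjoin_parts)
qed

theorem converse_direction: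
  fixes \<Theta> :: "('m::finite, 'd::finite) theta"
  assumes adm: "admissible_theta reg \<rho> \<Theta>" and \<rho>: "\<rho> > 0" and fe: "functional_equations_on (2 * \<rho>) \<Theta>"
  shows "generic_submanifold reg CARD('d) (theta_set \<rho> \<Theta>) \<and> L_bar_basis \<Theta> (theta_set \<rho> \<Theta>)"
  by (rule generic_and_basis_of_points[OF adm], rule theta_ptI[OF adm])
    (auto intro: functional_equations_on_refl[OF adm \<rho> fe])

theorem converse_direction_germ:
  fixes \<Theta> :: "('m::finite, 'd::finite) theta"
  assumes adm: "admissible_theta reg \<rho>1 \<Theta>" and \<rho>1: "\<rho>1 > 0" and fe: "functional_equations \<Theta>"
  shows "\<exists>\<rho>>0. \<rho> \<le> \<rho>1 \<and> generic_submanifold reg CARD('d) (theta_set \<rho>1 \<Theta> \<inter> polydisc \<rho>) \<and>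
    L_bar_basis \<Theta> (theta_set \<rho>1 \<Theta> \<inter> polydisc \<rho>)"
proof -
  obtain W where W: "open W" "0 \<in> W" "\<And>X j. X \<in> W \<Longrightarrow> cnj (ps_sum (\<Theta> j) (theta_refl \<Theta> X)) = X $ Inr (Inr j)"
    using functional_equations_refl[OF fe] unfolding eventually_nhds by blast
  obtain e where e: "e > 0" "polydisc e \<subseteq> W" using polydisc_in_nhd[OF W(1,2)] by blast
  define \<rho> where "\<rho> = min e \<rho>1"
  have "generic_submanifold reg CARD('d) (theta_set \<rho>1 \<Theta> \<inter> polydisc \<rho>) \<and> L_bar_basis \<Theta> (theta_set \<rho>1 \<Theta> \<inter> polydisc \<rho>)"
  proof (rule generic_and_basis_of_points[OF adm])
    fix p assume p: "p \<in> theta_set \<rho>1 \<Theta> \<inter> polydisc \<rho>"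
    show "theta_pt \<rho>1 \<Theta> (theta_set \<rho>1 \<Theta> \<inter> polydisc \<rho>) p"
    proof (rule theta_ptI[OF adm])
      show "p \<in> theta_set \<rho>1 \<Theta>" using p by simp
      show "\<forall>\<^sub>F t in nhds p. (t \<in> theta_set \<rho>1 \<Theta> \<inter> polydisc \<rho>) = (t \<in> theta_set \<rho>1 \<Theta>)"
        using eventually_nhds_in_open[OF open_polydisc, of p \<rho>] p by (auto elim: eventually_mono)
      have "p \<in> polydisc e" using p polydisc_mono[of \<rho> e] by (auto simp: \<rho>_def)
      then have "lift p \<in> W" using e(2) lift_in_polydisc by blast
      then show "\<forall>\<^sub>F X in nhds (lift p). \<forall>j. cnj (ps_sum (\<Theta> j) (theta_refl \<Theta> X)) = X $ Inr (Inr j)"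
        unfolding eventually_nhds using W by blast
    qed
  qed
  then show ?thesis using e(1) \<rho>1 by (intro exI[of _ \<rho>]) (auto simp: \<rho>_def)
qed

lemma alg_at_polyfn:
  fixes f :: "complex ^ 'k::finite \<Rightarrow> complex"
  assumes "polyfn f"
  shows "alg_at x0 f"
proof -
  define p where "p y = y $ None - f (\<chi> k. y $ Some k)" for y
  have "polyfn p" unfolding p_def
    by (intro polyfn_diff polyfn_coord polyfn_compose[OF assms]) (simp add: polyfn_coord)
  moreover have "p (snoc_vec 0 (f 0 + 1)) \<noteq> 0"
  proof -
    have "(\<chi> k. 0) = (0 :: complex ^ 'k)" by (simp add: vec_eq_iff)
    then show ?thesis by (simp add: p_def)
  qed
  moreover have "p (snoc_vec x (f x)) = 0" for x
  proof -
    have "(\<chi> k. snoc_vec x (f x) $ Some k) = x" by (simp add: vec_eq_iff)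
    then show ?thesis by (simp add: p_def)
  qed
  ultimately show ?thesis unfolding alg_at_def algdep_def by (auto intro!: exI[of _ p])
qed

lemma polyfn_linear:
  fixes L :: "complex ^ 'k::finite \<Rightarrow> complex ^ 'l::finite"
  assumes "Vector_Spaces.linear (*s) (*s) L"
  shows "polyfn (\<lambda>x. L x $ i)"
proof -
  have "L x = matrix L *v x" for x by (rule matrix_works[OF assms, symmetric])
  then have "L x $ i = (\<Sum>j\<in>UNIV. x $ j * matrix L $ i $ j)" for x
    by (simp only: matrix_vector_mult_def vec_lambda_beta mult.commute)
  then show ?thesis by (simp add: polyfn_sum polyfn_cmult polyfn_coord)
qed

section \<open>Uniqueness of \<open>\<Theta>\<close>\<close>

text \<open>
  The differential of such an \<open>f\<close> is complex linear and kills the lifts of the tangent vectors of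
  \<open>N\<close>, which span everything over the complex numbers.
\<close>

lemma theta_point_partial_deriv_0:
  assumes pt: "theta_point T \<Omega> N p \<sigma>" and f: "mhol f S" "lift p \<in> S"
    and z: "\<forall>\<^sub>F t in nhds p. t \<in> N \<longrightarrow> f (lift t) = 0"
  shows "partial_deriv f i (lift p) = 0"
proof -
  interpret theta_point T \<Omega> N p \<sigma> by (rule pt)
  obtain U where U: "open U" "p \<in> U" "\<And>t. t \<in> U \<Longrightarrow> t \<in> N \<Longrightarrow> f (lift t) = 0"
    using z unfolding eventually_nhds by blast
  have d: "((\<lambda>t. f (lift t)) has_derivative (\<lambda>v. cdiff f (lift p) (lift v))) (at p)"
    by (rule has_derivative_compose[OF has_derivative_lift mhol_has_derivative[OF f]])
  have tz: "cdiff f (lift p) (lift v) = 0" if "v \<in> tangent_space N p" for v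
    using tangent_space_subset_kernel[OF that d U(1,2)] U(3) by blast
  obtain u v where "u \<in> tangent_space N p" "v \<in> tangent_space N p" "axis i 1 = lift u + \<i> *s lift v"
    using lift_tangent_decomposition[of "axis i 1"] by blast
  then have "cdiff f (lift p) (axis i 1) = 0" by (simp add: cdiff_add cdiff_scale tz)
  moreover have "cdiff f (lift p) (axis i 1) = partial_deriv f i (lift p)"
    by (simp add: cdiff_def axis_def if_distrib[of "\<lambda>x. _ * x"] cong: if_cong)
  ultimately show ?thesis by simp
qed

text \<open>
  Both functions agree on the lifted points of \<open>N\<close>. Vanishing on these points passes on to partial
  derivatives, so it kills all coefficients of the difference.
\<close>

lemma theta_unique:
  fixes \<Theta> \<Theta>' :: "('m::finite, 'd::finite) theta"
  assumes adm: "admissible_theta reg \<rho> \<Theta>" "admissible_theta reg \<rho>' \<Theta>'" and pos: "\<rho> > 0" "\<rho>' > 0"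
    and N: "N \<inter> polydisc \<rho> = theta_set \<rho> \<Theta>" "N \<inter> polydisc \<rho>' = theta_set \<rho>' \<Theta>'"
    and pts: "\<And>p. p \<in> theta_set \<rho> \<Theta> \<Longrightarrow> theta_pt \<rho> \<Theta> (theta_set \<rho> \<Theta>) p"
  shows "\<Theta>' = \<Theta>"
proof
  fix j
  let ?N = "theta_set \<rho> \<Theta>"
  define R where "R = min \<rho> \<rho>'"
  have R: "R > 0" "R \<le> \<rho>" "R \<le> \<rho>'" using pos by (auto simp: R_def)
  have c: "converges_normally (\<Theta> j) R" "converges_normally (\<Theta>' j) R"
    using adm converges_normally_mono[of _ "2 * \<rho>" R] converges_normally_mono[of _ "2 * \<rho>'" R] R pos
    by (auto simp: admissible_theta_def)
  have P: "\<forall>\<^sub>F t in nhds 0. t \<in> polydisc R"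
    by (rule eventually_nhds_in_open[OF open_polydisc]) (use R in simp)
  have "(\<lambda>\<gamma>. \<Theta>' j \<gamma> - \<Theta> j \<gamma>) = (\<lambda>_. 0)"
  proof (rule ps_eq_0I[OF converges_normally_diff[OF c(2,1)] R(1),
        where Z = "\<lambda>f. \<forall>\<^sub>F t in nhds 0. t \<in> ?N \<longrightarrow> f (lift t) = 0"])
    from P show "\<forall>\<^sub>F t in nhds 0. t \<in> ?N \<longrightarrow> ps_sum (\<lambda>\<gamma>. \<Theta>' j \<gamma> - \<Theta> j \<gamma>) (lift t) = 0"
    proof eventually_elim
      case (elim t)
      show ?case
      proof
        assume t: "t \<in> ?N"
        have "t \<in> polydisc \<rho>'" using elim polydisc_mono[OF R(3)] by blast
        then have "t \<in> theta_set \<rho>' \<Theta>'" using t N by blast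
        with t have "ps_sum (\<Theta>' j) (lift t) = ps_sum (\<Theta> j) (lift t)" unfolding theta_set_iff by metis
        then show "ps_sum (\<lambda>\<gamma>. \<Theta>' j \<gamma> - \<Theta> j \<gamma>) (lift t) = 0"
          using ps_sum_diff[OF c(2,1), of "lift t"] elim by simp
      qed
    qed
  next
    have l0: "lift 0 = (0 :: complex ^ ('m + 'm + 'd))" by (auto simp: vec_eq_sum_iff)
    have "0 \<in> ?N" unfolding theta_set_iff l0 using adm(1) pos by (simp add: admissible_theta_def)
    then show "f 0 = 0" if "\<forall>\<^sub>F t in nhds 0. t \<in> ?N \<longrightarrow> f (lift t) = 0" for f :: "complex ^ ('m + 'm + 'd) \<Rightarrow> complex"
      using eventually_nhds_x_imp_x[OF that] l0 by simp
  next
    fix f i assume f: "mhol f (polydisc R :: (complex ^ ('m + 'm + 'd)) set)"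
      and ev: "\<forall>\<^sub>F t in nhds 0. t \<in> ?N \<longrightarrow> f (lift t) = 0"
    have "\<forall>\<^sub>F t in nhds 0. \<forall>\<^sub>F s in nhds t. s \<in> ?N \<longrightarrow> f (lift s) = 0"
      using ev by (simp add: eventually_eventually)
    with P show "\<forall>\<^sub>F t in nhds 0. t \<in> ?N \<longrightarrow> partial_deriv f i (lift t) = 0"
    proof eventually_elim
      case (elim t)
      show ?case using theta_point_partial_deriv_0[OF pts f _ elim(2)] elim(1) by simp
    qed
  qed
  then show "\<Theta>' j = \<Theta> j" by (simp add: fun_eq_iff)
qed

section \<open>Complexification of real equations\<close>

lemma cdiff_cps_real:
  fixes c :: "('k::finite, real) pseries"
  assumes c: "converges_normally c \<rho>" "\<rho> > 0"
  shows "cdiff (ps_sum (cps c)) 0 (cnj_vec Y) = cnj (cdiff (ps_sum (cps c)) 0 Y)"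
proof -
  have "cnj (partial_deriv (ps_sum (cps c)) i 0) = partial_deriv (ps_sum (cps c)) i 0" for i
    using partial_deriv_ps_sum[of "cps c" \<rho> 0 i] c
    by (simp add: converges_normally_cps) (simp add: ps_deriv_def cps_def)
  then show ?thesis by (simp add: cdiff_def)
qed

lemma cnj_ps_cps [simp]: "cnj_ps (cps c) = cps c"
  by (simp add: cnj_ps_def cps_def)

lemma linear_cvec_real_coords: "bounded_linear (\<lambda>x. cvec (real_coords x))"
proof -
  have "linear (\<lambda>x :: complex ^ 'n. cvec (real_coords x))"
    by (rule linearI) (auto simp: vec_eq_sum_iff cvec_def scaleR_vec_complex)
  then show ?thesis by (rule linear_conv_bounded_linear[THEN iffD1])
qed

lemma real_equation_derivative:
  fixes c :: "('n::finite + 'n, real) pseries"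
  assumes c: "converges_normally c \<rho>" and x: "real_coords (x - p) \<in> polydisc \<rho>"
  shows "((\<lambda>x. ps_sum c (real_coords (x - p))) has_derivative
     (\<lambda>v. Re (cdiff (ps_sum (cps c)) (cvec (real_coords (x - p))) (cvec (real_coords v))))) (at x)"
proof -
  have m: "mhol (ps_sum (cps c)) (polydisc \<rho>)" using c by (intro mhol_ps_sum) (simp add: converges_normally_cps)
  have "((\<lambda>x. cvec (real_coords (x - p))) has_derivative (\<lambda>v. cvec (real_coords v))) (at x)"
    by (rule bounded_linear.has_derivative[OF linear_cvec_real_coords]) (auto intro!: derivative_eq_intros)
  from has_derivative_compose[OF this mhol_has_derivative[OF m]] x
  have "((\<lambda>x. ps_sum (cps c) (cvec (real_coords (x - p)))) has_derivative
     (\<lambda>v. cdiff (ps_sum (cps c)) (cvec (real_coords (x - p))) (cvec (real_coords v)))) (at x)" by simp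
  from bounded_linear.has_derivative[OF bounded_linear_Re this] show ?thesis by (simp add: ps_sum_cps)
qed

lemma real_coords_kernel_tangent:
  fixes r :: "'d::finite \<Rightarrow> ('n::finite + 'n, real) pseries"
  assumes \<rho>: "\<rho> > 0" and conv: "\<And>j. converges_normally (r j) \<rho>"
    and ind: "\<And>a. (\<And>v. (\<Sum>j\<in>UNIV. a j * Re (cdiff (ps_sum (cps (r j))) 0 (cvec (real_coords v)))) = 0) \<Longrightarrow> (\<forall>j. a j = 0)"
    and M: "\<And>x. real_coords (x - p) \<in> polydisc \<rho> \<Longrightarrow> x \<in> M \<longleftrightarrow> (\<forall>j. ps_sum (r j) (real_coords (x - p)) = 0)"
    and p: "p \<in> M" and v: "\<And>j. Re (cdiff (ps_sum (cps (r j))) 0 (cvec (real_coords v))) = 0"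
  shows "v \<in> tangent_space M p"
proof -
  have rc0: "real_coords 0 = (0 :: real ^ ('n + 'n))" by (auto simp: vec_eq_sum_iff)
  define S where "S = {x :: complex ^ 'n. real_coords (x - p) \<in> polydisc \<rho>}"
  have mc: "mhol (ps_sum (cps (r j))) (polydisc \<rho>)" for j
    using conv by (intro mhol_ps_sum) (simp add: converges_normally_cps)
  have cc: "continuous_on A (\<lambda>x. cvec (real_coords (x - p)))" for A
    using linear_continuous_on[OF linear_cvec_real_coords, of UNIV]
    by (rule continuous_on_compose2) (auto intro!: continuous_intros)
  have "S = (\<lambda>x. cvec (real_coords (x - p))) -` polydisc \<rho>" by (auto simp: S_def)
  then have "open S" using open_vimage[OF open_polydisc cc] by simp
  show ?thesis
  proof (rule kernel_subset_tangent_space[where S = S and r = "\<lambda>j x. ps_sum (r j) (real_coords (x - p))"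
        and D = "\<lambda>j x v. Re (cdiff (ps_sum (cps (r j))) (cvec (real_coords (x - p))) (cvec (real_coords v)))"])
    show "open S" by fact
    show "p \<in> S" using \<rho> by (simp add: S_def rc0)
    show "((\<lambda>x. ps_sum (r j) (real_coords (x - p))) has_derivative
        (\<lambda>v. Re (cdiff (ps_sum (cps (r j))) (cvec (real_coords (x - p))) (cvec (real_coords v))))) (at x)" if "x \<in> S" for j x
      by (rule real_equation_derivative[OF conv]) (use that in \<open>simp add: S_def\<close>)
    show "continuous_on S (\<lambda>x. Re (cdiff (ps_sum (cps (r j))) (cvec (real_coords (x - p))) (cvec (real_coords v))))" for j v
    proof -
      have "continuous_on S (\<lambda>x. partial_deriv (ps_sum (cps (r j))) i (cvec (real_coords (x - p))))" for i
        by (rule continuous_on_compose2[OF mhol_continuous_on[OF mhol_partial_deriv[OF mc]] cc]) (auto simp: S_def)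
      then show ?thesis unfolding cdiff_def by (intro continuous_intros)
    qed
    show "ps_sum (r j) (real_coords (p - p)) = 0" for j
      using M[of p] p \<rho> by (simp add: rc0)
    show "x \<in> M" if "x \<in> S" "\<And>j. ps_sum (r j) (real_coords (x - p)) = 0" for x
      using M that by (auto simp: S_def)
    show "Re (cdiff (ps_sum (cps (r j))) (cvec (real_coords (p - p))) (cvec (real_coords v))) = 0" for j
      using v by (simp add: rc0)
    show "\<forall>j. a j = 0" if "\<And>w. (\<Sum>j\<in>UNIV. a j * Re (cdiff (ps_sum (cps (r j))) (cvec (real_coords (p - p))) (cvec (real_coords w)))) = 0" for a
      using ind[of a] that by (simp add: rc0)
  qed
qed

lemma real_submanifold_equations:
  fixes M :: "(complex ^ 'n::finite) set"
  assumes M: "real_submanifold reg CARD('d::finite) M" "p \<in> M"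
  obtains \<rho> and r :: "'d::finite \<Rightarrow> ('n + 'n, real) pseries" where
    "\<rho> > 0" "\<And>j. ps_class reg (r j)" "\<And>j. converges_normally (r j) \<rho>"
    "\<And>a. \<forall>v. (\<Sum>j\<in>UNIV. a j * Re (cdiff (ps_sum (cps (r j))) 0 (cvec (real_coords v)))) = 0 \<Longrightarrow> (\<forall>j. a j = 0)"
    "\<And>x. real_coords (x - p) \<in> polydisc \<rho> \<Longrightarrow> x \<in> M \<longleftrightarrow> (\<forall>j. ps_sum (r j) (real_coords (x - p)) = 0)"
proof -
  obtain \<rho> and r :: "nat \<Rightarrow> ('n + 'n, real) pseries" where \<rho>: "\<rho> > 0"
    and r: "\<And>j. j < CARD('d) \<Longrightarrow> ps_class reg (r j) \<and> converges_normally (r j) \<rho>"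
    and ind: "\<And>a. (\<And>v. (\<Sum>j<CARD('d). a j * frechet_derivative (\<lambda>x. ps_sum (r j) (real_coords (x - p))) (at p) v) = 0)
          \<Longrightarrow> (\<forall>j<CARD('d). a j = 0)"
    and eq: "\<And>x. real_coords (x - p) \<in> polydisc \<rho> \<Longrightarrow>
          (x \<in> M \<longleftrightarrow> (\<forall>j<CARD('d). ps_sum (r j) (real_coords (x - p)) = 0))"
    using M(1)[unfolded real_submanifold_def, rule_format, OF M(2)] by blast
  obtain h :: "nat \<Rightarrow> 'd" where h: "bij_betw h {..<CARD('d)} UNIV"
    using ex_bij_betw_nat_finite[of "UNIV :: 'd set"] by (auto simp: atLeast0LessThan)
  define g where "g = the_inv_into {..<CARD('d)} h"
  have gh: "g (h j) = j" if "j < CARD('d)" for j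
    unfolding g_def using h that by (simp add: bij_betw_def the_inv_into_f_f)
  have gb: "bij_betw g UNIV {..<CARD('d)}"
    unfolding g_def by (rule bij_betw_the_inv_into[OF h])
  then have gl: "g i < CARD('d)" for i by (auto simp: bij_betw_def)
  have hg: "h (g i) = i" for i
    unfolding g_def using h by (simp add: bij_betw_def f_the_inv_into_f)
  have rc0: "real_coords 0 = (0 :: real ^ ('n + 'n))" by (auto simp: vec_eq_sum_iff)
  have fd: "frechet_derivative (\<lambda>x. ps_sum (r j) (real_coords (x - p))) (at p)
      = (\<lambda>v. Re (cdiff (ps_sum (cps (r j))) 0 (cvec (real_coords v))))" if "j < CARD('d)" for j
  proof -
    have "((\<lambda>x. ps_sum (r j) (real_coords (x - p))) has_derivative
     (\<lambda>v. Re (cdiff (ps_sum (cps (r j))) (cvec (real_coords (p - p))) (cvec (real_coords v))))) (at p)"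
      by (rule real_equation_derivative[where \<rho> = \<rho>]) (use r[OF that] \<rho> in \<open>auto simp: rc0\<close>)
    from frechet_derivative_at[OF this] show ?thesis by (simp add: rc0)
  qed
  show thesis
  proof (rule that[of \<rho> "\<lambda>i. r (g i)"])
    show "\<rho> > 0" by (rule \<rho>)
    show "ps_class reg (r (g i))" "converges_normally (r (g i)) \<rho>" for i using r[OF gl] by blast+
    show "\<forall>i. a i = 0"
      if z: "\<forall>v. (\<Sum>i\<in>UNIV. a i * Re (cdiff (ps_sum (cps (r (g i)))) 0 (cvec (real_coords v)))) = 0" for a
    proof -
      have "(\<Sum>j<CARD('d). a (h j) * frechet_derivative (\<lambda>x. ps_sum (r j) (real_coords (x - p))) (at p) v) = 0" for v
      proof -
        have "(\<Sum>j<CARD('d). a (h j) * frechet_derivative (\<lambda>x. ps_sum (r j) (real_coords (x - p))) (at p) v)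
          = (\<Sum>i\<in>UNIV. a (h (g i)) * frechet_derivative (\<lambda>x. ps_sum (r (g i)) (real_coords (x - p))) (at p) v)"
          by (rule sum.reindex_bij_betw[OF gb, symmetric])
        also have "\<dots> = 0" using z by (simp add: hg fd gl)
        finally show ?thesis .
      qed
      then have "\<forall>j<CARD('d). a (h j) = 0" by (rule ind)
      then show ?thesis using gl hg by metis
    qed
    show "x \<in> M \<longleftrightarrow> (\<forall>i. ps_sum (r (g i)) (real_coords (x - p)) = 0)" if "real_coords (x - p) \<in> polydisc \<rho>" for x
    proof -
      have "(\<forall>j<CARD('d). ps_sum (r j) (real_coords (x - p)) = 0) \<longleftrightarrow> (\<forall>i. ps_sum (r (g i)) (real_coords (x - p)) = 0)"
        using gl gh by metis
      then show ?thesis using eq[OF that] by simp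
    qed
  qed
qed


section \<open>Solving the complexified equations\<close>

lemma vjoin_in_polydisc [simp]: "vjoin x y \<in> polydisc \<rho> \<longleftrightarrow> x \<in> polydisc \<rho> \<and> y \<in> polydisc \<rho>"
proof -
  have "(\<forall>i. norm (vjoin x y $ i) < \<rho>) \<longleftrightarrow> (\<forall>k. norm (x $ k) < \<rho>) \<and> (\<forall>l. norm (y $ l) < \<rho>)"
  proof (intro iffI conjI allI)
    fix i assume *: "(\<forall>k. norm (x $ k) < \<rho>) \<and> (\<forall>l. norm (y $ l) < \<rho>)"
    show "norm (vjoin x y $ i) < \<rho>" using * by (cases i) simp_all
  next
    fix k assume "\<forall>i. norm (vjoin x y $ i) < \<rho>"
    from this[rule_format, of "Inl k"] show "norm (x $ k) < \<rho>" by simp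
  next
    fix l assume "\<forall>i. norm (vjoin x y $ i) < \<rho>"
    from this[rule_format, of "Inr l"] show "norm (y $ l) < \<rho>" by simp
  qed
  then show ?thesis by (simp add: polydisc_def)
qed

lemma cdiff_component: "cdiff (\<lambda>V. V $ i) x v = v $ i"
proof -
  have "(\<lambda>V. V $ i) = cdiff (\<lambda>V. V $ i) x"
    by (rule cdiff_unique[OF mhol_component[OF open_UNIV]])
      (auto intro: bounded_linear_imp_has_derivative[OF bounded_linear_vec_nth])
  from fun_cong[OF this, of v] show ?thesis by simp
qed

lemma tendsto_nth_0: "((\<lambda>X. X $ i) \<longlongrightarrow> 0) (nhds (0 :: complex ^ 'k::finite))"
  by (rule tendsto_eq_rhs[OF tendsto_vec_nth[OF filterlim_ident]]) simp

text \<open>The involution \<open>(\<zeta>, z, w, \<omega>) \<mapsto> (\<bar>z, \<bar>\<zeta>, \<bar>\<omega>, \<bar>w)\<close>, whose fixed points are the real points.\<close>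

definition swap_cnj :: "complex ^ (('m::finite + 'm + 'd::finite) + 'd) \<Rightarrow> complex ^ (('m + 'm + 'd) + 'd)"
  where "swap_cnj V = vjoin (vjoin (\<chi> k. cnj (V $ Inl (Inr (Inl k)))) (vjoin (\<chi> k. cnj (V $ Inl (Inl k))) (\<chi> j. cnj (V $ Inr j))))
    (\<chi> j. cnj (V $ Inl (Inr (Inr j))))"

text \<open>
  The inverse \<open>\<Psi>\<close> of the map \<open>\<Phi>(X, \<omega>) = (X, G(X, \<omega>))\<close> gives the solution \<open>T(X)\<close> as the last component
  of \<open>\<Psi>(X, 0)\<close>. The involution maps the zero \<open>(X, T(X))\<close> of \<open>G\<close> to the zero \<open>(\<sigma>(X), \<bar>w)\<close>, and
  solving this one as well yields the functional equation. In the algebraic case one passes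
  through \<open>\<Psi>\<close> too, since inverse maps are easier to handle than implicit functions.
\<close>

theorem implicit_theta:
  fixes G :: "'d::finite \<Rightarrow> complex ^ (('m::finite + 'm + 'd) + 'd) \<Rightarrow> complex"
  assumes G: "\<And>j. mhol (G j) S" "0 \<in> S" "\<And>j. G j 0 = 0"
    and inj: "\<And>\<omega>. (\<And>j. cdiff (G j) 0 (vjoin 0 \<omega>) = 0) \<Longrightarrow> \<omega> = 0"
    and real: "\<And>j V. G j (swap_cnj V) = cnj (G j V)"
    and alg: "\<And>j. reg = Algebraic \<Longrightarrow> alg_at 0 (G j)"
  obtains \<rho> and \<Theta> :: "('m, 'd) theta" where "\<rho> > 0" "admissible_theta reg \<rho> \<Theta>" "polydisc \<rho> \<subseteq> S"
    "\<And>X \<omega>. vjoin X \<omega> \<in> polydisc \<rho> \<Longrightarrow> (\<forall>j. G j (vjoin X \<omega>) = 0) \<longleftrightarrow> (\<forall>j. \<omega> $ j = ps_sum (\<Theta> j) X)"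
    "\<And>X j. X \<in> polydisc \<rho> \<Longrightarrow> cnj (ps_sum (\<Theta> j) (theta_refl \<Theta> X)) = X $ Inr (Inr j)"
proof -
  have S: "open S" using G(1) mhol_open by blast
  define \<Phi> where "\<Phi> V = vjoin (z_part V) (\<chi> j. G j V)" for V
  have \<Phi>h: "mhol (\<lambda>V. \<Phi> V $ i) S" for i
    by (cases i) (auto simp: \<Phi>_def intro: mhol_component[OF S] G)
  have \<Phi>i: "v = 0" if "\<And>i. cdiff (\<lambda>V. \<Phi> V $ i) 0 v = 0" for v
  proof -
    have z: "v $ Inl i = 0" for i using that[of "Inl i"] by (simp add: \<Phi>_def cdiff_component)
    then have v: "v = vjoin 0 (w_part v)" by (simp add: vec_eq_sum_iff)
    have "cdiff (G j) 0 (vjoin 0 (w_part v)) = 0" for j using that[of "Inr j"] by (simp add: \<Phi>_def v[symmetric])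
    then have "w_part v = 0" by (rule inj)
    then show ?thesis using v by (simp add: vec_eq_sum_iff)
  qed
  obtain U V' \<Psi> where UV: "open U" "U \<subseteq> S" "0 \<in> U" "open V'" "\<Phi> 0 \<in> V'"
    and \<Phi>\<Psi>: "\<And>x. x \<in> U \<Longrightarrow> \<Phi> x \<in> V' \<and> \<Psi> (\<Phi> x) = x" "\<And>y. y \<in> V' \<Longrightarrow> \<Psi> y \<in> U \<and> \<Phi> (\<Psi> y) = y"
    and \<Psi>h: "\<And>i. mhol (\<lambda>y. \<Psi> y $ i) V'"
    by (rule mhol_inverse_function[OF \<Phi>h G(2) \<Phi>i], assumption, rule that)
  have \<Phi>0: "\<Phi> 0 = 0" by (simp add: \<Phi>_def G(3) vec_eq_sum_iff)
  then have V0: "0 \<in> V'" and \<Psi>0: "\<Psi> 0 = 0" using UV \<Phi>\<Psi>(1)[OF UV(3)] by auto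
  define T where "T j X = \<Psi> (vjoin X 0) $ Inr j" for j X
  define Y where "Y = {X. vjoin X 0 \<in> V'}"
  have vc: "mhol (\<lambda>X. vjoin X (0 :: complex ^ 'd) $ i) UNIV" for i :: "('m + 'm + 'd) + 'd"
    by (cases i) (auto intro: mhol_component)
  have "continuous_on UNIV (\<lambda>X :: complex ^ ('m + 'm + 'd). vjoin X (0 :: complex ^ 'd))"
  proof -
    have "continuous_on UNIV (\<lambda>X :: complex ^ ('m + 'm + 'd). \<chi> i. vjoin X (0 :: complex ^ 'd) $ i)"
      by (intro continuous_intros mhol_continuous_on vc)
    then show ?thesis by simp
  qed
  from open_vimage[OF UV(4) this] have Y: "open Y" by (simp add: Y_def vimage_def)
  have v00: "vjoin 0 0 = (0 :: complex ^ (('m + 'm + 'd) + 'd))" by (simp add: vec_eq_sum_iff)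
  have Y0: "0 \<in> Y" using V0 by (simp add: Y_def v00)
  have Th: "mhol (T j) Y" for j
    unfolding T_def by (rule mhol_compose[OF \<Psi>h mhol_subset[OF vc Y]]) (auto simp: Y_def)
  obtain \<rho>a where \<rho>a: "\<rho>a > 0" "polydisc \<rho>a \<subseteq> Y" using polydisc_in_nhd[OF Y Y0] by blast
  have "\<exists>c. converges_normally c \<rho>a \<and> (\<forall>x\<in>polydisc \<rho>a. ps_sum c x = T j x)" for j
    using mhol_ps_expansion[OF mhol_subset[OF Th open_polydisc \<rho>a(2)] \<rho>a(1)] by metis
  then obtain \<Theta> where \<Theta>: "\<And>j. converges_normally (\<Theta> j) \<rho>a" "\<And>j X. X \<in> polydisc \<rho>a \<Longrightarrow> ps_sum (\<Theta> j) X = T j X"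
    by metis
  have \<Theta>0: "ps_sum (\<Theta> j) 0 = 0" for j using \<Theta>(2)[of 0] \<rho>a(1) by (simp add: T_def v00 \<Psi>0 del: ps_sum_0)
  have graph: "vjoin X (\<chi> j. T j X) \<in> U \<and> (\<forall>j. G j (vjoin X (\<chi> j. T j X)) = 0)" if "X \<in> Y" for X
  proof -
    have y: "vjoin X 0 \<in> V'" using that by (simp add: Y_def)
    have "\<Phi> (\<Psi> (vjoin X 0)) = vjoin X 0" using \<Phi>\<Psi>(2)[OF y] by simp
    then have e1: "z_part (\<Psi> (vjoin X 0)) = X" and e2: "(\<chi> j. G j (\<Psi> (vjoin X 0))) = 0"
      unfolding \<Phi>_def by (metis z_part_vjoin, metis w_part_vjoin)
    have e3: "\<Psi> (vjoin X 0) = vjoin X (\<chi> j. T j X)"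
      using arg_cong[OF e1, of "\<lambda>x. x $ _"] by (auto simp: vec_eq_sum_iff T_def)
    show ?thesis using \<Phi>\<Psi>(2)[OF y] e2 unfolding e3 by (simp add: vec_eq_iff)
  qed
  have solve: "\<omega> = (\<chi> j. T j X)" if "vjoin X \<omega> \<in> U" "\<And>j. G j (vjoin X \<omega>) = 0" for X :: "complex ^ ('m + 'm + 'd)" and \<omega> :: "complex ^ 'd"
  proof -
    have "\<Phi> (vjoin X \<omega>) = vjoin X 0" unfolding \<Phi>_def using that(2) by (simp add: vec_eq_sum_iff)
    then have "\<Psi> (vjoin X 0) = vjoin X \<omega>" using \<Phi>\<Psi>(1)[OF that(1)] by simp
    then show ?thesis by (simp add: vec_eq_iff T_def)
  qed
  obtain \<rho>b where \<rho>b: "\<rho>b > 0" "polydisc \<rho>b \<subseteq> U" using polydisc_in_nhd[OF UV(1,3)] by blast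
  have cl: "ps_class reg (\<Theta> j)" for j
  proof (cases reg)
    case Analytic
    then show ?thesis using \<Theta>(1) \<rho>a(1) by (auto simp: ps_class_def convergent_ps_def)
  next
    case Algebraic
    have \<Phi>a: "alg_at 0 (\<lambda>V. \<Phi> V $ i)" for i
      by (cases i) (auto simp: \<Phi>_def intro: alg_at_polyfn polyfn_coord alg[OF Algebraic])
    have "(\<Psi> \<longlongrightarrow> 0) (nhds 0)"
    proof (rule vec_tendstoI)
      fix i
      have "isCont (\<lambda>y. \<Psi> y $ i) 0"
        using mhol_continuous_on[OF \<Psi>h] UV(4) V0 continuous_on_eq_continuous_at by blast
      then show "((\<lambda>y. \<Psi> y $ i) \<longlongrightarrow> 0 $ i) (nhds 0)" by (simp add: continuous_at tendsto_nhds_iff \<Psi>0)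
    qed
    moreover have "\<forall>\<^sub>F y in nhds 0. \<Phi> (\<Psi> y) = y"
      using eventually_nhds_in_open[OF UV(4) V0] by eventually_elim (simp add: \<Phi>\<Psi>(2))
    ultimately have "alg_at 0 (\<lambda>y. \<Psi> y $ Inr j)" by (rule alg_at_inverse[OF \<Phi>h G(2) \<Phi>a])
    from alg_at_restrict[OF \<Psi>h V0 this] have "alg_at 0 (T j)" by (simp add: T_def[abs_def])
    moreover have "\<forall>\<^sub>F X in nhds 0. T j X = ps_sum (\<Theta> j) X"
      using eventually_nhds_in_open[OF open_polydisc, of 0 \<rho>a] \<rho>a(1) by (auto elim!: eventually_mono simp: \<Theta>(2))
    ultimately have "alg_at 0 (ps_sum (\<Theta> j))" by (rule alg_at_cong)
    then show ?thesis using Algebraic \<Theta>(1) \<rho>a(1)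
      by (auto simp: ps_class_def algebraic_ps_iff_alg_at convergent_ps_def)
  qed
  have tc: "((\<lambda>X. cnj (X $ i)) \<longlongrightarrow> 0) (nhds 0)" for i :: "'m + 'm + 'd"
    using tendsto_cnj[OF tendsto_nth_0[of i]] by simp
  have t\<sigma>: "(theta_refl \<Theta> \<longlongrightarrow> 0) (nhds 0)"
  proof (rule vec_tendstoI)
    fix i :: "'m + 'm + 'd"
    have *: "((\<lambda>X. cnj (ps_sum (\<Theta> j) X)) \<longlongrightarrow> 0) (nhds 0)" for j
    proof -
      have "isCont (ps_sum (\<Theta> j)) 0"
        using mhol_continuous_on[OF mhol_ps_sum[OF \<Theta>(1)]] open_polydisc \<rho>a(1) continuous_on_eq_continuous_at zero_in_polydisc by blast
      then have "(ps_sum (\<Theta> j) \<longlongrightarrow> 0) (nhds 0)" by (simp add: continuous_at tendsto_nhds_iff \<Theta>0 del: ps_sum_0)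
      from tendsto_cnj[OF this] show ?thesis by simp
    qed
    show "((\<lambda>X. theta_refl \<Theta> X $ i) \<longlongrightarrow> 0 $ i) (nhds 0)"
    proof (cases i)
      case (Inl k) then show ?thesis by (simp add: theta_refl_def tc)
    next
      case (Inr i') then show ?thesis by (cases i') (simp_all add: theta_refl_def tc *)
    qed
  qed
  have t\<sigma>': "((\<lambda>X. vjoin (theta_refl \<Theta> X) (\<chi> j. cnj (X $ Inr (Inr j)))) \<longlongrightarrow> 0) (nhds 0)"
  proof (rule vec_tendstoI)
    fix i :: "('m + 'm + 'd) + 'd"
    show "((\<lambda>X. vjoin (theta_refl \<Theta> X) (\<chi> j. cnj (X $ Inr (Inr j))) $ i) \<longlongrightarrow> 0 $ i) (nhds 0)"
      using tendsto_vec_nth[OF t\<sigma>] by (cases i) (simp_all add: tc)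
  qed
  have "\<forall>\<^sub>F X in nhds 0. X \<in> polydisc \<rho>a \<and> theta_refl \<Theta> X \<in> polydisc \<rho>a \<and>
      vjoin (theta_refl \<Theta> X) (\<chi> j. cnj (X $ Inr (Inr j))) \<in> U"
    by (intro eventually_conj topological_tendstoD[OF t\<sigma>] topological_tendstoD[OF t\<sigma>'] eventually_nhds_in_open open_polydisc UV(1,3))
      (use \<rho>a(1) in simp_all)
  then obtain W where W: "open W" "0 \<in> W" "\<And>X. X \<in> W \<Longrightarrow> X \<in> polydisc \<rho>a \<and> theta_refl \<Theta> X \<in> polydisc \<rho>a \<and>
      vjoin (theta_refl \<Theta> X) (\<chi> j. cnj (X $ Inr (Inr j))) \<in> U"
    unfolding eventually_nhds by blast
  obtain \<rho>c where \<rho>c: "\<rho>c > 0" "polydisc \<rho>c \<subseteq> W" using polydisc_in_nhd[OF W(1,2)] by blast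
  define \<rho> where "\<rho> = min (\<rho>a / 2) (min \<rho>b \<rho>c)"
  have \<rho>: "\<rho> > 0" "2 * \<rho> \<le> \<rho>a" "\<rho> \<le> \<rho>a" "\<rho> \<le> \<rho>b" "\<rho> \<le> \<rho>c"
    using \<rho>a \<rho>b \<rho>c by (auto simp: \<rho>_def)
  show thesis
  proof (rule that[OF \<rho>(1)])
    show "admissible_theta reg \<rho> \<Theta>"
      unfolding admissible_theta_def using cl \<Theta>0 converges_normally_mono[OF \<Theta>(1) \<rho>(2)] by blast
    show "polydisc \<rho> \<subseteq> S" using polydisc_mono[OF \<rho>(4)] \<rho>b(2) UV(2) by blast
    fix X :: "complex ^ ('m + 'm + 'd)" and \<omega> :: "complex ^ 'd" assume X: "vjoin X \<omega> \<in> polydisc \<rho>"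
    then have XU: "vjoin X \<omega> \<in> U" using polydisc_mono[OF \<rho>(4)] \<rho>b(2) by blast
    have Xa: "X \<in> polydisc \<rho>a" using X polydisc_mono[OF \<rho>(3)] by auto
    have "(\<forall>j. G j (vjoin X \<omega>) = 0) \<longleftrightarrow> \<omega> = (\<chi> j. T j X)"
      using solve[OF XU] graph[of X] Xa \<rho>a(2) by blast
    then show "(\<forall>j. G j (vjoin X \<omega>) = 0) \<longleftrightarrow> (\<forall>j. \<omega> $ j = ps_sum (\<Theta> j) X)"
      by (simp add: \<Theta>(2)[OF Xa] vec_eq_iff)
  next
    fix X :: "complex ^ ('m + 'm + 'd)" and j assume "X \<in> polydisc \<rho>"
    then have "X \<in> W" using polydisc_mono[OF \<rho>(5)] \<rho>c(2) by blast
    from W(3)[OF this] have Xa: "X \<in> polydisc \<rho>a" and \<sigma>a: "theta_refl \<Theta> X \<in> polydisc \<rho>a"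
      and \<sigma>U: "vjoin (theta_refl \<Theta> X) (\<chi> j. cnj (X $ Inr (Inr j))) \<in> U" by auto
    have sw: "swap_cnj (vjoin X (\<chi> j. T j X)) = vjoin (theta_refl \<Theta> X) (\<chi> j. cnj (X $ Inr (Inr j)))"
      unfolding swap_cnj_def theta_refl_def by (simp add: \<Theta>(2)[OF Xa])
    have "G j (vjoin (theta_refl \<Theta> X) (\<chi> j. cnj (X $ Inr (Inr j)))) = 0" for j
      using real[of j "vjoin X (\<chi> j. T j X)"] graph[of X] Xa \<rho>a(2) unfolding sw by auto
    from solve[OF \<sigma>U this] have "cnj (X $ Inr (Inr j)) = T j (theta_refl \<Theta> X)" by (simp add: vec_eq_iff)
    then show "cnj (ps_sum (\<Theta> j) (theta_refl \<Theta> X)) = X $ Inr (Inr j)"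
      by (simp add: \<Theta>(2)[OF \<sigma>a, symmetric]) (metis complex_cnj_cnj)
  qed
qed

section \<open>From generic submanifolds to the functional equations\<close>

definition t_slot :: "complex ^ (('m::finite + 'm + 'd::finite) + 'd) \<Rightarrow> complex ^ ('m + 'd)"
  where "t_slot V = w_part (z_part V)"

definition t_cnj_slot :: "complex ^ (('m::finite + 'm + 'd::finite) + 'd) \<Rightarrow> complex ^ ('m + 'd)"
  where "t_cnj_slot V = vjoin (z_part (z_part V)) (w_part V)"

text \<open>
  For a complex linear map \<open>L\<close> this is the complexification of \<open>t \<mapsto> real_coords (L t)\<close>, as a function
  of \<open>t\<close> and of an independent variable in the place of \<open>\<bar>t\<close>.
\<close>

definition complexified_coords :: "(complex ^ ('m::finite + 'd::finite) \<Rightarrow> complex ^ 'n::finite) \<Rightarrow>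
    complex ^ (('m + 'm + 'd) + 'd) \<Rightarrow> complex ^ ('n + 'n)"
  where "complexified_coords L V =
    vjoin (\<chi> k. (L (t_slot V) $ k + cnj (L (cnj_vec (t_cnj_slot V)) $ k)) * (1 / 2))
      (\<chi> k. (L (t_slot V) $ k - cnj (L (cnj_vec (t_cnj_slot V)) $ k)) * (- \<i> / 2))"

lemma cnj_vec_simps [simp]: "cnj_vec 0 = 0" "cnj_vec (v + w) = cnj_vec v + cnj_vec w" "cnj_vec (c *s v) = cnj c *s cnj_vec v"
  by (simp_all add: vec_eq_iff)

lemma complexified_coords_real:
  "complexified_coords L (vjoin (lift t) (cnj_vec (w_part t))) = cvec (real_coords (L t))"
proof -
  have s: "t_slot (vjoin (lift t) (cnj_vec (w_part t))) = t" by (simp add: t_slot_def vec_eq_iff)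
  have s': "t_cnj_slot (vjoin (lift t) (cnj_vec (w_part t))) = cnj_vec t"
    by (simp add: t_cnj_slot_def vec_eq_sum_iff)
  show ?thesis
    unfolding complexified_coords_def s s' cnj_vec_cnj_vec by (simp add: vec_eq_sum_iff cvec_def complex_eq_iff)
qed

lemma complexified_coords_swap: "complexified_coords L (swap_cnj V) = cnj_vec (complexified_coords L V)"
proof -
  have s: "t_slot (swap_cnj V) = cnj_vec (t_cnj_slot V)" "t_cnj_slot (swap_cnj V) = cnj_vec (t_slot V)"
    by (simp_all add: t_slot_def t_cnj_slot_def swap_cnj_def vec_eq_sum_iff)
  show ?thesis unfolding complexified_coords_def s cnj_vec_cnj_vec
    by (simp add: vec_eq_sum_iff algebra_simps)
qed

context
  fixes L :: "complex ^ ('m::finite + 'd::finite) \<Rightarrow> complex ^ 'n::finite"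
  assumes L: "Vector_Spaces.linear (*s) (*s) L"
begin

lemma L_add: "L (x + y) = L x + L y" and L_scale: "L (c *s x) = c *s L x" and L_0: "L 0 = 0"
proof -
  interpret linear: Vector_Spaces.linear "(*s)" "(*s)" L by (rule L)
  show "L (x + y) = L x + L y" "L (c *s x) = c *s L x" "L 0 = 0"
    by (rule linear.add, rule linear.scale, rule linear.zero)
qed

lemma complexified_coords_linear:
  "complexified_coords L (V + W) = complexified_coords L V + complexified_coords L W"
  "complexified_coords L (c *s V) = c *s complexified_coords L V"
proof -
  have s: "t_slot (V + W) = t_slot V + t_slot W" "t_cnj_slot (V + W) = t_cnj_slot V + t_cnj_slot W"
    "t_slot (c *s V) = c *s t_slot V" "t_cnj_slot (c *s V) = c *s t_cnj_slot V"
    by (simp_all add: t_slot_def t_cnj_slot_def vec_eq_sum_iff)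
  show "complexified_coords L (V + W) = complexified_coords L V + complexified_coords L W"
    "complexified_coords L (c *s V) = c *s complexified_coords L V"
    unfolding complexified_coords_def s cnj_vec_simps L_add L_scale by (simp_all add: vec_eq_sum_iff algebra_simps)
qed

lemma linear_complexified_coords: "Vector_Spaces.linear (*s) (*s) (complexified_coords L)"
  by unfold_locales (simp_all add: complexified_coords_linear vec.scale_right_distrib vec.scale_left_distrib)

lemma bounded_linear_complexified_coords: "bounded_linear (complexified_coords L)"
proof -
  have "linear (complexified_coords L)"
    by (rule linearI) (simp_all add: complexified_coords_linear scaleR_vec_complex)
  then show ?thesis by (rule linear_conv_bounded_linear[THEN iffD1])
qed

text \<open>
  The point \<open>c L(0, \<bar>\<omega>)\<close> has its complexified coordinates in the span of those of \<open>(0, \<omega>)\<close> and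
  of their conjugates. Hence a real functional whose complex extension vanishes at the latter
  vanishes at all complex multiples of \<open>L(0, \<bar>\<omega>)\<close>.
\<close>

lemma complexified_coords_cnj_w:
  "cvec (real_coords (c *s L (vjoin 0 (cnj_vec \<omega>))))
    = cnj c *s complexified_coords L (vjoin 0 \<omega>) + cnj_vec (cnj c *s complexified_coords L (vjoin 0 \<omega>))"
proof -
  have z0: "z_part (0 :: complex ^ ('m + 'm + 'd)) = 0" "w_part (0 :: complex ^ ('m + 'm + 'd)) = 0"
    by (simp_all add: vec_eq_iff)
  have s: "t_slot (vjoin (0 :: complex ^ ('m + 'm + 'd)) \<omega>) = 0" "t_cnj_slot (vjoin (0 :: complex ^ ('m + 'm + 'd)) \<omega>) = vjoin 0 \<omega>"
    by (simp_all add: t_slot_def t_cnj_slot_def z0)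
  have s': "cnj_vec (vjoin 0 \<omega>) = (vjoin 0 (cnj_vec \<omega>) :: complex ^ ('m + 'd))" by (simp add: cnj_vec_vjoin)
  show ?thesis
    unfolding complexified_coords_def s s' L_0
    by (simp add: vec_eq_sum_iff cvec_def complex_eq_iff field_simps)
qed

end

lemma surj_complexified_coords:
  fixes L :: "complex ^ ('m::finite + 'd::finite) \<Rightarrow> complex ^ 'n::finite"
  assumes "surj L"
  shows "surj (complexified_coords L)"
proof (rule surjI)
  fix Y :: "complex ^ ('n + 'n)"
  let ?a = "\<lambda>Y. (\<chi> k. Y $ Inl k + \<i> * Y $ Inr k) :: complex ^ 'n"
  let ?b = "\<lambda>Y. (\<chi> k. Y $ Inl k - \<i> * Y $ Inr k) :: complex ^ 'n"
  let ?t = "\<lambda>Y. inv L (?a Y)" and ?\<tau> = "\<lambda>Y. cnj_vec (inv L (cnj_vec (?b Y)))"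
  let ?V = "\<lambda>Y. vjoin (vjoin (z_part (?\<tau> Y)) (?t Y)) (w_part (?\<tau> Y))"
  have s: "t_slot (?V Y) = ?t Y" "t_cnj_slot (?V Y) = ?\<tau> Y" by (simp_all add: t_slot_def t_cnj_slot_def)
  show "complexified_coords L (?V Y) = Y"
    unfolding complexified_coords_def s cnj_vec_cnj_vec surj_f_inv_f[OF assms]
    by (simp add: vec_eq_sum_iff complex_eq_iff field_simps)
qed

text \<open>
  The transversality of \<open>T\<^sup>cM\<close> and \<open>{z = 0}\<close> enters as the hypothesis of \<open>implicit_theta\<close> on the
  derivative with respect to \<open>\<omega>\<close>: a vector \<open>\<omega>\<close> in its kernel gives the vector \<open>L(0, \<bar>\<omega>)\<close> of
  \<open>T\<^sup>cM\<close>.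
\<close>

theorem theta_exists:
  fixes M :: "(complex ^ 'n::finite) set" and A :: "complex ^ 'n \<Rightarrow> complex ^ ('m::finite + 'd::finite)"
  assumes M: "real_submanifold reg CARD('d) M" "p0 \<in> M"
    and A: "Vector_Spaces.linear (*s) (*s) A" "bij A"
    and trans: "complex_tangent_space M p0 \<inter> {v. z_part (A v) = 0} = {0}"
  obtains \<rho> and \<Theta> :: "('m, 'd) theta" where "\<rho> > 0" "admissible_theta reg \<rho> \<Theta>"
    "(\<lambda>p. A (p - p0)) ` M \<inter> polydisc \<rho> = theta_set \<rho> \<Theta>"
    "\<And>X j. X \<in> polydisc \<rho> \<Longrightarrow> cnj (ps_sum (\<Theta> j) (theta_refl \<Theta> X)) = X $ Inr (Inr j)"
proof -
  obtain \<rho>0 and r :: "'d \<Rightarrow> ('n + 'n, real) pseries" where \<rho>0: "\<rho>0 > 0"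
    and r: "\<And>j. ps_class reg (r j)" "\<And>j. converges_normally (r j) \<rho>0"
    and ind: "\<And>a. \<forall>v. (\<Sum>j\<in>UNIV. a j * Re (cdiff (ps_sum (cps (r j))) 0 (cvec (real_coords v)))) = 0 \<Longrightarrow> (\<forall>j. a j = 0)"
    and eqs: "\<And>x. real_coords (x - p0) \<in> polydisc \<rho>0 \<Longrightarrow> x \<in> M \<longleftrightarrow> (\<forall>j. ps_sum (r j) (real_coords (x - p0)) = 0)"
    by (rule real_submanifold_equations[OF M]) (rule that)
  define L where "L = inv A"
  have LA: "L (A x) = x" "A (L t) = t" for x t
    using A(2) by (simp_all add: L_def bij_is_inj bij_is_surj surj_f_inv_f)
  have lL: "Vector_Spaces.linear (*s) (*s) L"
  proof -
    interpret linear: Vector_Spaces.linear "(*s)" "(*s)" A by (rule A(1))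
    show ?thesis
    proof unfold_locales
      show "L (x + y) = L x + L y" for x y by (metis LA linear.add)
      show "L (c *s x) = c *s L x" for c x by (metis LA linear.scale)
    qed
  qed
  have A0: "A 0 = 0"
  proof -
    interpret linear: Vector_Spaces.linear "(*s)" "(*s)" A by (rule A(1))
    show ?thesis by (rule linear.zero)
  qed
  have sL: "surj L" using LA(1) by (metis surjI)
  define K where "K = complexified_coords L"
  define Rc where "Rc j = ps_sum (cps (r j))" for j
  define G where "G j V = Rc j (K V)" for j V
  define S where "S = K -` polydisc \<rho>0"
  have cr: "converges_normally (cps (r j)) \<rho>0" for j using r(2) by (simp add: converges_normally_cps)
  have Rh: "mhol (Rc j) (polydisc \<rho>0)" for j unfolding Rc_def by (rule mhol_ps_sum[OF cr])
  have bK: "bounded_linear K" unfolding K_def by (rule bounded_linear_complexified_coords[OF lL])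
  have K0: "K 0 = 0" using bK linear_0 bounded_linear.linear by blast
  have pK: "polyfn (\<lambda>V. K V $ i)" for i
    unfolding K_def by (rule polyfn_linear[OF linear_complexified_coords[OF lL]])
  have S: "open S" "0 \<in> S"
    unfolding S_def using open_vimage[OF open_polydisc linear_continuous_on[OF bK]] K0 \<rho>0 by auto
  have Gh: "mhol (G j) S" for j
    unfolding G_def by (rule mhol_compose[OF Rh mhol_subset[OF mhol_polyfn[OF pK] S(1)]]) (auto simp: S_def)
  have p0eq: "ps_sum (r j) 0 = 0" for j
  proof -
    have "real_coords (p0 - p0) = 0" by (auto simp: vec_eq_sum_iff)
    then show ?thesis using eqs[of p0] M(2) \<rho>0 by auto
  qed
  have Rreal: "Rc j (cvec y) = complex_of_real (ps_sum (r j) y)" for j y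
    unfolding Rc_def by (rule ps_sum_cps)
  have G0: "G j 0 = 0" for j
    using Rreal[of j 0] p0eq[of j] by (simp add: G_def K0 del: ps_sum_0)
  have Gd: "cdiff (G j) 0 V = cdiff (Rc j) 0 (K V)" for j V
  proof -
    have "(K has_derivative K) (at 0)" by (rule bounded_linear_imp_has_derivative[OF bK])
    moreover have "(Rc j has_derivative cdiff (Rc j) 0) (at (K 0))"
      using mhol_has_derivative[OF Rh, of 0 j] \<rho>0 K0 by simp
    ultimately have "(G j has_derivative (\<lambda>V. cdiff (Rc j) 0 (K V))) (at 0)"
      unfolding G_def[abs_def] by (rule has_derivative_compose)
    from cdiff_unique[OF Gh S(2) this] show ?thesis by metis
  qed
  have inj: "\<omega> = 0" if z: "\<And>j. cdiff (G j) 0 (vjoin 0 \<omega>) = 0" for \<omega>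
  proof -
    define u where "u = L (vjoin 0 (cnj_vec \<omega>))"
    have "c *s u \<in> tangent_space M p0" for c
    proof (rule real_coords_kernel_tangent[OF \<rho>0 r(2) _ eqs M(2)])
      show "\<forall>j. a j = 0" if "\<And>v. (\<Sum>j\<in>UNIV. a j * Re (cdiff (ps_sum (cps (r j))) 0 (cvec (real_coords v)))) = 0" for a
        by (rule ind) (simp add: that)
    next
      fix j
      have y0: "cdiff (Rc j) 0 (cnj c *s K (vjoin 0 \<omega>)) = 0" using z[of j] by (simp add: Gd cdiff_scale)
      have "cdiff (Rc j) 0 (cvec (real_coords (c *s u))) = 0"
        unfolding u_def complexified_coords_cnj_w[OF lL] cdiff_add K_def[symmetric]
        unfolding Rc_def cdiff_cps_real[OF r(2) \<rho>0] using y0 by (simp add: Rc_def)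
      then show "Re (cdiff (ps_sum (cps (r j))) 0 (cvec (real_coords (c *s u)))) = 0" by (simp add: Rc_def)
    qed
    from this[of 1] this[of "- \<i>"] have "u \<in> tangent_space M p0" "(- \<i>) *s u \<in> tangent_space M p0" by simp_all
    moreover have "u = \<i> *s ((- \<i>) *s u)" by (simp add: vec_eq_iff)
    ultimately have "u \<in> complex_tangent_space M p0" unfolding complex_tangent_space_def by blast
    moreover have "z_part (A u) = 0" by (simp add: u_def LA)
    ultimately have "u = 0" using trans by blast
    then have "vjoin 0 (cnj_vec \<omega>) = (0 :: complex ^ ('m + 'd))" using LA(2)[of "vjoin 0 (cnj_vec \<omega>)"] A0 by (simp add: u_def)
    then have "\<forall>l. \<omega> $ l = 0" by (simp add: vec_eq_sum_iff)
    then show "\<omega> = 0" by (simp add: vec_eq_iff)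
  qed
  have Gr: "G j (swap_cnj V) = cnj (G j V)" for j V
    using ps_sum_cnj_ps[of "cps (r j)" "cnj_vec (K V)"]
    by (simp add: G_def K_def complexified_coords_swap Rc_def)
  have Ga: "alg_at 0 (G j)" if "reg = Algebraic" for j
  proof -
    have "algebraic_ps (cps (r j))" using r(1)[of j] that by (intro algebraic_ps_cps) (simp add: ps_class_def)
    then have "alg_at (K 0) (Rc j)" by (simp add: K0 Rc_def algebraic_ps_iff_alg_at)
    then show ?thesis unfolding G_def[abs_def]
      by (rule alg_at_compose_surj[OF _ pK]) (simp add: K_def surj_complexified_coords[OF sL])
  qed
  obtain \<rho> and \<Theta> :: "('m, 'd) theta" where \<rho>: "\<rho> > 0" "admissible_theta reg \<rho> \<Theta>" "polydisc \<rho> \<subseteq> S"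
    and solve: "\<And>X \<omega>. vjoin X \<omega> \<in> polydisc \<rho> \<Longrightarrow> (\<forall>j. G j (vjoin X \<omega>) = 0) \<longleftrightarrow> (\<forall>j. \<omega> $ j = ps_sum (\<Theta> j) X)"
    and refl: "\<And>X j. X \<in> polydisc \<rho> \<Longrightarrow> cnj (ps_sum (\<Theta> j) (theta_refl \<Theta> X)) = X $ Inr (Inr j)"
    by (rule implicit_theta[OF Gh S(2) G0 inj Gr Ga], assumption, assumption, rule that)
  have mem: "t \<in> (\<lambda>p. A (p - p0)) ` M \<longleftrightarrow> p0 + L t \<in> M" for t
  proof
    assume "t \<in> (\<lambda>p. A (p - p0)) ` M"
    then show "p0 + L t \<in> M" by (auto simp: LA)
  next
    assume "p0 + L t \<in> M"
    then have "A ((p0 + L t) - p0) \<in> (\<lambda>p. A (p - p0)) ` M" by (rule imageI)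
    then show "t \<in> (\<lambda>p. A (p - p0)) ` M" by (simp add: LA)
  qed
  have "t \<in> (\<lambda>p. A (p - p0)) ` M \<longleftrightarrow> (\<forall>j. cnj (t $ Inr j) = ps_sum (\<Theta> j) (lift t))" if t: "t \<in> polydisc \<rho>" for t
  proof -
    let ?V = "vjoin (lift t) (cnj_vec (w_part t))"
    have "w_part t \<in> polydisc \<rho>" using t by (simp add: polydisc_def)
    then have V: "?V \<in> polydisc \<rho>" using t by simp
    have KV: "K ?V = cvec (real_coords (L t))" unfolding K_def by (rule complexified_coords_real)
    have "K ?V \<in> polydisc \<rho>0" using subsetD[OF \<rho>(3) V] by (simp only: S_def vimage_eq)
    then have "real_coords ((p0 + L t) - p0) \<in> polydisc \<rho>0" by (simp add: KV)
    from eqs[OF this] have "p0 + L t \<in> M \<longleftrightarrow> (\<forall>j. ps_sum (r j) (real_coords (L t)) = 0)" by simp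
    also have "\<dots> \<longleftrightarrow> (\<forall>j. G j ?V = 0)" by (simp add: G_def KV Rreal)
    also have "\<dots> \<longleftrightarrow> (\<forall>j. cnj (t $ Inr j) = ps_sum (\<Theta> j) (lift t))" using solve[OF V] by simp
    finally show ?thesis by (simp add: mem)
  qed
  then have "(\<lambda>p. A (p - p0)) ` M \<inter> polydisc \<rho> = theta_set \<rho> \<Theta>"
    unfolding set_eq_iff Int_iff theta_set_iff by blast
  then show thesis using that[OF \<rho>(1,2) _ refl] by blast
qed

text \<open>
  The two functional equations are conjugate to each other, so the second implies the first.
\<close>

lemma functional_equationsI:
  fixes \<Theta> :: "('m::finite, 'd::finite) theta"
  assumes \<rho>: "\<rho> > 0" and refl: "\<And>X j. X \<in> polydisc \<rho> \<Longrightarrow> cnj (ps_sum (\<Theta> j) (theta_refl \<Theta> X)) = X $ Inr (Inr j)"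
  shows "functional_equations \<Theta>"
proof -
  have 2: "w = theta_map (cnj_theta \<Theta>) z \<zeta> (theta_map \<Theta> \<zeta> z w)"
    if "\<zeta> \<in> polydisc \<rho>" "z \<in> polydisc \<rho>" "w \<in> polydisc \<rho>" for \<zeta> z w
    unfolding theta_refl_equation using refl[of "vjoin \<zeta> (vjoin z w)"] that by simp
  have 1: "\<omega> = theta_map \<Theta> \<zeta> z (theta_map (cnj_theta \<Theta>) z \<zeta> \<omega>)"
    if "\<zeta> \<in> polydisc \<rho>" "z \<in> polydisc \<rho>" "\<omega> \<in> polydisc \<rho>" for \<zeta> z \<omega>
  proof -
    have "cnj_vec \<omega> = theta_map (cnj_theta \<Theta>) (cnj_vec \<zeta>) (cnj_vec z) (theta_map \<Theta> (cnj_vec z) (cnj_vec \<zeta>) (cnj_vec \<omega>))"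
      using that by (intro 2) simp_all
    also have "\<dots> = cnj_vec (theta_map \<Theta> \<zeta> z (theta_map (cnj_theta \<Theta>) z \<zeta> \<omega>))"
      by (simp add: theta_map_cnj)
    finally show ?thesis by (metis cnj_vec_cnj_vec)
  qed
  have ev: "\<forall>\<^sub>F x in nhds (0, 0, 0). fst x \<in> polydisc \<rho> \<and> fst (snd x) \<in> polydisc \<rho> \<and> snd (snd x) \<in> polydisc \<rho>"
  proof -
    have "open (polydisc \<rho> \<times> polydisc \<rho> \<times> polydisc \<rho>)" by (intro open_Times open_polydisc)
    from eventually_nhds_in_open[OF this, of "(0, 0, 0)"] \<rho> show ?thesis
      by (auto elim: eventually_mono)
  qed
  have "\<forall>\<^sub>F (\<zeta>, z, \<omega>) in nhds (0, 0, 0). \<omega> = theta_map \<Theta> \<zeta> z (theta_map (cnj_theta \<Theta>) z \<zeta> \<omega>)"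
    using ev
  proof eventually_elim
    case (elim x)
    then show ?case using 1[of "fst x" "fst (snd x)" "snd (snd x)"] by (simp add: case_prod_beta)
  qed
  moreover have "\<forall>\<^sub>F (\<zeta>, z, w) in nhds (0, 0, 0). w = theta_map (cnj_theta \<Theta>) z \<zeta> (theta_map \<Theta> \<zeta> z w)"
    using ev
  proof eventually_elim
    case (elim x)
    then show ?case using 2[of "fst x" "fst (snd x)" "snd (snd x)"] by (simp add: case_prod_beta)
  qed
  ultimately show ?thesis unfolding functional_equations_def zero_prod_def by simp
qed

theorem theorem2p1p22:
  fixes reg :: regularity
  shows
    "(\<forall>(M :: (complex ^ 'n::finite) set) p0 (A :: complex ^ 'n \<Rightarrow> complex ^ ('m::finite + 'd::finite)).
        CARD('n) = CARD('m) + CARD('d) \<and>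
        generic_submanifold reg CARD('d) M \<and> p0 \<in> M \<and>
        Vector_Spaces.linear (*s) (*s) A \<and> bij A \<and>
        complex_tangent_space M p0 \<inter> {v. z_part (A v) = 0} = {0} \<longrightarrow>
        (let N = (\<lambda>p. A (p - p0)) ` M in
          \<exists>\<rho>1>0. \<exists>\<Theta> :: ('m, 'd) theta.
            admissible_theta reg \<rho>1 \<Theta> \<and>
            N \<inter> polydisc \<rho>1 = theta_set \<rho>1 \<Theta> \<and>
            N \<inter> polydisc \<rho>1 = cnj_theta_set \<rho>1 \<Theta> \<and>
            (\<forall>\<rho>'>0. \<forall>\<Theta>'. admissible_theta reg \<rho>' \<Theta>' \<and>
                N \<inter> polydisc \<rho>' = theta_set \<rho>' \<Theta>' \<longrightarrow> \<Theta>' = \<Theta>) \<and>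
            functional_equations \<Theta> \<and>
            L_bar_basis \<Theta> (N \<inter> polydisc \<rho>1)))
     \<and>
     (\<forall>\<rho>1>0. \<forall>\<Theta> :: ('m, 'd) theta. admissible_theta reg \<rho>1 \<Theta> \<longrightarrow>
        (functional_equations_on (2 * \<rho>1) \<Theta> \<longrightarrow>
           generic_submanifold reg CARD('d) (theta_set \<rho>1 \<Theta>) \<and>
           L_bar_basis \<Theta> (theta_set \<rho>1 \<Theta>)) \<and>
        (functional_equations \<Theta> \<longrightarrow>
           (\<exists>\<rho>>0. \<rho> \<le> \<rho>1 \<and>
              generic_submanifold reg CARD('d) (theta_set \<rho>1 \<Theta> \<inter> polydisc \<rho>) \<and>
              L_bar_basis \<Theta> (theta_set \<rho>1 \<Theta> \<inter> polydisc \<rho>))))"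
proof (intro conjI allI impI)
  fix M :: "(complex ^ 'n) set" and p0 and A :: "complex ^ 'n \<Rightarrow> complex ^ ('m + 'd)"
  assume hyp: "CARD('n) = CARD('m) + CARD('d) \<and>
        generic_submanifold reg CARD('d) M \<and> p0 \<in> M \<and>
        Vector_Spaces.linear (*s) (*s) A \<and> bij A \<and>
        complex_tangent_space M p0 \<inter> {v. z_part (A v) = 0} = {0}"
  define N where "N = (\<lambda>p. A (p - p0)) ` M"
  obtain \<rho> and \<Theta> :: "('m, 'd) theta" where \<rho>: "\<rho> > 0" and adm: "admissible_theta reg \<rho> \<Theta>"
    and N: "N \<inter> polydisc \<rho> = theta_set \<rho> \<Theta>"
    and refl: "\<And>X j. X \<in> polydisc \<rho> \<Longrightarrow> cnj (ps_sum (\<Theta> j) (theta_refl \<Theta> X)) = X $ Inr (Inr j)"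
    unfolding N_def by (rule theta_exists[of reg M p0 A]) (use hyp in \<open>auto simp: generic_submanifold_def\<close>)
  have pts: "theta_pt \<rho> \<Theta> (theta_set \<rho> \<Theta>) p" if p: "p \<in> theta_set \<rho> \<Theta>" for p
  proof (rule theta_ptI[OF adm p])
    have "lift p \<in> polydisc \<rho>" using p by (simp add: theta_set_iff)
    from eventually_nhds_in_open[OF open_polydisc this]
    show "\<forall>\<^sub>F X in nhds (lift p). \<forall>j. cnj (ps_sum (\<Theta> j) (theta_refl \<Theta> X)) = X $ Inr (Inr j)"
      by eventually_elim (simp add: refl)
  qed simp
  have basis: "L_bar_basis \<Theta> (theta_set \<rho> \<Theta>)"
    using generic_and_basis_of_points[OF adm pts] by blast
  show "let N = (\<lambda>p. A (p - p0)) ` M in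
          \<exists>\<rho>1>0. \<exists>\<Theta> :: ('m, 'd) theta.
            admissible_theta reg \<rho>1 \<Theta> \<and>
            N \<inter> polydisc \<rho>1 = theta_set \<rho>1 \<Theta> \<and>
            N \<inter> polydisc \<rho>1 = cnj_theta_set \<rho>1 \<Theta> \<and>
            (\<forall>\<rho>'>0. \<forall>\<Theta>'. admissible_theta reg \<rho>' \<Theta>' \<and>
                N \<inter> polydisc \<rho>' = theta_set \<rho>' \<Theta>' \<longrightarrow> \<Theta>' = \<Theta>) \<and>
            functional_equations \<Theta> \<and>
            L_bar_basis \<Theta> (N \<inter> polydisc \<rho>1)"
    unfolding Let_def N_def[symmetric]
  proof (intro exI[of _ \<rho>] exI[of _ \<Theta>] conjI allI impI)
    show "N \<inter> polydisc \<rho> = cnj_theta_set \<rho> \<Theta>" by (simp add: cnj_theta_set_eq N)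
    show "functional_equations \<Theta>" by (rule functional_equationsI[OF \<rho> refl])
    show "L_bar_basis \<Theta> (N \<inter> polydisc \<rho>)" unfolding N by (rule basis)
    show "\<Theta>' = \<Theta>" if "0 < \<rho>'" "admissible_theta reg \<rho>' \<Theta>' \<and> N \<inter> polydisc \<rho>' = theta_set \<rho>' \<Theta>'" for \<rho>' \<Theta>'
      by (rule theta_unique[OF adm _ \<rho> that(1) N _ pts]) (use that(2) in auto)
  qed (fact \<rho> adm N)+
next
  fix \<rho>1 :: real and \<Theta> :: "('m, 'd) theta"
  assume \<rho>1: "0 < \<rho>1" and adm: "admissible_theta reg \<rho>1 \<Theta>"
  {
    assume "functional_equations_on (2 * \<rho>1) \<Theta>"
    from converse_direction[OF adm \<rho>1 this]
    show "generic_submanifold reg CARD('d) (theta_set \<rho>1 \<Theta>)" "L_bar_basis \<Theta> (theta_set \<rho>1 \<Theta>)" by blast+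
  }
  assume "functional_equations \<Theta>"
  from converse_direction_germ[OF adm \<rho>1 this]
  show "\<exists>\<rho>>0. \<rho> \<le> \<rho>1 \<and> generic_submanifold reg CARD('d) (theta_set \<rho>1 \<Theta> \<inter> polydisc \<rho>) \<and>
      L_bar_basis \<Theta> (theta_set \<rho>1 \<Theta> \<inter> polydisc \<rho>)" .
qed

end
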